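(* For the conifold algebra $\Lambda_c$, the representation variety $\mathrm{rep}_2\Lambda_c$ is a smooth affine variety having three disjoint irreducible components. Two of these components are a point, and the third component $\mathrm{trep}_2\Lambda_c$ has dimension $6$. In particular, the conifold algebra $\Lambda_c$ is a smooth order (whence the map $\psi:\mathrm{spec}\,\Lambda_c\to\mathrm{spec}\,R_c$, $P\mapsto P\cap R_c$, can be viewed as a non-commutative desingularization).
   Context: The conifold algebra is $$\Lambda_c=\frac{\mathbb{C}\langle X,Y,Z\rangle}{(Z^2-1,\ XZ+ZX,\ YZ+ZY,\ [X^2,Y],\ [Y^2,X])},\qquad [A,B]=AB-BA.$$ Its center $R_c$ is isomorphic to $\mathbb{C}[a,b,c,d]/(ab-cd)$ and $\Lambda_c$ is an $R_c$-order in a central simple algebra of dimension $4=2^2$ over the fraction field of $R_c$. $\mathrm{rep}_2\Lambda_c$ is the affine scheme of all algebra maps $\phi:\Lambda_c\to M_2(\mathbb{C})$. $\mathrm{trep}_2\Lambda_c$ is the scheme of trace preserving ones, i.e. those with $\phi(tr(a))=\mathrm{Tr}(\phi(a))1_2$ for all $a$, where $tr:\Lambda_c\to R_c$ is the reduced trace; equivalently, the component of those $\phi$ with $\mathrm{Tr}\,\phi(X)=\mathrm{Tr}\,\phi(Y)=\mathrm{Tr}\,\phi(Z)=0$. An order $\Lambda$ in a central simple algebra of dimension $n^2$ is called a smooth order if $\mathrm{trep}_n\Lambda$ is a smooth variety. $\mathrm{spec}\,\Lambda_c$ is the set of two-sided prime ideals of $\Lambda_c$. Calling $\psi$ a "non-commutative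 desingularization" is terminology expressing that $\Lambda_c$ is a smooth order with center $R_c$ and that $\psi$ is bijective away from the singular point. *)

theory Defs
  imports "HOL-Analysis.Analysis" "HOL-Algebra.Algebra" "HOL-Algebra.Algebraic_Closure_Type" "HOL-Library.Poly_Mapping"
begin

no_notation fps_nth (infixl \<open>$\<close> 75)

section \<open>Closed subschemes of affine space over the complex numbers\<close>

type_synonym 'v mpoly = "('v \<Rightarrow>\<^sub>0 nat) \<Rightarrow>\<^sub>0 complex"

definition mvar :: "'v \<Rightarrow> 'v mpoly" where
  "mvar x = Poly_Mapping.single (Poly_Mapping.single x 1) 1"

definition mconst :: "complex \<Rightarrow> 'v mpoly" where
  "mconst c = Poly_Mapping.single 0 c"

definition meval :: "('v::finite) mpoly \<Rightarrow> complex ^ 'v \<Rightarrow> complex" where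
  "meval p v = (\<Sum>m\<in>Poly_Mapping.keys p. Poly_Mapping.lookup p m *
     (\<Prod>i\<in>UNIV. (v $ i) ^ Poly_Mapping.lookup m i))"

text \<open>The value at \<open>v\<close> of the formal partial derivative of \<open>p\<close> with respect to \<open>i\<close>.\<close>

definition mdiff :: "'v \<Rightarrow> ('v::finite) mpoly \<Rightarrow> complex ^ 'v \<Rightarrow> complex" where
  "mdiff i p v = (\<Sum>m\<in>Poly_Mapping.keys p. Poly_Mapping.lookup p m *
     (of_nat (Poly_Mapping.lookup m i) * (v $ i) ^ (Poly_Mapping.lookup m i - 1) *
       (\<Prod>j\<in>UNIV - {i}. (v $ j) ^ Poly_Mapping.lookup m j)))"

text \<open>
  An ideal \<open>I\<close> of polynomials stands for the affine scheme with coordinate ring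
  \<open>ring_of_type_algebra Quot I\<close>. Its closed points are the common zeros of \<open>I\<close>; the scheme
  structure (nilpotents included) is visible in the Zariski tangent spaces.
\<close>

definition zeros :: "('v::finite) mpoly set \<Rightarrow> (complex ^ 'v) set" where
  "zeros I = {v. \<forall>p\<in>I. meval p v = 0}"

definition tangent_space :: "('v::finite) mpoly set \<Rightarrow> complex ^ 'v \<Rightarrow> (complex ^ 'v) set" where
  "tangent_space I v = {\<xi>. \<forall>p\<in>I. (\<Sum>i\<in>UNIV. mdiff i p v * \<xi> $ i) = 0}"

definition zariski_closed :: "(complex ^ 'v::finite) set \<Rightarrow> bool" where
  "zariski_closed Z \<longleftrightarrow> (\<exists>F. Z = zeros F)"

definition irreducible_closed :: "(complex ^ 'v::finite) set \<Rightarrow> bool" where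
  "irreducible_closed Z \<longleftrightarrow> zariski_closed Z \<and> Z \<noteq> {} \<and>
     (\<forall>A B. zariski_closed A \<and> zariski_closed B \<and> Z \<subseteq> A \<union> B \<longrightarrow> Z \<subseteq> A \<or> Z \<subseteq> B)"

definition irreducible_components :: "(complex ^ 'v::finite) set \<Rightarrow> (complex ^ 'v) set set" where
  "irreducible_components V = {Z. irreducible_closed Z \<and> Z \<subseteq> V \<and>
     (\<forall>Z'. irreducible_closed Z' \<and> Z \<subseteq> Z' \<and> Z' \<subseteq> V \<longrightarrow> Z' = Z)}"

text \<open>
  Krull dimension of the Zariski topology on \<open>V\<close>, and at a point \<open>v\<close> of a closed \<open>V\<close> (that is,
  the Krull dimension of the local ring at \<open>v\<close>).
\<close>

definition irreducible_chain :: "(complex ^ 'v::finite) set \<Rightarrow> nat \<Rightarrow> (nat \<Rightarrow> (complex ^ 'v) set) \<Rightarrow> bool" where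
  "irreducible_chain V n C \<longleftrightarrow>
     (\<forall>k\<le>n. irreducible_closed (C k) \<and> C k \<subseteq> V) \<and> (\<forall>k<n. C k \<subset> C (Suc k))"

definition variety_dim :: "(complex ^ 'v::finite) set \<Rightarrow> enat" where
  "variety_dim V = Sup {enat n | n. \<exists>C. irreducible_chain V n C}"

definition local_dim :: "(complex ^ 'v::finite) set \<Rightarrow> complex ^ 'v \<Rightarrow> enat" where
  "local_dim V v = Sup {enat n | n. \<exists>C. irreducible_chain V n C \<and> v \<in> C 0}"

text \<open>
  Regularity of the local ring at \<open>v\<close>: the Zariski tangent space has the dimension of the local
  ring. Over the complex numbers, smoothness can be tested at closed points.
\<close>

definition smooth_at :: "('v::finite) mpoly set \<Rightarrow> complex ^ 'v \<Rightarrow> bool" where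
  "smooth_at I v \<longleftrightarrow> enat (vec.dim (tangent_space I v)) = local_dim (zeros I) v"

definition smooth_scheme :: "('v::finite) mpoly set \<Rightarrow> bool" where
  "smooth_scheme I \<longleftrightarrow> (\<forall>v\<in>zeros I. smooth_at I v)"

section \<open>Finitely generated algebras\<close>

datatype 'g fmon = FMon "'g list"

instantiation fmon :: (type) monoid_add
begin

definition zero_fmon :: "'a fmon" where "zero_fmon = FMon []"

fun plus_fmon :: "'a fmon \<Rightarrow> 'a fmon \<Rightarrow> 'a fmon" where
  "plus_fmon (FMon xs) (FMon ys) = FMon (xs @ ys)"

instance
proof
  fix a b c :: "'a fmon"
  show "a + b + c = a + (b + c)" by (cases a; cases b; cases c) simp
  show "0 + a = a" by (cases a) (simp add: zero_fmon_def)
  show "a + 0 = a" by (cases a) (simp add: zero_fmon_def)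
qed

end

text \<open>The free associative algebra is the monoid algebra of the free monoid.\<close>

type_synonym 'g falg = "'g fmon \<Rightarrow>\<^sub>0 complex"

definition fvar :: "'g \<Rightarrow> 'g falg" where
  "fvar g = Poly_Mapping.single (FMon [g]) 1"

definition fconst :: "complex \<Rightarrow> 'g falg" where
  "fconst c = Poly_Mapping.single 0 c"

definition relation_ideal :: "'g falg set \<Rightarrow> 'g falg set" where
  "relation_ideal S = genideal ring_of_type_algebra S"

text \<open>The algebra generated by \<open>'g\<close> with relations \<open>S\<close>; its elements are cosets of the two-sided
  ideal generated by \<open>S\<close>.\<close>

definition presented :: "'g falg set \<Rightarrow> 'g falg set ring" where
  "presented S = ring_of_type_algebra Quot (relation_ideal S)"

definition residue_class :: "'g falg set \<Rightarrow> 'g falg \<Rightarrow> 'g falg set" where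
  "residue_class S f = relation_ideal S +>\<^bsub>ring_of_type_algebra\<^esub> f"

section \<open>Representation schemes\<close>

primrec monomial_eval :: "('g \<Rightarrow> 'c::comm_ring_1 ^ 'n ^ 'n) \<Rightarrow> 'g fmon \<Rightarrow> 'c ^ 'n ^ 'n" where
  "monomial_eval M (FMon gs) = foldr (\<lambda>g A. M g ** A) gs (mat 1)"

text \<open>Evaluation at matrices over a commutative algebra with structure map \<open>\<kappa>\<close>.\<close>

definition free_eval ::
    "(complex \<Rightarrow> 'c::comm_ring_1) \<Rightarrow> ('g \<Rightarrow> 'c ^ 'n ^ 'n) \<Rightarrow> 'g falg \<Rightarrow> 'c ^ 'n ^ 'n" where
  "free_eval \<kappa> M f = (\<Sum>w\<in>Poly_Mapping.keys f. mat (\<kappa> (Poly_Mapping.lookup f w)) ** monomial_eval M w)"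

definition generic_matrix :: "'g \<Rightarrow> ('g \<times> 'n \<times> 'n) mpoly ^ 'n ^ 'n" where
  "generic_matrix g = (\<chi> i j. mvar (g, i, j))"

abbreviation generic_eval :: "'g falg \<Rightarrow> ('g \<times> 'n \<times> 'n) mpoly ^ 'n ^ 'n" where
  "generic_eval \<equiv> free_eval mconst generic_matrix"

definition rep_ideal :: "'g falg set \<Rightarrow> ('g \<times> 'n::finite \<times> 'n) mpoly set" where
  "rep_ideal S = genideal ring_of_type_algebra
     {generic_eval f $ i $ j | f i j. f \<in> relation_ideal S}"

definition centre :: "('a, 'm) ring_scheme \<Rightarrow> 'a set" where
  "centre R = {z \<in> carrier R. \<forall>x\<in>carrier R. z \<otimes>\<^bsub>R\<^esub> x = x \<otimes>\<^bsub>R\<^esub> z}"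

definition centre_ring :: "('a, 'm) ring_scheme \<Rightarrow> ('a, 'm) ring_scheme" where
  "centre_ring R = R\<lparr>carrier := centre R\<rparr>"

subsection \<open>Orders in central simple algebras and the reduced trace\<close>

text \<open>The localization of \<open>R\<close> at the nonzero elements of its centre; the fractions with
  central numerator form the fraction field of the centre when that is a domain.\<close>

definition central_fraction_rel :: "('a, 'm) ring_scheme \<Rightarrow> (('a \<times> 'a) \<times> ('a \<times> 'a)) set" where
  "central_fraction_rel R = {((a, s), (b, t)) | a s b t.
     a \<in> carrier R \<and> b \<in> carrier R \<and> s \<in> centre R - {\<zero>\<^bsub>R\<^esub>} \<and> t \<in> centre R - {\<zero>\<^bsub>R\<^esub>} \<and>
     (\<exists>u\<in>centre R - {\<zero>\<^bsub>R\<^esub>}. u \<otimes>\<^bsub>R\<^esub> (a \<otimes>\<^bsub>R\<^esub> t) = u \<otimes>\<^bsub>R\<^esub> (b \<otimes>\<^bsub>R\<^esub> s))}"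

definition central_fraction :: "('a, 'm) ring_scheme \<Rightarrow> 'a \<Rightarrow> 'a \<Rightarrow> ('a \<times> 'a) set" where
  "central_fraction R a s = central_fraction_rel R `` {(a, s)}"

definition central_localization :: "('a, 'm) ring_scheme \<Rightarrow> ('a \<times> 'a) set ring" where
  "central_localization R =
    \<lparr>carrier = (carrier R \<times> (centre R - {\<zero>\<^bsub>R\<^esub>})) // central_fraction_rel R,
     monoid.mult = (\<lambda>p q. \<Union>(a, s)\<in>p. \<Union>(b, t)\<in>q. central_fraction R (a \<otimes>\<^bsub>R\<^esub> b) (s \<otimes>\<^bsub>R\<^esub> t)),
     one = central_fraction R \<one>\<^bsub>R\<^esub> \<one>\<^bsub>R\<^esub>,
     ring.zero = central_fraction R \<zero>\<^bsub>R\<^esub> \<one>\<^bsub>R\<^esub>,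
     add = (\<lambda>p q. \<Union>(a, s)\<in>p. \<Union>(b, t)\<in>q.
       central_fraction R ((a \<otimes>\<^bsub>R\<^esub> t) \<oplus>\<^bsub>R\<^esub> (b \<otimes>\<^bsub>R\<^esub> s)) (s \<otimes>\<^bsub>R\<^esub> t))\<rparr>"

definition central_fraction_field :: "('a, 'm) ring_scheme \<Rightarrow> ('a \<times> 'a) set set" where
  "central_fraction_field R =
     {central_fraction R r s | r s. r \<in> centre R \<and> s \<in> centre R - {\<zero>\<^bsub>R\<^esub>}}"

definition central_simple_algebra :: "('a, 'm) ring_scheme \<Rightarrow> 'a set \<Rightarrow> nat \<Rightarrow> bool" where
  "central_simple_algebra A K d \<longleftrightarrow> ring A \<and> subfield K A \<and> centre A = K \<and>
     (\<forall>I. ideal I A \<longrightarrow> I = {\<zero>\<^bsub>A\<^esub>} \<or> I = carrier A) \<and> ring.dimension A d K (carrier A)"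

text \<open>\<open>R\<close> is an order, over its centre, in a central simple algebra of dimension \<open>n\<^sup>2\<close> over the
  fraction field of the centre; torsion-freeness says that \<open>R\<close> embeds in the localization.\<close>

definition is_order :: "('a, 'm) ring_scheme \<Rightarrow> nat \<Rightarrow> bool" where
  "is_order R n \<longleftrightarrow> ring R \<and> domain (centre_ring R) \<and>
     (\<forall>s\<in>centre R - {\<zero>\<^bsub>R\<^esub>}. \<forall>a\<in>carrier R. s \<otimes>\<^bsub>R\<^esub> a = \<zero>\<^bsub>R\<^esub> \<longrightarrow> a = \<zero>\<^bsub>R\<^esub>) \<and>
     (\<exists>G. finite G \<and> G \<subseteq> carrier R \<and>
        (\<forall>a\<in>carrier R. \<exists>c\<in>G \<rightarrow> centre R. a = (\<Oplus>\<^bsub>R\<^esub>g\<in>G. c g \<otimes>\<^bsub>R\<^esub> g))) \<and>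
     central_simple_algebra (central_localization R) (central_fraction_field R) (n\<^sup>2)"

text \<open>\<open>\<rho>\<close> is a ring map from \<open>A\<close> to the matrices over the field \<open>L\<close> carrying \<open>K\<close> to scalar
  matrices; for central simple \<open>A\<close> of dimension \<open>CARD('n)\<^sup>2\<close> over \<open>K\<close> it extends to an isomorphism of
  \<open>A \<otimes>\<^sub>K L\<close> with the matrix algebra.\<close>

definition splitting ::
    "('a, 'm) ring_scheme \<Rightarrow> 'a set \<Rightarrow> ('l, 'k) ring_scheme \<Rightarrow> ('a \<Rightarrow> 'n::finite \<Rightarrow> 'n \<Rightarrow> 'l) \<Rightarrow> bool" where
  "splitting A K L \<rho> \<longleftrightarrow> field L \<and>
     (\<forall>x\<in>carrier A. \<forall>i j. \<rho> x i j \<in> carrier L) \<and>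
     (\<forall>x\<in>carrier A. \<forall>y\<in>carrier A. \<forall>i j. \<rho> (x \<oplus>\<^bsub>A\<^esub> y) i j = \<rho> x i j \<oplus>\<^bsub>L\<^esub> \<rho> y i j) \<and>
     (\<forall>x\<in>carrier A. \<forall>y\<in>carrier A. \<forall>i j.
        \<rho> (x \<otimes>\<^bsub>A\<^esub> y) i j = (\<Oplus>\<^bsub>L\<^esub>k\<in>UNIV. \<rho> x i k \<otimes>\<^bsub>L\<^esub> \<rho> y k j)) \<and>
     (\<forall>i j. \<rho> \<one>\<^bsub>A\<^esub> i j = (if i = j then \<one>\<^bsub>L\<^esub> else \<zero>\<^bsub>L\<^esub>)) \<and>
     (\<forall>x\<in>K. \<exists>c\<in>carrier L. \<forall>i j. \<rho> x i j = (if i = j then c else \<zero>\<^bsub>L\<^esub>))"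

text \<open>
  The element of \<open>K\<close> that a splitting sends to the scalar matrix of the trace. Taking \<open>L\<close> on the
  carrier type of \<open>A\<close> is no restriction: an algebraic closure of an infinite \<open>K\<close> has the
  cardinality of \<open>K\<close>, and over a finite \<open>K\<close> the algebra \<open>A\<close> is itself a matrix algebra.
\<close>

definition reduced_trace :: "('n::finite) itself \<Rightarrow> ('a, 'm) ring_scheme \<Rightarrow> 'a set \<Rightarrow> 'a \<Rightarrow> 'a" where
  "reduced_trace _ A K a = (THE t. t \<in> K \<and>
     (\<exists>(L :: 'a ring) (\<rho> :: 'a \<Rightarrow> 'n \<Rightarrow> 'n \<Rightarrow> 'a). splitting A K L \<rho> \<and>
        (\<forall>i. \<rho> t i i = (\<Oplus>\<^bsub>L\<^esub>j\<in>UNIV. \<rho> a j j))))"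

definition order_trace :: "('n::finite) itself \<Rightarrow> ('a, 'm) ring_scheme \<Rightarrow> 'a \<Rightarrow> 'a" where
  "order_trace n R a = (THE r. r \<in> centre R \<and> central_fraction R r \<one>\<^bsub>R\<^esub> =
     reduced_trace n (central_localization R) (central_fraction_field R) (central_fraction R a \<one>\<^bsub>R\<^esub>))"

subsection \<open>Trace preserving representations and smooth orders\<close>

definition trep_ideal :: "'g falg set \<Rightarrow> ('g \<times> 'n::finite \<times> 'n) mpoly set" where
  "trep_ideal S = genideal ring_of_type_algebra
     ({generic_eval f $ i $ j | f i j. f \<in> relation_ideal S} \<union>
      {(generic_eval t - mat (trace (generic_eval f))) $ i $ j | t f i j.
         residue_class S t = order_trace TYPE('n) (presented S) (residue_class S f)})"

definition smooth_order :: "('n::finite) itself \<Rightarrow> ('g::finite) falg set \<Rightarrow> bool" where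
  "smooth_order _ S \<longleftrightarrow> is_order (presented S) CARD('n) \<and>
     smooth_scheme (trep_ideal S :: ('g \<times> 'n \<times> 'n) mpoly set)"

section \<open>Prime spectra\<close>

definition prime_spectrum :: "('a, 'm) ring_scheme \<Rightarrow> 'a set set" where
  "prime_spectrum R = {P. ideal P R \<and> P \<noteq> carrier R \<and>
     (\<forall>A B. ideal A R \<and> ideal B R \<and> (\<forall>a\<in>A. \<forall>b\<in>B. a \<otimes>\<^bsub>R\<^esub> b \<in> P) \<longrightarrow> A \<subseteq> P \<or> B \<subseteq> P)}"

definition point_ideal :: "('v::finite) mpoly set \<Rightarrow> complex ^ 'v \<Rightarrow> 'v mpoly set set" where
  "point_ideal I v = {I +>\<^bsub>ring_of_type_algebra\<^esub> f | f. meval f v = 0}"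

section \<open>The conifold algebra\<close>

datatype conifold_gen = GX | GY | GZ

instance conifold_gen :: finite
proof
  have "(UNIV :: conifold_gen set) = {GX, GY, GZ}"
    using conifold_gen.exhaust by auto
  then show "finite (UNIV :: conifold_gen set)" by (metis finite.emptyI finite.insertI)
qed

definition conifold_relations :: "conifold_gen falg set" where
  "conifold_relations =
    (let x = fvar GX; y = fvar GY; z = fvar GZ in
     {z\<^sup>2 - 1, x * z + z * x, y * z + z * y, x\<^sup>2 * y - y * x\<^sup>2, y\<^sup>2 * x - x * y\<^sup>2})"

definition conifold_algebra :: "conifold_gen falg set ring" where
  "conifold_algebra = presented conifold_relations"

definition conifold_rep2 :: "(conifold_gen \<times> 2 \<times> 2) mpoly set" where
  "conifold_rep2 = rep_ideal conifold_relations"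

definition conifold_trep2 :: "(conifold_gen \<times> 2 \<times> 2) mpoly set" where
  "conifold_trep2 = trep_ideal conifold_relations"

text \<open>The cone \<open>a b = c d\<close> in affine 4-space.\<close>

definition cone_ideal :: "4 mpoly set" where
  "cone_ideal = genideal ring_of_type_algebra {mvar 1 * mvar 2 - mvar 3 * mvar 4}"

definition cone_ring :: "4 mpoly set ring" where
  "cone_ring = ring_of_type_algebra Quot cone_ideal"

section \<open>The points of the representation schemes\<close>

lemma pm_induct [case_names zero single add]:
  fixes f :: "'a \<Rightarrow>\<^sub>0 'b::comm_monoid_add"
  assumes "P 0" "\<And>k c. P (Poly_Mapping.single k c)" "\<And>f g. P f \<Longrightarrow> P g \<Longrightarrow> P (f + g)"
  shows "P f"
proof (induction f rule: update_induct)
  case const then show ?case by (rule assms(1))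
next
  case (update f a b)
  have "Poly_Mapping.update a b f = Poly_Mapping.single a b + f"
    using update(1) by (intro poly_mapping_eqI)
      (auto simp: lookup_update lookup_add lookup_single in_keys_iff when_def)
  then show ?case using assms update by metis
qed

lemma meval_superset:
  assumes "finite W" "Poly_Mapping.keys p \<subseteq> W"
  shows "meval p v = (\<Sum>m\<in>W. Poly_Mapping.lookup p m * (\<Prod>i\<in>UNIV. (v $ i) ^ Poly_Mapping.lookup m i))"
  unfolding meval_def using assms by (intro sum.mono_neutral_left) (auto simp: in_keys_iff)

lemma meval_0 [simp]: "meval 0 v = 0" by (simp add: meval_def)

lemma meval_single [simp]:
  "meval (Poly_Mapping.single m c) v = c * (\<Prod>i\<in>UNIV. (v $ i) ^ Poly_Mapping.lookup m i)"
  by (subst meval_superset[where W="{m}"]) auto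

lemma meval_add [simp]: "meval (p + q) v = meval p v + meval q v"
  by (subst (1 2 3) meval_superset[where W="Poly_Mapping.keys p \<union> Poly_Mapping.keys q"])
    (use keys_add[of p q] in \<open>auto simp: lookup_add distrib_right sum.distrib\<close>)

lemma meval_mult [simp]: "meval (p * q) v = meval p v * meval q v"
proof (induction p rule: pm_induct)
  case (single k c)
  show ?case
    by (induction q rule: pm_induct)
      (auto simp: mult_single lookup_add power_add prod.distrib algebra_simps)
qed (auto simp: algebra_simps)

lemma meval_uminus [simp]: "meval (- p) v = - meval p v"
  using meval_add[of p "- p" v] by (simp add: add_eq_0_iff)

lemma meval_diff [simp]: "meval (p - q) v = meval p v - meval q v"
  using meval_add[of p "- q" v] by simp

lemma meval_sum [simp]: "meval (sum f A) v = (\<Sum>x\<in>A. meval (f x) v)"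
  by (induction A rule: infinite_finite_induct) auto

lemma meval_mconst [simp]: "meval (mconst c) v = c"
  by (simp add: mconst_def)

lemma meval_mvar [simp]: "meval (mvar x) v = v $ x"
proof -
  have "(\<Prod>i\<in>UNIV. (v $ i) ^ Poly_Mapping.lookup (Poly_Mapping.single x 1) i)
      = (\<Prod>i\<in>UNIV. if i = x then v $ i else 1)"
    by (intro prod.cong) (auto simp: lookup_single when_def)
  then show ?thesis by (simp add: mvar_def)
qed

lemma mat_mult_nth:
  fixes A :: "'c::comm_ring_1 ^ 'n ^ 'n"
  shows "(mat c ** A) $ i $ j = c * A $ i $ j" "(A ** mat c) $ i $ j = A $ i $ j * c"
proof -
  have "(\<Sum>k\<in>UNIV. (if i = k then c else 0) * A $ k $ j) = (\<Sum>k\<in>UNIV. if k = i then c * A $ i $ j else 0)"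
    by (intro sum.cong) auto
  then show "(mat c ** A) $ i $ j = c * A $ i $ j" by (simp add: matrix_matrix_mult_def mat_def)
  have "(\<Sum>k\<in>UNIV. A $ i $ k * (if k = j then c else 0)) = (\<Sum>k\<in>UNIV. if k = j then A $ i $ j * c else 0)"
    by (intro sum.cong) auto
  then show "(A ** mat c) $ i $ j = A $ i $ j * c" by (simp add: matrix_matrix_mult_def mat_def)
qed

lemma matrix_add_rdistrib: "(A + B) ** C = A ** C + B ** (C :: 'c::comm_ring_1 ^ 'n ^ 'm)"
  by (simp add: vec_eq_iff matrix_matrix_mult_def sum.distrib distrib_right)

lemma mat_mult_commute:
  fixes A :: "'c::comm_ring_1 ^ 'n ^ 'n"
  shows "mat c ** A = A ** mat c"
  by (simp add: vec_eq_iff mat_mult_nth mult.commute)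

lemma mat_mult_mat: "mat c ** mat d = (mat (c * d) :: 'c::comm_ring_1 ^ 'n ^ 'n)"
  unfolding vec_eq_iff mat_mult_nth by (simp add: mat_def)

lemma mat_add: "mat (c + d) = (mat c + mat d :: 'c::comm_ring_1 ^ 'n ^ 'n)"
  by (simp add: vec_eq_iff mat_def)

lemma mat_0 [simp]: "mat 0 = (0 :: 'c::comm_ring_1 ^ 'n ^ 'n)"
  by (simp add: vec_eq_iff mat_def)

lemma zero_matrix_mult [simp]: "(0 :: 'c::comm_ring_1 ^ 'n ^ 'n) ** A = 0" "A ** (0 :: 'c::comm_ring_1 ^ 'n ^ 'n) = 0"
  by (simp_all add: vec_eq_iff matrix_matrix_mult_def)

lemma monomial_eval_add: "monomial_eval M (w + w') = monomial_eval M w ** monomial_eval M w'"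
proof -
  have "foldr (\<lambda>g A. M g ** A) xs B = foldr (\<lambda>g A. M g ** A) xs (mat 1) ** B" for xs B
    by (induction xs) (auto simp: matrix_mul_assoc[symmetric])
  from this[of _ "foldr (\<lambda>g A. M g ** A) _ (mat 1)"] show ?thesis by (cases w; cases w') simp
qed

lemma monomial_eval_0 [simp]: "monomial_eval M 0 = mat 1"
  by (simp add: zero_fmon_def)

locale structure_map =
  fixes \<kappa> :: "complex \<Rightarrow> 'c::comm_ring_1"
  assumes \<kappa>_add: "\<kappa> (c + d) = \<kappa> c + \<kappa> d" and \<kappa>_mult: "\<kappa> (c * d) = \<kappa> c * \<kappa> d" and \<kappa>_1: "\<kappa> 1 = 1"
begin

lemma \<kappa>_0: "\<kappa> 0 = 0" using \<kappa>_add[of 0 0] by simp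

lemma free_eval_superset:
  assumes "finite W" "Poly_Mapping.keys f \<subseteq> W"
  shows "free_eval \<kappa> M f = (\<Sum>w\<in>W. mat (\<kappa> (Poly_Mapping.lookup f w)) ** monomial_eval M w)"
  unfolding free_eval_def using assms by (intro sum.mono_neutral_left) (auto simp: in_keys_iff \<kappa>_0)

lemma free_eval_0 [simp]: "free_eval \<kappa> M 0 = 0" by (simp add: free_eval_def)

lemma free_eval_single [simp]:
  "free_eval \<kappa> M (Poly_Mapping.single w c) = mat (\<kappa> c) ** monomial_eval M w"
  by (subst free_eval_superset[where W="{w}"]) (auto simp: \<kappa>_0)

lemma free_eval_add [simp]: "free_eval \<kappa> M (f + g) = free_eval \<kappa> M f + free_eval \<kappa> M g"
  by (subst (1 2 3) free_eval_superset[where W="Poly_Mapping.keys f \<union> Poly_Mapping.keys g"])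
    (use keys_add[of f g] in \<open>auto simp: lookup_add \<kappa>_add mat_add matrix_add_rdistrib sum.distrib\<close>)

lemma free_eval_mult [simp]: "free_eval \<kappa> M (f * g) = free_eval \<kappa> M f ** free_eval \<kappa> M g"
proof (induction f rule: pm_induct)
  case (single k c)
  show ?case
  proof (induction g rule: pm_induct)
    case (single l d)
    have "mat (\<kappa> c) ** mat (\<kappa> d) ** (monomial_eval M k ** monomial_eval M l)
       = mat (\<kappa> c) ** (mat (\<kappa> d) ** monomial_eval M k) ** monomial_eval M l"
      by (simp add: matrix_mul_assoc)
    also have "\<dots> = mat (\<kappa> c) ** monomial_eval M k ** (mat (\<kappa> d) ** monomial_eval M l)"
      unfolding mat_mult_commute[of "\<kappa> d" "monomial_eval M k"] by (simp add: matrix_mul_assoc)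
    finally show ?case by (simp add: mult_single monomial_eval_add \<kappa>_mult flip: mat_mult_mat)
  qed (auto simp: distrib_left matrix_add_ldistrib)
qed (auto simp: distrib_right matrix_add_rdistrib)

lemma free_eval_uminus [simp]: "free_eval \<kappa> M (- f) = - free_eval \<kappa> M f"
  using free_eval_add[of M f "- f"] by (simp add: add_eq_0_iff)

lemma free_eval_fconst [simp]: "free_eval \<kappa> M (fconst c) = mat (\<kappa> c)"
  by (simp add: fconst_def)

lemma free_eval_fvar [simp]: "free_eval \<kappa> M (fvar g) = M g"
  by (simp add: fvar_def \<kappa>_1)

end

interpretation id_map: structure_map "\<lambda>c. c" by standard auto

interpretation mconst_map: structure_map mconst
  by standard (auto simp: mconst_def single_add mult_single)

definition point_matrix :: "complex ^ ('g::finite \<times> 'n::finite \<times> 'n) \<Rightarrow> 'g \<Rightarrow> complex ^ 'n ^ 'n" where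
  "point_matrix v g = (\<chi> i j. v $ (g, i, j))"

lemma meval_matrix_mult:
  "meval ((A ** B) $ i $ j) v = ((\<chi> i j. meval (A $ i $ j) v) ** (\<chi> i j. meval (B $ i $ j) v)) $ i $ j"
  by (simp add: matrix_matrix_mult_def)

lemma meval_mat: "meval (mat c $ i $ j) v = mat (meval c v) $ i $ j"
  by (cases "i = j") (simp_all add: mat_def)

lemma meval_monomial_eval:
  fixes v :: "complex ^ ('g::finite \<times> 'n::finite \<times> 'n)"
  shows "meval (monomial_eval generic_matrix w $ i $ j) v = monomial_eval (point_matrix v) w $ i $ j"
proof (cases w)
  case (FMon gs)
  have "meval (1 :: ('g \<times> 'n \<times> 'n) mpoly) v = 1"
    using meval_mconst[of 1 v] by (simp add: mconst_def)
  moreover have "(\<chi> i j. meval (generic_matrix g $ i $ j) v) = point_matrix v g" for g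
    by (simp add: vec_eq_iff generic_matrix_def point_matrix_def)
  ultimately have "meval (foldr (\<lambda>g A. generic_matrix g ** A) gs (mat 1) $ i $ j) v
     = foldr (\<lambda>g A. point_matrix v g ** A) gs (mat 1) $ i $ j" for i j
  proof (induction gs arbitrary: i j)
    case Nil
    then show ?case by (simp add: meval_mat)
  next
    case (Cons g gs)
    then show ?case by (simp add: meval_matrix_mult)
  qed
  then show ?thesis using FMon by simp
qed

lemma meval_generic_eval:
  fixes f :: "'g::finite falg" and i j :: "'n::finite"
  shows "meval (generic_eval f $ i $ j) v = free_eval (\<lambda>c. c) (point_matrix v) f $ i $ j"
proof (induction f rule: pm_induct)
  case zero
  show ?case by simp
next
  case (single w c)
  show ?case by (simp add: mat_mult_nth meval_monomial_eval)
next
  case (add f g)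
  then show ?case by simp
qed

lemma type_ring_simps:
  "carrier ring_of_type_algebra = UNIV"
  "a \<otimes>\<^bsub>ring_of_type_algebra\<^esub> b = a * b"
  "a \<oplus>\<^bsub>ring_of_type_algebra\<^esub> b = a + b"
  "\<one>\<^bsub>ring_of_type_algebra\<^esub> = 1"
  "\<zero>\<^bsub>ring_of_type_algebra\<^esub> = 0"
  by (simp_all add: ring_of_type_algebra_def)

lemma ideal_vanishing:
  fixes v :: "complex ^ 'v::finite"
  shows "ideal {p. meval p v = 0} (ring_of_type_algebra :: 'v mpoly ring)"
proof -
  interpret R: cring "ring_of_type_algebra :: 'v mpoly ring" by (rule cring_from_type_algebra)
  have m: "\<ominus>\<^bsub>ring_of_type_algebra\<^esub> a = - a" for a :: "'v mpoly"
    by (rule R.minus_equality) (simp_all add: type_ring_simps)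
  show ?thesis
  proof (rule idealI)
    show "subgroup {p. meval p v = 0} (add_monoid (ring_of_type_algebra :: 'v mpoly ring))"
    proof (rule R.add.subgroupI)
      show "{p. meval p v = 0} \<noteq> {}" by (auto intro: exI[of _ 0])
    qed (simp_all add: type_ring_simps m)
  qed (simp_all add: R.ring_axioms type_ring_simps)
qed

lemma zeros_genideal:
  fixes F :: "('v::finite) mpoly set"
  shows "zeros (genideal ring_of_type_algebra F) = zeros F"
proof -
  interpret R: cring "ring_of_type_algebra :: 'v mpoly ring" by (rule cring_from_type_algebra)
  have "F \<subseteq> genideal ring_of_type_algebra F"
    by (rule R.genideal_self) (simp add: type_ring_simps)
  moreover have "genideal ring_of_type_algebra F \<subseteq> {p. meval p v = 0}" if "v \<in> zeros F" for v
    by (rule R.genideal_minimal[OF ideal_vanishing]) (use that in \<open>auto simp: zeros_def\<close>)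
  ultimately show ?thesis by (fastforce simp: zeros_def)
qed

definition matrix_ring :: "(complex ^ 'n ^ 'n) ring" where
  "matrix_ring = \<lparr>carrier = UNIV, monoid.mult = (**), one = mat 1, ring.zero = 0, add = (+)\<rparr>"

definition algebra_maps :: "'g falg set \<Rightarrow> ('g falg set \<Rightarrow> complex ^ 'n ^ 'n) set" where
  "algebra_maps S = {\<phi> \<in> ring_hom (presented S) matrix_ring.
     \<forall>c. \<phi> (residue_class S (fconst c)) = mat c}"

lemma ring_falg: "ring (ring_of_type_algebra :: 'g falg ring)"
proof -
  have "\<exists>y. x + y = 0" for x :: "'g falg"
    using add.right_inverse by blast
  then show ?thesis
    unfolding ring_of_type_algebra_def using add.right_inverse
    by unfold_locales (auto simp: algebra_simps Units_def)
qed

lemma ideal_relation_ideal: "ideal (relation_ideal S) ring_of_type_algebra"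
  unfolding relation_ideal_def
  by (rule ring.genideal_ideal[OF ring_falg]) (simp add: ring_of_type_algebra_def)

lemma residue_class_hom: "residue_class S \<in> ring_hom ring_of_type_algebra (presented S)"
  using ideal.rcos_ring_hom[OF ideal_relation_ideal, of S]
  unfolding residue_class_def presented_def by simp

lemma carrier_presented: "carrier (presented S) = range (residue_class S)"
  by (auto simp: presented_def FactRing_def A_RCOSETS_def RCOSETS_def residue_class_def a_r_coset_def
      ring_of_type_algebra_def)

lemma residue_class_eq_iff: "residue_class S f = residue_class S g \<longleftrightarrow> f - g \<in> relation_ideal S"
proof -
  interpret I: ideal "relation_ideal S" "ring_of_type_algebra :: 'a falg ring"
    by (rule ideal_relation_ideal)
  have m: "\<ominus>\<^bsub>ring_of_type_algebra\<^esub> a = - a" for a :: "'a falg"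
    by (rule I.minus_equality) (simp_all add: ring_of_type_algebra_def)
  have "f \<ominus>\<^bsub>ring_of_type_algebra\<^esub> g = f - g"
    unfolding a_minus_def m by (simp add: ring_of_type_algebra_def)
  then show ?thesis
    using I.quotient_eq_iff_same_a_r_cos[OF I.ideal_axioms, of f g]
    by (simp add: residue_class_def ring_of_type_algebra_def)
qed

lemma presented_simps:
  "residue_class S f \<otimes>\<^bsub>presented S\<^esub> residue_class S g = residue_class S (f * g)"
  "residue_class S f \<oplus>\<^bsub>presented S\<^esub> residue_class S g = residue_class S (f + g)"
  "\<one>\<^bsub>presented S\<^esub> = residue_class S 1"
  using residue_class_hom[of S] by (auto simp: ring_hom_def ring_of_type_algebra_def)

lemma algebra_map_eq_free_eval:
  assumes "\<phi> \<in> algebra_maps S" and "\<And>g. \<phi> (residue_class S (fvar g)) = M g"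
  shows "\<phi> (residue_class S f) = free_eval (\<lambda>c. c) M f"
proof -
  have add: "\<phi> (residue_class S (f + g)) = \<phi> (residue_class S f) + \<phi> (residue_class S g)" for f g
    using assms(1) carrier_presented[of S]
    by (auto simp: algebra_maps_def ring_hom_def matrix_ring_def simp flip: presented_simps)
  have mult: "\<phi> (residue_class S (f * g)) = \<phi> (residue_class S f) ** \<phi> (residue_class S g)" for f g
    using assms(1) carrier_presented[of S]
    by (auto simp: algebra_maps_def ring_hom_def matrix_ring_def simp flip: presented_simps)
  have const: "\<phi> (residue_class S (fconst c)) = mat c" for c
    using assms(1) by (simp add: algebra_maps_def)
  have "\<phi> (residue_class S (Poly_Mapping.single (FMon gs) 1)) = monomial_eval M (FMon gs)" for gs
  proof (induction gs)
    case Nil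
    then show ?case using const[of 1] by (simp add: fconst_def zero_fmon_def)
  next
    case (Cons g gs)
    have "Poly_Mapping.single (FMon (g # gs)) 1 = fvar g * Poly_Mapping.single (FMon gs) (1 :: complex)"
      by (simp add: fvar_def mult_single)
    then show ?case using Cons mult assms(2) by simp
  qed
  then have mono: "\<phi> (residue_class S (Poly_Mapping.single w 1)) = monomial_eval M w" for w
    by (cases w) simp
  show ?thesis
  proof (induction f rule: pm_induct)
    case zero
    show ?case using const[of 0] by (simp add: fconst_def)
  next
    case (single w c)
    have "Poly_Mapping.single w c = fconst c * Poly_Mapping.single w 1"
      by (simp add: fconst_def mult_single)
    then show ?case using mult const mono by simp
  next
    case (add f g)
    then show ?case using \<open>\<And>f g. \<phi> (residue_class S (f + g)) = _\<close> by simp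
  qed
qed

lemma algebra_map_iff:
  fixes M :: "'g \<Rightarrow> complex ^ 'n ^ 'n"
  shows "(\<exists>\<phi>\<in>algebra_maps S. \<forall>g. \<phi> (residue_class S (fvar g)) = M g) \<longleftrightarrow>
    (\<forall>f\<in>relation_ideal S. free_eval (\<lambda>c. c) M f = 0)" (is "?L \<longleftrightarrow> ?R")
proof
  assume ?L
  then obtain \<phi> where \<phi>: "\<phi> \<in> algebra_maps S" "\<And>g. \<phi> (residue_class S (fvar g)) = M g" by blast
  show ?R
  proof
    fix f assume "f \<in> relation_ideal S"
    then have "residue_class S f = residue_class S 0" by (simp add: residue_class_eq_iff)
    then show "free_eval (\<lambda>c. c) M f = 0" using algebra_map_eq_free_eval[OF \<phi>] by (metis id_map.free_eval_0)
  qed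
next
  assume R: ?R
  define \<phi> where "\<phi> C = free_eval (\<lambda>c. c) M (SOME f. residue_class S f = C)" for C
  have \<phi>: "\<phi> (residue_class S f) = free_eval (\<lambda>c. c) M f" for f
  proof -
    have "residue_class S (SOME g. residue_class S g = residue_class S f) = residue_class S f"
      by (rule someI) (rule refl)
    then have "free_eval (\<lambda>c. c) M ((SOME g. residue_class S g = residue_class S f) - f) = 0"
      using R by (simp add: residue_class_eq_iff)
    then show ?thesis
      using id_map.free_eval_add[of M "(SOME g. residue_class S g = residue_class S f) - f" f]
      by (simp add: \<phi>_def)
  qed
  have "free_eval (\<lambda>c. c) M 1 = mat 1"
    using id_map.free_eval_fconst[of M 1] by (simp add: fconst_def)
  then have "\<phi> \<in> algebra_maps S"
    by (auto simp: algebra_maps_def ring_hom_def matrix_ring_def carrier_presented presented_simps \<phi>)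
  then show ?L using \<phi> by (auto intro!: bexI[of _ \<phi>])
qed

lemma matrix_eq_0_iff: "A = 0 \<longleftrightarrow> (\<forall>i j. A $ i $ j = 0)" for A :: "'c::zero ^ 'n ^ 'm"
  by (simp add: vec_eq_iff)

text \<open>The closed points of \<open>rep_ideal S\<close> are the algebra maps to matrices, and those of
  \<open>trep_ideal S\<close> are the trace preserving ones.\<close>

theorem zeros_rep_ideal:
  fixes v :: "complex ^ ('g::finite \<times> 'n::finite \<times> 'n)"
  shows "v \<in> zeros (rep_ideal S) \<longleftrightarrow>
    (\<exists>\<phi>\<in>algebra_maps S. \<forall>g. \<phi> (residue_class S (fvar g)) = point_matrix v g)"
proof -
  have "v \<in> zeros (rep_ideal S) \<longleftrightarrow>
     (\<forall>f\<in>relation_ideal S. \<forall>i j. meval (generic_eval f $ i $ j) v = 0)"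
    unfolding rep_ideal_def zeros_genideal unfolding zeros_def by blast
  then show ?thesis unfolding algebra_map_iff meval_generic_eval matrix_eq_0_iff .
qed

theorem zeros_trep_ideal:
  fixes v :: "complex ^ ('g::finite \<times> 'n::finite \<times> 'n)"
  assumes tr: "\<And>a. a \<in> carrier (presented S) \<Longrightarrow>
    order_trace TYPE('n) (presented S) a \<in> carrier (presented S)"
  shows "v \<in> zeros (trep_ideal S) \<longleftrightarrow>
    (\<exists>\<phi>\<in>algebra_maps S. (\<forall>g. \<phi> (residue_class S (fvar g)) = point_matrix v g) \<and>
       (\<forall>a\<in>carrier (presented S). \<phi> (order_trace TYPE('n) (presented S) a) = mat (trace (\<phi> a))))"
    (is "_ \<longleftrightarrow> ?R")
proof -
  let ?ev = "free_eval (\<lambda>c. c) (point_matrix v)"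
  let ?tr = "order_trace TYPE('n) (presented S)"
  have tr_ev: "meval (trace (generic_eval f :: ('g \<times> 'n \<times> 'n) mpoly ^ 'n ^ 'n)) v = trace (?ev f)" for f
    by (simp add: trace_def meval_generic_eval)
  have ev: "meval ((generic_eval t - mat (trace (generic_eval f))) $ i $ j) v
      = (?ev t - mat (trace (?ev f))) $ i $ j" for t f and i j :: 'n
    by (simp add: meval_generic_eval mat_def tr_ev)
  have "v \<in> zeros (trep_ideal S) \<longleftrightarrow>
     (\<forall>f\<in>relation_ideal S. \<forall>i j. meval (generic_eval f $ i $ j) v = 0) \<and>
     (\<forall>t f. residue_class S t = ?tr (residue_class S f) \<longrightarrow>
       (\<forall>i j. meval ((generic_eval t - mat (trace (generic_eval f))) $ i $ j) v = 0))"
    unfolding trep_ideal_def zeros_genideal unfolding zeros_def by blast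
  also have "\<dots> \<longleftrightarrow> (\<forall>f\<in>relation_ideal S. ?ev f = 0) \<and>
     (\<forall>t f. residue_class S t = ?tr (residue_class S f) \<longrightarrow> ?ev t - mat (trace (?ev f)) = 0)"
    unfolding ev unfolding meval_generic_eval matrix_eq_0_iff ..
  finally have 1: "v \<in> zeros (trep_ideal S) \<longleftrightarrow>
     (\<exists>\<phi>\<in>algebra_maps S. \<forall>g. \<phi> (residue_class S (fvar g)) = point_matrix v g) \<and>
     (\<forall>t f. residue_class S t = ?tr (residue_class S f) \<longrightarrow> ?ev t = mat (trace (?ev f)))"
    unfolding algebra_map_iff by simp
  have 2: "(\<forall>t f. residue_class S t = ?tr (residue_class S f) \<longrightarrow> ?ev t = mat (trace (?ev f))) \<longleftrightarrow>
      (\<forall>a\<in>carrier (presented S). \<phi> (?tr a) = mat (trace (\<phi> a)))" (is "?A \<longleftrightarrow> ?B")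
    if "\<phi> \<in> algebra_maps S" "\<forall>g. \<phi> (residue_class S (fvar g)) = point_matrix v g" for \<phi>
  proof -
    have \<phi>: "\<phi> (residue_class S f) = ?ev f" for f
      by (rule algebra_map_eq_free_eval) (use that in simp_all)
    show ?thesis
    proof
      assume A: ?A
      show ?B
      proof
        fix a assume a: "a \<in> carrier (presented S)"
        obtain f where f: "a = residue_class S f" using a carrier_presented by blast
        obtain t where t: "?tr a = residue_class S t" using tr[OF a] carrier_presented by blast
        then have "?ev t = mat (trace (?ev f))" using A f by metis
        then show "\<phi> (?tr a) = mat (trace (\<phi> a))" unfolding t unfolding f \<phi> .
      qed
    next
      assume B: ?B
      show ?A
      proof (intro allI impI)
        fix t f assume t: "residue_class S t = ?tr (residue_class S f)"
        have "residue_class S f \<in> carrier (presented S)" using carrier_presented by blast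
        then have "\<phi> (?tr (residue_class S f)) = mat (trace (\<phi> (residue_class S f)))" using B by blast
        then show "?ev t = mat (trace (?ev f))" unfolding t[symmetric] \<phi> .
      qed
    qed
  qed
  show ?thesis unfolding 1 using 2 by blast
qed

end

theory Submission
  imports Defs "HOL-Library.Function_Algebras" "HOL-Computational_Algebra.Fraction_Field"
begin

text \<open>
  Over \<open>S = \<complex>[x\<^sub>1, y\<^sub>1, x\<^sub>2, y\<^sub>2]\<close>, graded by \<open>deg x\<^sub>1 = deg y\<^sub>1 = 1 = - deg x\<^sub>2 = - deg y\<^sub>2\<close>, put
  \<open>X = (0, x\<^sub>1; x\<^sub>2, 0)\<close>, \<open>Y = (0, y\<^sub>1; y\<^sub>2, 0)\<close> and \<open>Z = diag(1, -1)\<close>. This identifies the conifold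
  algebra with the matrices whose entries are homogeneous of degrees \<open>(0, 1; -1, 0)\<close>, since modulo
  the relations a word is determined by its image. The centre consists of the scalar matrices over
  \<open>S\<^sub>0 = \<complex>[a, b, c, d]/(ab - cd)\<close>, and adjoining fractions of the centre gives all
  matrices over the fraction field of \<open>S\<^sub>0\<close>, whose trace is the reduced trace. Away from the vertex some
  product \<open>uw\<close> with \<open>u \<in> {x\<^sub>1, y\<^sub>1}\<close>, \<open>w \<in> {x\<^sub>2, y\<^sub>2}\<close> becomes invertible and the algebra is a
  matrix algebra over its centre, which gives the bijection on primes.

  A two-dimensional representation has \<open>Z = \<plusminus>1\<close>, hence \<open>X = Y = 0\<close>, or \<open>Z\<close> of trace zero. In the
  second case it is conjugate to a specialization of the model, hence trace preserving, and these
  representations are covered by six-dimensional charts: two parameters for the pair of eigenlines of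
  \<open>Z\<close>, four for the antidiagonal matrices \<open>X\<close> and \<open>Y\<close>. Dimensions are bounded from above by algebraic
  independence of polynomials along a chain and from below by coordinate subspaces of a chart.
\<close>

section \<open>Polynomial maps into affine space\<close>

text \<open>No generators of the representation ideals beyond the defining ones are computed. The
  zero sets are found from the algebra maps, and the tangent space at a point of the large component
  is squeezed between two bounds. Velocities of curves inside the zero set are tangent to every
  ideal that vanishes there, and the linearized relations \<open>Z ** Z = mat 1\<close>,
  \<open>X ** Z + Z ** X = 0\<close>, \<open>Y ** Z + Z ** Y = 0\<close> leave no further direction.
  Smoothness as a scheme results from this agreement, and the same argument serves the trace
  preserving ideal, whose generators involve the reduced trace.

  The reduced trace is specified through arbitrary splittings, so its value requires that all of
  them agree: a functional that is additive, compatible with scalars, indifferent to the order of a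
  product and equal to 2 at the identity must be the matrix trace. Existence is easier, since the
  localization is already split over its centre.\<close>

lemma has_field_derivative_meval:
  fixes \<gamma> :: "complex \<Rightarrow> complex ^ 'v::finite"
  assumes "\<And>i. ((\<lambda>s. \<gamma> s $ i) has_field_derivative \<xi> $ i) (at s0)"
  shows "((\<lambda>s. meval p (\<gamma> s)) has_field_derivative (\<Sum>i\<in>UNIV. mdiff i p (\<gamma> s0) * \<xi> $ i)) (at s0)"
proof -
  have "((\<lambda>s. \<Sum>m\<in>Poly_Mapping.keys p. Poly_Mapping.lookup p m *
      (\<Prod>i\<in>UNIV. (\<gamma> s $ i) ^ Poly_Mapping.lookup m i)) has_field_derivative
    (\<Sum>m\<in>Poly_Mapping.keys p. Poly_Mapping.lookup p m *
      (\<Sum>i\<in>UNIV. of_nat (Poly_Mapping.lookup m i) * (\<xi> $ i * (\<gamma> s0 $ i) ^ (Poly_Mapping.lookup m i - Suc 0)) *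
        (\<Prod>j\<in>UNIV - {i}. (\<gamma> s0 $ j) ^ Poly_Mapping.lookup m j)))) (at s0)"
    by (intro DERIV_sum DERIV_cmult has_field_derivative_prod DERIV_power assms)
  moreover have "(\<Sum>m\<in>Poly_Mapping.keys p. Poly_Mapping.lookup p m *
      (\<Sum>i\<in>UNIV. of_nat (Poly_Mapping.lookup m i) * (\<xi> $ i * (\<gamma> s0 $ i) ^ (Poly_Mapping.lookup m i - Suc 0)) *
        (\<Prod>j\<in>UNIV - {i}. (\<gamma> s0 $ j) ^ Poly_Mapping.lookup m j)))
    = (\<Sum>i\<in>UNIV. mdiff i p (\<gamma> s0) * \<xi> $ i)"
    unfolding mdiff_def sum_distrib_left sum_distrib_right
    by (subst sum.swap) (simp add: mult_ac)
  ultimately show ?thesis by (simp add: meval_def)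
qed

definition dir_deriv :: "('v::finite) mpoly \<Rightarrow> complex ^ 'v \<Rightarrow> complex ^ 'v \<Rightarrow> complex" where
  "dir_deriv p v \<xi> = (\<Sum>i\<in>UNIV. mdiff i p v * \<xi> $ i)"

text \<open>Uniqueness of analytic derivatives turns this into a characterization of the formal one,
  so the sum and Leibniz rules below come from calculus instead of manipulations of
  monomials.\<close>

lemma dir_deriv_line: "((\<lambda>s. meval p (v + s *s \<xi>)) has_field_derivative dir_deriv p v \<xi>) (at 0)"
  unfolding dir_deriv_def
  by (rule has_field_derivative_meval[of "\<lambda>s. v + s *s \<xi>" \<xi> 0 p, simplified])
    (auto intro!: derivative_eq_intros)

text \<open>This is the source of the lower bound on the tangent spaces of the large component: the
  differential of \<open>p\<close> annihilates velocities of curves on which \<open>p\<close> is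
  constantly zero.\<close>

lemma dir_deriv_curve:
  assumes "\<And>i. ((\<lambda>s. \<gamma> s $ i) has_field_derivative \<xi> $ i) (at 0)" "\<And>s. meval p (\<gamma> s) = 0" "\<gamma> 0 = v"
  shows "dir_deriv p v \<xi> = 0"
proof -
  have "((\<lambda>s. 0) has_field_derivative dir_deriv p v \<xi>) (at 0)"
    using has_field_derivative_meval[of \<gamma> \<xi> 0 p] assms by (simp add: dir_deriv_def)
  then show ?thesis using DERIV_unique[OF _ DERIV_const] by blast
qed

lemma dir_deriv_add [simp]: "dir_deriv (p + q) v \<xi> = dir_deriv p v \<xi> + dir_deriv q v \<xi>"
  by (rule DERIV_unique[OF dir_deriv_line])
    (auto intro!: derivative_eq_intros dir_deriv_line)

lemma dir_deriv_diff [simp]: "dir_deriv (p - q) v \<xi> = dir_deriv p v \<xi> - dir_deriv q v \<xi>"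
  by (rule DERIV_unique[OF dir_deriv_line])
    (auto intro!: derivative_eq_intros dir_deriv_line)

lemma dir_deriv_mult [simp]:
  "dir_deriv (p * q) v \<xi> = dir_deriv p v \<xi> * meval q v + meval p v * dir_deriv q v \<xi>"
  by (rule DERIV_unique[OF dir_deriv_line])
    (auto intro!: derivative_eq_intros dir_deriv_line)

lemma dir_deriv_mvar [simp]: "dir_deriv (mvar i) v \<xi> = \<xi> $ i"
  by (rule DERIV_unique[OF dir_deriv_line]) (auto intro!: derivative_eq_intros)

lemma dir_deriv_mconst [simp]: "dir_deriv (mconst c) v \<xi> = 0"
  by (rule DERIV_unique[OF dir_deriv_line]) (auto intro!: derivative_eq_intros)

lemma meval_1 [simp]: "meval 1 v = 1"
  using meval_mconst[of 1 v] by (simp add: mconst_def)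

lemma dir_deriv_0 [simp]: "dir_deriv 0 v \<xi> = 0"
  by (simp add: dir_deriv_def mdiff_def)

lemma dir_deriv_1 [simp]: "dir_deriv 1 v \<xi> = 0"
  using dir_deriv_mconst[of 1 v \<xi>] by (simp add: mconst_def)

lemma tangent_space_dir_deriv: "tangent_space I v = {\<xi>. \<forall>p\<in>I. dir_deriv p v \<xi> = 0}"
  by (simp add: tangent_space_def dir_deriv_def)

lemma meval_power [simp]: "meval (p ^ n) v = meval p v ^ n"
  by (induction n) auto

text \<open>Polynomial functions are taken semantically, as a closure property of functions of a
  sequence of parameters. One type then serves every number \<open>n\<close> of parameters, and
  composition with \<open>meval\<close> needs only closure.\<close>

inductive pfun :: "nat \<Rightarrow> ((nat \<Rightarrow> complex) \<Rightarrow> complex) \<Rightarrow> bool" for n where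
  const: "pfun n (\<lambda>_. c)"
| coord: "i < n \<Longrightarrow> pfun n (\<lambda>w. w i)"
| add: "pfun n f \<Longrightarrow> pfun n g \<Longrightarrow> pfun n (\<lambda>w. f w + g w)"
| mult: "pfun n f \<Longrightarrow> pfun n g \<Longrightarrow> pfun n (\<lambda>w. f w * g w)"

lemma pfun_uminus: "pfun n f \<Longrightarrow> pfun n (\<lambda>w. - f w)"
  using pfun.mult[OF pfun.const[of n "-1"]] by fastforce

lemma pfun_power: "pfun n f \<Longrightarrow> pfun n (\<lambda>w. f w ^ k)"
  by (induction k) (auto intro: pfun.intros)

lemma pfun_sum: "(\<And>i. i \<in> A \<Longrightarrow> pfun n (f i)) \<Longrightarrow> pfun n (\<lambda>w. \<Sum>i\<in>A. f i w)"
  by (induction A rule: infinite_finite_induct) (auto intro: pfun.intros)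

lemma pfun_prod: "(\<And>i. i \<in> A \<Longrightarrow> pfun n (f i)) \<Longrightarrow> pfun n (\<lambda>w. \<Prod>i\<in>A. f i w)"
  by (induction A rule: infinite_finite_induct) (auto intro: pfun.intros)

definition pmap :: "nat \<Rightarrow> ((nat \<Rightarrow> complex) \<Rightarrow> complex ^ 'v) \<Rightarrow> bool" where
  "pmap n F \<longleftrightarrow> (\<forall>i. pfun n (\<lambda>w. F w $ i))"

lemma pfun_meval: "pmap n F \<Longrightarrow> pfun n (\<lambda>w. meval p (F w))"
  unfolding meval_def pmap_def by (intro pfun_sum pfun.mult pfun.const pfun_prod pfun_power) auto

lemma pfun_line: "pfun n f \<Longrightarrow> \<exists>P. \<forall>t. f (\<lambda>i. a i + t * (b i - a i)) = poly P t"
proof (induction rule: pfun.induct)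
  case (const c)
  show ?case by (intro exI[of _ "[:c:]"]) simp
next
  case (coord i)
  show ?case by (intro exI[of _ "[:a i, b i - a i:]"]) simp
next
  case (add f g)
  then obtain P Q where "\<forall>t. f (\<lambda>i. a i + t * (b i - a i)) = poly P t" "\<forall>t. g (\<lambda>i. a i + t * (b i - a i)) = poly Q t"
    by blast
  then show ?case by (intro exI[of _ "P + Q"]) simp
next
  case (mult f g)
  then obtain P Q where "\<forall>t. f (\<lambda>i. a i + t * (b i - a i)) = poly P t" "\<forall>t. g (\<lambda>i. a i + t * (b i - a i)) = poly Q t"
    by blast
  then show ?case by (intro exI[of _ "P * Q"]) simp
qed

text \<open>Restricted to the line through \<open>a\<close> and \<open>b\<close> both functions
  become univariate polynomials, which have no zero divisors; \<open>t = 0\<close> is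
  \<open>a\<close> and \<open>t = 1\<close> is \<open>b\<close>.\<close>

lemma pfun_no_zero_divisors:
  assumes f: "pfun n f" and g: "pfun n g" and fg: "\<And>w. f w * g w = 0" and a: "f a \<noteq> 0"
  shows "g b = 0"
proof -
  obtain P Q where P: "\<And>t. f (\<lambda>i. a i + t * (b i - a i)) = poly P t"
    and Q: "\<And>t. g (\<lambda>i. a i + t * (b i - a i)) = poly Q t"
    using pfun_line[OF f] pfun_line[OF g] by metis
  have "poly (P * Q) t = 0" for t using fg by (simp flip: P Q)
  then have "P * Q = 0" using poly_all_0_iff_0 by blast
  moreover have "P \<noteq> 0" using P[of 0] a by auto
  ultimately show ?thesis using Q[of 1] by simp
qed

section \<open>Zariski closures of images of polynomial maps\<close>

definition Zariski_closure :: "(complex ^ 'v::finite) set \<Rightarrow> (complex ^ 'v) set" where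
  "Zariski_closure A = zeros {p. \<forall>v\<in>A. meval p v = 0}"

lemma Zariski_closure_superset: "A \<subseteq> Zariski_closure A"
  by (auto simp: Zariski_closure_def zeros_def)

lemma Zariski_closure_minimal: "A \<subseteq> B \<Longrightarrow> zariski_closed B \<Longrightarrow> Zariski_closure A \<subseteq> B"
  unfolding zariski_closed_def Zariski_closure_def zeros_def by blast

lemma Zariski_closure_mono: "A \<subseteq> B \<Longrightarrow> Zariski_closure A \<subseteq> Zariski_closure B"
  unfolding Zariski_closure_def zeros_def by blast

lemma zariski_closed_Zariski_closure: "zariski_closed (Zariski_closure A)"
  unfolding zariski_closed_def Zariski_closure_def by blast

lemma zariski_closed_zeros: "zariski_closed (zeros I)"
  unfolding zariski_closed_def by blast

lemma zariski_closed_eq_closure: "zariski_closed A \<Longrightarrow> Zariski_closure A = A"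
  by (simp add: Zariski_closure_minimal Zariski_closure_superset subset_antisym)

text \<open>Irreducibility of the parameter space passes to the closure of its image: if neither
  \<open>A\<close> nor \<open>B\<close> contained the image, two polynomials that are nonzero
  somewhere on it would multiply to zero along \<open>F\<close>.\<close>

lemma irreducible_closed_Zariski_closure:
  assumes F: "pmap n F"
  shows "irreducible_closed (Zariski_closure (range F))"
  unfolding irreducible_closed_def
proof (intro conjI allI impI)
  show "zariski_closed (Zariski_closure (range F))" by (rule zariski_closed_Zariski_closure)
  show "Zariski_closure (range F) \<noteq> {}" using Zariski_closure_superset by blast
  fix A B
  assume AB: "zariski_closed A \<and> zariski_closed B \<and> Zariski_closure (range F) \<subseteq> A \<union> B"
  then obtain FA FB where A: "A = zeros FA" and B: "B = zeros FB"
    unfolding zariski_closed_def by blast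
  have R: "F w \<in> A \<union> B" for w using AB Zariski_closure_superset by blast
  show "Zariski_closure (range F) \<subseteq> A \<or> Zariski_closure (range F) \<subseteq> B"
  proof (rule ccontr)
    assume *: "\<not> ?thesis"
    then have "\<not> range F \<subseteq> A" "\<not> range F \<subseteq> B" using Zariski_closure_minimal AB by blast+
    then obtain f a g b where f: "f \<in> FA" "meval f (F a) \<noteq> 0" and g: "g \<in> FB" "meval g (F b) \<noteq> 0"
      unfolding A B zeros_def by blast
    have "meval f (F w) * meval g (F w) = 0" for w
      using R[of w] f(1) g(1) unfolding A B zeros_def by auto
    from pfun_no_zero_divisors[OF pfun_meval[OF F] pfun_meval[OF F], OF this, of a b] show False
      using f(2) g(2) by blast
  qed
qed

lemma irreducible_closed_range:
  "pmap n F \<Longrightarrow> zariski_closed (range F) \<Longrightarrow> irreducible_closed (range F)"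
  using irreducible_closed_Zariski_closure zariski_closed_eq_closure by metis

text \<open>Polynomial functions on an irreducible set form a domain. This is how identities checked
  on one chart spread to a whole component.\<close>

lemma irreducible_closed_mult_zero:
  assumes Z: "irreducible_closed Z" and fg: "\<And>z. z \<in> Z \<Longrightarrow> meval f z * meval g z = 0"
    and f: "z0 \<in> Z" "meval f z0 \<noteq> 0" and z: "z \<in> Z"
  shows "meval g z = 0"
proof -
  have "Z \<subseteq> zeros {f} \<union> zeros {g}" using fg by (auto simp: zeros_def)
  then have "Z \<subseteq> zeros {f} \<or> Z \<subseteq> zeros {g}"
    using Z zariski_closed_zeros unfolding irreducible_closed_def by blast
  then show ?thesis using f z by (auto simp: zeros_def)
qed

text \<open>Each strict inclusion is certified by one polynomial: it vanishes on the smaller image,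
  hence on its closure, but not on the next image.\<close>

lemma irreducible_chainI:
  fixes G :: "nat \<Rightarrow> (nat \<Rightarrow> complex) \<Rightarrow> complex ^ 'v::finite"
  assumes G: "\<And>k. k \<le> n \<Longrightarrow> pmap m (G k)"
    and V: "zariski_closed V" "\<And>w. G n w \<in> V"
    and sub: "\<And>k. k < n \<Longrightarrow> range (G k) \<subseteq> range (G (Suc k))"
    and sep: "\<And>k. k < n \<Longrightarrow> \<exists>p. (\<forall>w. meval p (G k w) = 0) \<and> (\<exists>w. meval p (G (Suc k) w) \<noteq> 0)"
  shows "irreducible_chain V n (\<lambda>k. Zariski_closure (range (G k)))"
  unfolding irreducible_chain_def
proof (intro conjI allI impI)
  fix k assume k: "k \<le> n"
  show "irreducible_closed (Zariski_closure (range (G k)))"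
    by (rule irreducible_closed_Zariski_closure[OF G[OF k]])
  have "range (G k) \<subseteq> range (G n)"
    using k
  proof (induction rule: inc_induct)
    case (step j)
    then show ?case using sub[of j] by auto
  qed auto
  then show "Zariski_closure (range (G k)) \<subseteq> V"
    using V by (intro Zariski_closure_minimal) auto
next
  fix k assume k: "k < n"
  obtain p w where p: "\<And>w. meval p (G k w) = 0" and w: "meval p (G (Suc k) w) \<noteq> 0"
    using sep[OF k] by blast
  have "G (Suc k) w \<in> Zariski_closure (range (G (Suc k)))"
    by (rule subsetD[OF Zariski_closure_superset]) simp
  moreover have "G (Suc k) w \<notin> Zariski_closure (range (G k))"
    using p w by (auto simp: Zariski_closure_def zeros_def)
  moreover have "Zariski_closure (range (G k)) \<subseteq> Zariski_closure (range (G (Suc k)))"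
    by (rule Zariski_closure_mono[OF sub[OF k]])
  ultimately show "Zariski_closure (range (G k)) \<subset> Zariski_closure (range (G (Suc k)))" by blast
qed

section \<open>Independent polynomials bound the dimension\<close>

text \<open>Lists put the exponent of the most recently added polynomial at the head, and a bound on
  each entry rather than on the sum makes the count exactly \<open>Suc k ^ m\<close>.\<close>

definition expos :: "nat \<Rightarrow> nat \<Rightarrow> nat list set" where
  "expos m k = {\<alpha>. set \<alpha> \<subseteq> {..k} \<and> length \<alpha> = m}"

definition mons :: "'a::comm_semiring_1 list \<Rightarrow> nat list \<Rightarrow> 'a" where
  "mons us \<alpha> = prod_list (map2 (^) us \<alpha>)"

text \<open>Algebraic independence of the restrictions to \<open>Z\<close>: every polynomial
  relation fits into some box of exponents, so quantifying over \<open>k\<close> loses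
  nothing.\<close>

definition indep_on :: "(complex ^ 'v::finite) set \<Rightarrow> 'v mpoly list \<Rightarrow> bool" where
  "indep_on Z us \<longleftrightarrow> (\<forall>k c. (\<forall>z\<in>Z. (\<Sum>\<alpha>\<in>expos (length us) k. c \<alpha> * meval (mons us \<alpha>) z) = 0) \<longrightarrow>
     (\<forall>\<alpha>\<in>expos (length us) k. c \<alpha> = 0))"

lemma expos_0: "expos 0 k = {[]}"
  by (auto simp: expos_def)

lemma expos_Suc: "expos (Suc m) k = (\<lambda>(j, \<alpha>). j # \<alpha>) ` ({..k} \<times> expos m k)"
  by (force simp: expos_def length_Suc_conv image_iff)

lemma finite_expos: "finite (expos m k)"
  unfolding expos_def by (rule finite_lists_length_eq) simp

lemma card_expos: "card (expos m k) = Suc k ^ m"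
  unfolding expos_def by (subst card_lists_length_eq) auto

lemma mons_Cons [simp]: "mons (u # us) (j # \<alpha>) = u ^ j * mons us \<alpha>"
  by (simp add: mons_def)

lemma mons_Nil [simp]: "mons [] \<alpha> = 1"
  by (simp add: mons_def)

lemma indep_on_Nil: "Z \<noteq> {} \<Longrightarrow> indep_on Z []"
  by (auto simp: indep_on_def expos_0)

lemma sum_expos_Suc:
  "(\<Sum>\<alpha>\<in>expos (Suc m) k. g \<alpha>) = (\<Sum>j\<le>k. \<Sum>\<alpha>\<in>expos m k. g (j # \<alpha>))"
proof -
  have "(\<Sum>\<alpha>\<in>expos (Suc m) k. g \<alpha>) = (\<Sum>(j, \<alpha>)\<in>{..k} \<times> expos m k. g (j # \<alpha>))"
    unfolding expos_Suc by (subst sum.reindex) (auto simp: inj_on_def split_def)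
  then show ?thesis by (simp add: sum.cartesian_product)
qed

text \<open>A polynomial that vanishes on \<open>Z\<close> but not on the larger irreducible set \<open>Z'\<close> is algebraically
  independent on \<open>Z'\<close> of polynomials independent on \<open>Z\<close>: divide a relation by the largest power
  of \<open>f\<close> and restrict it to \<open>Z\<close>.\<close>

lemma indep_on_Cons:
  assumes us: "indep_on Z us" and Z': "irreducible_closed Z'" and sub: "Z \<subseteq> Z'"
    and f: "\<And>z. z \<in> Z \<Longrightarrow> meval f z = 0" and z0: "z0 \<in> Z'" "meval f z0 \<noteq> 0"
  shows "indep_on Z' (f # us)"
  unfolding indep_on_def
proof (intro allI impI)
  fix k c
  let ?m = "length us"
  assume "\<forall>z\<in>Z'. (\<Sum>\<alpha>\<in>expos (length (f # us)) k. c \<alpha> * meval (mons (f # us) \<alpha>) z) = 0"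
  then have rel: "(\<Sum>j\<le>k. meval f z ^ j * (\<Sum>\<alpha>\<in>expos ?m k. c (j # \<alpha>) * meval (mons us \<alpha>) z)) = 0"
    if "z \<in> Z'" for z
    using that by (simp add: sum_expos_Suc sum_distrib_left mult_ac)
  define G where "G j = (\<Sum>\<alpha>\<in>expos ?m k. mconst (c (j # \<alpha>)) * mons us \<alpha>)" for j
  have mG: "meval (G j) z = (\<Sum>\<alpha>\<in>expos ?m k. c (j # \<alpha>) * meval (mons us \<alpha>) z)" for j z
    by (simp add: G_def)
  have "\<forall>\<alpha>\<in>expos ?m k. c (j # \<alpha>) = 0" if "j \<le> k" for j
    using that
  proof (induction j rule: less_induct)
    case (less j)
    have G0: "meval (G i) z = 0" if "i < j" for i z
      using less that by (auto simp: mG intro!: sum.neutral)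
    \<comment> \<open>\<open>H\<close> gathers the higher terms divided by \<open>f ^ Suc j\<close>.
      As the lower coefficients already vanish, the relation reads
      \<open>f ^ j * (G j + f * H) = 0\<close> on \<open>Z'\<close>.\<close>
    define H where "H = (\<Sum>i\<in>{Suc j..k}. f ^ (i - Suc j) * G i)"
    have "meval (f ^ j) z * meval (G j + f * H) z = 0" if z: "z \<in> Z'" for z
    proof -
      have "0 = (\<Sum>i\<le>k. meval f z ^ i * meval (G i) z)" using rel[OF z] by (simp add: mG)
      also have "\<dots> = (\<Sum>i\<in>{j..k}. meval f z ^ i * meval (G i) z)"
        by (rule sum.mono_neutral_right) (auto simp: G0)
      also have "\<dots> = meval f z ^ j * meval (G j) z + (\<Sum>i\<in>{Suc j..k}. meval f z ^ i * meval (G i) z)"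
        using less.prems by (simp add: sum.atLeast_Suc_atMost)
      also have "(\<Sum>i\<in>{Suc j..k}. meval f z ^ i * meval (G i) z)
          = (\<Sum>i\<in>{Suc j..k}. meval f z ^ j * (meval f z * (meval f z ^ (i - Suc j) * meval (G i) z)))"
      proof (rule sum.cong)
        fix i assume "i \<in> {Suc j..k}"
        then have "i = j + Suc (i - Suc j)" by simp
        then have "meval f z ^ i = meval f z ^ j * (meval f z * meval f z ^ (i - Suc j))"
          by (metis power_add power_Suc)
        then show "meval f z ^ i * meval (G i) z
            = meval f z ^ j * (meval f z * (meval f z ^ (i - Suc j) * meval (G i) z))"
          by (simp add: mult_ac)
      qed simp
      finally show ?thesis by (simp add: H_def algebra_simps sum_distrib_left)
    qed
    \<comment> \<open>\<open>Z'\<close> is irreducible and \<open>f\<close> is not identically zero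
      on it, so \<open>f ^ j\<close> cancels; restriction to \<open>Z\<close> then removes the
      multiple of \<open>f\<close>.\<close>
    then have "meval (G j + f * H) z = 0" if "z \<in> Z'" for z
      using irreducible_closed_mult_zero[OF Z' _ z0(1) _ that, of "f ^ j"] z0(2) by fastforce
    then have "meval (G j) z = 0" if "z \<in> Z" for z
      using that sub f by fastforce
    then show ?case
      using us[unfolded indep_on_def, rule_format, of "\<lambda>\<alpha>. c (j # \<alpha>)" k] by (simp add: mG)
  qed
  then show "\<forall>\<alpha>\<in>expos (length (f # us)) k. c \<alpha> = 0" by (auto simp: expos_Suc)
qed

text \<open>Each strict inclusion supplies a polynomial that vanishes on the smaller set but not on
  the larger, so the independent family grows by one at every link.\<close>

lemma irreducible_chain_indep:
  assumes "irreducible_chain V n C"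
  shows "\<exists>us. length us = n \<and> indep_on (C n) us"
  using assms
proof (induction n)
  case 0
  then have "C 0 \<noteq> {}" by (auto simp: irreducible_chain_def irreducible_closed_def)
  then show ?case using indep_on_Nil by (intro exI[of _ "[]"]) auto
next
  case (Suc n)
  then have "irreducible_chain V n C" by (auto simp: irreducible_chain_def)
  then obtain us where us: "length us = n" "indep_on (C n) us" using Suc.IH by blast
  have irr: "irreducible_closed (C n)" "irreducible_closed (C (Suc n))" and sub: "C n \<subset> C (Suc n)"
    using Suc.prems by (auto simp: irreducible_chain_def)
  have "zariski_closed (C n)" using irr(1) by (simp only: irreducible_closed_def)
  then obtain I where I: "C n = zeros I" unfolding zariski_closed_def by (elim exE)
  obtain z where z: "z \<in> C (Suc n)" "z \<notin> zeros I" using sub unfolding I by blast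
  then obtain f where "f \<in> I" "meval f z \<noteq> 0" by (auto simp: zeros_def)
  then have "indep_on (C (Suc n)) (f # us)"
    using us irr sub z(1) by (intro indep_on_Cons[of "C n" us "C (Suc n)" f z]) (auto simp: zeros_def I)
  then show ?case using us by (intro exI[of _ "f # us"]) simp
qed

section \<open>Counting polynomial functions of bounded degree in the parameters\<close>

interpretation fvs: vector_space "\<lambda>(c::complex) (f :: (nat \<Rightarrow> complex) \<Rightarrow> complex) w. c * f w"
  by standard (auto simp: fun_eq_iff algebra_simps)

definition monomial_box :: "nat \<Rightarrow> nat \<Rightarrow> ((nat \<Rightarrow> complex) \<Rightarrow> complex) set" where
  "monomial_box n D = (\<lambda>\<alpha> w. \<Prod>i<n. w i ^ \<alpha> i) ` (PiE {..<n} (\<lambda>_. {..D}))"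

lemma finite_monomial_box: "finite (monomial_box n D)" and card_monomial_box: "card (monomial_box n D) \<le> Suc D ^ n"
proof -
  have "finite (PiE {..<n} (\<lambda>_. {..D}))" by (intro finite_PiE) auto
  then show "finite (monomial_box n D)" "card (monomial_box n D) \<le> Suc D ^ n"
    unfolding monomial_box_def using card_image_le[of "PiE {..<n} (\<lambda>_. {..D})"] by (auto simp: card_PiE)
qed

lemma monomial_box_memI:
  assumes "\<And>i. i < n \<Longrightarrow> \<alpha> i \<le> D"
  shows "(\<lambda>w. \<Prod>i<n. w i ^ \<alpha> i) \<in> monomial_box n D"
proof -
  have "(\<lambda>w::nat \<Rightarrow> complex. \<Prod>i<n. w i ^ \<alpha> i) = (\<lambda>w. \<Prod>i<n. w i ^ restrict \<alpha> {..<n} i)"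
    by (intro ext prod.cong) auto
  moreover have "restrict \<alpha> {..<n} \<in> PiE {..<n} (\<lambda>_. {..D})" using assms by auto
  ultimately show ?thesis unfolding monomial_box_def by blast
qed

lemma monomial_box_mono: "D \<le> D' \<Longrightarrow> monomial_box n D \<subseteq> monomial_box n D'"
  unfolding monomial_box_def by (intro image_mono PiE_mono) auto

lemma span_monomial_box_mult:
  assumes "f \<in> fvs.span (monomial_box n D)" "g \<in> fvs.span (monomial_box n D')"
  shows "f * g \<in> fvs.span (monomial_box n (D + D'))"
  using assms(1)
proof (induction f rule: fvs.span_induct_alt)
  case base
  show ?case by (simp only: mult_zero_left fvs.span_zero)
next
  case (step c x y)
  have "x * g \<in> fvs.span (monomial_box n (D + D'))"
    using assms(2)
  proof (induction g rule: fvs.span_induct_alt)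
    case base
    show ?case by (simp only: mult_zero_right fvs.span_zero)
  next
    case (step d u v)
    obtain \<alpha> \<beta> where \<alpha>: "\<alpha> \<in> PiE {..<n} (\<lambda>_. {..D})" "x = (\<lambda>w. \<Prod>i<n. w i ^ \<alpha> i)"
      and \<beta>: "\<beta> \<in> PiE {..<n} (\<lambda>_. {..D'})" "u = (\<lambda>w. \<Prod>i<n. w i ^ \<beta> i)"
      using \<open>x \<in> monomial_box n D\<close> \<open>u \<in> monomial_box n D'\<close> unfolding monomial_box_def by blast
    have "(\<lambda>w. \<Prod>i<n. w i ^ (\<alpha> i + \<beta> i)) \<in> monomial_box n (D + D')"
      using \<alpha>(1) \<beta>(1) by (intro monomial_box_memI) (auto intro!: add_mono simp: PiE_iff)
    moreover have "(\<lambda>w. \<Prod>i<n. w i ^ (\<alpha> i + \<beta> i)) = x * u"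
      by (simp add: \<alpha> \<beta> fun_eq_iff power_add prod.distrib)
    ultimately have "x * u \<in> fvs.span (monomial_box n (D + D'))" using fvs.span_base by metis
    moreover have "x * ((\<lambda>w. d * u w) + v) = (\<lambda>w. d * (x * u) w) + x * v"
      by (simp add: fun_eq_iff algebra_simps)
    ultimately show ?case using fvs.span_add[OF fvs.span_scale[of "x * u" _ d] step(2)] by (simp only:)
  qed
  moreover have "((\<lambda>w. c * x w) + y) * g = (\<lambda>w. c * (x * g) w) + y * g"
    by (simp add: fun_eq_iff algebra_simps)
  ultimately show ?case using fvs.span_add[OF fvs.span_scale[of "x * g" _ c] step(2)] by (simp only:)
qed

lemma span_monomial_box_1: "1 \<in> fvs.span (monomial_box n D)"
  using fvs.span_base[OF monomial_box_memI[of n "\<lambda>_. 0" D]] by (simp add: one_fun_def)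

lemma span_monomial_box_power:
  assumes "f \<in> fvs.span (monomial_box n D)"
  shows "f ^ k \<in> fvs.span (monomial_box n (k * D))"
proof (induction k)
  case 0
  show ?case by (simp only: power_0 mult_0 span_monomial_box_1)
next
  case (Suc k)
  show ?case using span_monomial_box_mult[OF assms Suc] by (simp only: power_Suc mult_Suc)
qed

lemma pfun_span_monomial_box: "pfun n f \<Longrightarrow> \<exists>D. f \<in> fvs.span (monomial_box n D)"
proof (induction rule: pfun.induct)
  case (const c)
  show ?case using fvs.span_scale[OF span_monomial_box_1[of n 0, unfolded one_fun_def], of c] by auto
next
  case (coord i)
  have "(\<lambda>w. \<Prod>j<n. w j ^ (if j = i then 1 else 0)) \<in> monomial_box n 1"
    by (intro monomial_box_memI) auto
  moreover have "(\<lambda>w. \<Prod>j<n. w j ^ (if j = i then 1 else 0)) = (\<lambda>w. w i :: complex)"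
  proof
    fix w :: "nat \<Rightarrow> complex"
    have "(\<Prod>j<n. w j ^ (if j = i then 1 else 0)) = (\<Prod>j<n. if j = i then w j else 1)"
      by (intro prod.cong) auto
    then show "(\<Prod>j<n. w j ^ (if j = i then 1 else 0)) = w i" using coord by simp
  qed
  ultimately show ?case using fvs.span_base by metis
next
  case (add f g)
  then obtain D D' where D: "f \<in> fvs.span (monomial_box n D)" "g \<in> fvs.span (monomial_box n D')" by blast
  have "f \<in> fvs.span (monomial_box n (max D D'))" "g \<in> fvs.span (monomial_box n (max D D'))"
    using fvs.span_mono[OF monomial_box_mono] D by (meson max.cobounded1 max.cobounded2 subsetD)+
  then have "f + g \<in> fvs.span (monomial_box n (max D D'))" by (rule fvs.span_add)
  then show ?case by (auto simp: plus_fun_def)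
next
  case (mult f g)
  then obtain D D' where D: "f \<in> fvs.span (monomial_box n D)" "g \<in> fvs.span (monomial_box n D')" by blast
  then have "f * g \<in> fvs.span (monomial_box n (D + D'))" by (rule span_monomial_box_mult)
  then show ?case by (auto simp: times_fun_def)
qed

lemma sum_fun_apply: "(\<Sum>i\<in>A. f i) x = (\<Sum>i\<in>A. f i x :: complex)"
  by (induction A rule: infinite_finite_induct) auto

lemma mons_span_monomial_box:
  assumes "\<And>u. u \<in> set us \<Longrightarrow> (\<lambda>w. meval u (F w)) \<in> fvs.span (monomial_box n D)" "\<alpha> \<in> expos (length us) k"
  shows "(\<lambda>w. meval (mons us \<alpha>) (F w)) \<in> fvs.span (monomial_box n (length us * (k * D)))"
  using assms
proof (induction us arbitrary: \<alpha>)
  case Nil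
  have "(\<lambda>_. 1) \<in> fvs.span (monomial_box n 0)" using span_monomial_box_1 unfolding one_fun_def by blast
  then show ?case by simp
next
  case (Cons u us)
  obtain j \<beta> where \<alpha>: "\<alpha> = j # \<beta>" "j \<le> k" "\<beta> \<in> expos (length us) k"
    using Cons.prems(2) by (auto simp: expos_Suc)
  have "(\<lambda>w. meval u (F w)) ^ j \<in> fvs.span (monomial_box n (j * D))"
    using Cons.prems(1) by (intro span_monomial_box_power) auto
  then have "(\<lambda>w. meval u (F w)) ^ j \<in> fvs.span (monomial_box n (k * D))"
    using fvs.span_mono[OF monomial_box_mono, of "j * D" "k * D" n] \<alpha>(2) by auto
  from span_monomial_box_mult[OF this Cons.IH[OF _ \<alpha>(3)]]
  have "(\<lambda>w. meval u (F w)) ^ j * (\<lambda>w. meval (mons us \<beta>) (F w)) \<in> fvs.span (monomial_box n (length (u # us) * (k * D)))"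
    using Cons.prems(1) by simp
  moreover have "(\<lambda>w. meval u (F w)) ^ j * (\<lambda>w. meval (mons us \<beta>) (F w)) = (\<lambda>w. meval (mons (u # us) \<alpha>) (F w))"
  proof
    have *: "((g :: (nat \<Rightarrow> complex) \<Rightarrow> complex) ^ j) w = g w ^ j" for g w by (induction j) auto
    show "((\<lambda>w. meval u (F w)) ^ j * (\<lambda>w. meval (mons us \<beta>) (F w))) w = meval (mons (u # us) \<alpha>) (F w)" for w
      by (simp add: \<alpha>(1) *)
  qed
  ultimately show ?case by simp
qed

text \<open>For \<open>m\<close> polynomials of degree at most \<open>D\<close> in each parameter,
  the \<open>(k + 1)^m\<close> monomials in them are independent and lie in a space of dimension at
  most \<open>(m k D + 1)^n\<close>. As \<open>k\<close> grows this forces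
  \<open>m \<le> n\<close>.\<close>

lemma indep_on_length_le:
  fixes F :: "(nat \<Rightarrow> complex) \<Rightarrow> complex ^ 'v::finite"
  assumes F: "pmap n F" and dense: "\<And>p z. (\<And>w. meval p (F w) = 0) \<Longrightarrow> z \<in> Z \<Longrightarrow> meval p z = 0"
    and indep: "indep_on Z us"
  shows "length us \<le> n"
proof (rule ccontr)
  assume "\<not> length us \<le> n"
  then have m: "Suc n \<le> length us" by simp
  let ?m = "length us"
  have "\<exists>D. \<forall>u\<in>set us. (\<lambda>w. meval u (F w)) \<in> fvs.span (monomial_box n D)"
  proof (induction us)
    case (Cons u us)
    then obtain D where D: "\<forall>u\<in>set us. (\<lambda>w. meval u (F w)) \<in> fvs.span (monomial_box n D)" by blast
    obtain D' where D': "(\<lambda>w. meval u (F w)) \<in> fvs.span (monomial_box n D')"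
      using pfun_span_monomial_box[OF pfun_meval[OF F]] by blast
    show ?case
    proof (intro exI[of _ "max D D'"] ballI)
      fix u' assume "u' \<in> set (u # us)"
      then consider "u' = u" | "u' \<in> set us" by auto
      then show "(\<lambda>w. meval u' (F w)) \<in> fvs.span (monomial_box n (max D D'))"
        using D D' fvs.span_mono[OF monomial_box_mono[of D "max D D'" n]] fvs.span_mono[OF monomial_box_mono[of D' "max D D'" n]]
        by cases auto
    qed
  qed auto
  then obtain D where D: "\<And>u. u \<in> set us \<Longrightarrow> (\<lambda>w. meval u (F w)) \<in> fvs.span (monomial_box n D)" by blast
  define g where "g \<alpha> = (\<lambda>w. meval (mons us \<alpha>) (F w))" for \<alpha>
  have zero: "\<forall>\<alpha>\<in>expos ?m k. c \<alpha> = 0" if rel: "\<And>w. (\<Sum>\<alpha>\<in>expos ?m k. c \<alpha> * g \<alpha> w) = 0" for k c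
  proof -
    have "meval (\<Sum>\<alpha>\<in>expos ?m k. mconst (c \<alpha>) * mons us \<alpha>) z = 0" if "z \<in> Z" for z
      using rel by (intro dense[OF _ that]) (simp add: g_def)
    then show ?thesis using indep[unfolded indep_on_def, rule_format, of c k] by simp
  qed
  \<comment> \<open>Linear independence is a property of a set of functions, so distinct exponents
    must first be seen to give distinct functions; a coincidence would be a relation with
    coefficients 1 and -1.\<close>
  have inj: "inj_on g (expos ?m k)" for k
  proof (rule inj_onI, rule ccontr)
    fix \<alpha> \<beta> assume *: "\<alpha> \<in> expos ?m k" "\<beta> \<in> expos ?m k" "g \<alpha> = g \<beta>" "\<alpha> \<noteq> \<beta>"
    define c :: "nat list \<Rightarrow> complex" where "c \<gamma> = (if \<gamma> = \<alpha> then 1 else if \<gamma> = \<beta> then - 1 else 0)" for \<gamma>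
    have "(\<Sum>\<gamma>\<in>expos ?m k. c \<gamma> * g \<gamma> w) = (\<Sum>\<gamma>\<in>{\<alpha>, \<beta>}. c \<gamma> * g \<gamma> w)" for w
      by (rule sum.mono_neutral_right) (use * finite_expos in \<open>auto simp: c_def\<close>)
    also have "(\<Sum>\<gamma>\<in>{\<alpha>, \<beta>}. c \<gamma> * g \<gamma> w) = 0" for w using * by (simp add: c_def)
    finally have "c \<alpha> = 0" using zero *(1) by blast
    then show False by (simp add: c_def)
  qed
  have "Suc k ^ ?m \<le> Suc (?m * (k * D)) ^ n" for k
  proof -
    have "\<not> fvs.dependent (g ` expos ?m k)"
    proof
      assume "fvs.dependent (g ` expos ?m k)"
      then obtain u where u: "\<exists>v\<in>g ` expos ?m k. u v \<noteq> 0" "(\<Sum>v\<in>g ` expos ?m k. (\<lambda>w. u v * v w)) = 0"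
        unfolding fvs.dependent_finite[OF finite_imageI[OF finite_expos]] by (elim exE conjE)
      have "(\<Sum>v\<in>g ` expos ?m k. (\<lambda>w. u v * v w)) w = 0" for w using u(2) by simp
      then have "(\<Sum>\<alpha>\<in>expos ?m k. u (g \<alpha>) * g \<alpha> w) = 0" for w
        unfolding sum_fun_apply by (simp add: sum.reindex[OF inj])
      from zero[OF this] show False using u(1) by auto
    qed
    moreover have "g ` expos ?m k \<subseteq> fvs.span (monomial_box n (?m * (k * D)))"
      using mons_span_monomial_box[OF D] by (auto simp: g_def)
    ultimately have "card (g ` expos ?m k) \<le> card (monomial_box n (?m * (k * D)))"
      by (rule fvs.independent_span_bound[OF finite_monomial_box, THEN conjunct2])
    then show ?thesis using card_monomial_box[of n "?m * (k * D)"] by (simp add: card_image[OF inj] card_expos)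
  qed
  moreover have "Suc (?m * (k * D)) \<le> Suc (?m * D) * Suc k" for k
    by (simp add: algebra_simps)
  \<comment> \<open>Up to a constant factor both sides are powers of \<open>Suc k\<close>. With
    \<open>m\<close> above \<open>n\<close> an extra factor \<open>Suc k\<close> survives on the
    left and is bounded by a constant for all \<open>k\<close>, which fails when \<open>k\<close> is
    that constant.\<close>
  ultimately have 1: "Suc k ^ ?m \<le> (Suc (?m * D) * Suc k) ^ n" for k
    by (meson order_trans power_mono zero_le)
  have "Suc k ^ Suc n \<le> (Suc (?m * D) * Suc k) ^ n" for k
    using power_increasing[OF m, of "Suc k"] 1[of k] by linarith
  then have "Suc k * Suc k ^ n \<le> Suc (?m * D) ^ n * Suc k ^ n" for k
    by (simp only: power_Suc power_mult_distrib)
  then have "Suc k \<le> Suc (?m * D) ^ n" for k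
    by (meson mult_le_cancel2 zero_less_Suc zero_less_power)
  from this[of "Suc (?m * D) ^ n"] show False by simp
qed

lemma indep_on_mono: "indep_on Z us \<Longrightarrow> Z \<subseteq> Z' \<Longrightarrow> indep_on Z' us"
  unfolding indep_on_def by blast

text \<open>\<open>dense\<close> makes polynomial relations on the image of \<open>F\<close> hold on
  \<open>V\<close>, so the number of parameters bounds the independent family attached to a
  chain.\<close>

lemma irreducible_chain_length_le:
  fixes F :: "(nat \<Rightarrow> complex) \<Rightarrow> complex ^ 'v::finite"
  assumes F: "pmap n F" and dense: "\<And>p z. (\<And>w. meval p (F w) = 0) \<Longrightarrow> z \<in> V \<Longrightarrow> meval p z = 0"
    and C: "irreducible_chain V k C"
  shows "k \<le> n"
proof -
  obtain us where us: "length us = k" "indep_on (C k) us" using irreducible_chain_indep[OF C] by blast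
  have "C k \<subseteq> V" using C by (auto simp: irreducible_chain_def)
  then have "indep_on V us" using us(2) by (rule indep_on_mono[rotated])
  from indep_on_length_le[OF F dense this] show ?thesis using us(1) by simp
qed

section \<open>A matrix model of the conifold algebra\<close>

definition M2 :: "'a \<Rightarrow> 'a \<Rightarrow> 'a \<Rightarrow> 'a \<Rightarrow> 'a ^ 2 ^ 2" where
  "M2 a b c d = (\<chi> i j. if i = 1 then (if j = 1 then a else b) else (if j = 1 then c else d))"

lemma M2_nth [simp]: "M2 a b c d $ 1 $ 1 = a" "M2 a b c d $ 1 $ 2 = b"
    "M2 a b c d $ 2 $ 1 = c" "M2 a b c d $ 2 $ 2 = d"
  by (simp_all add: M2_def)

lemma mat2_eq_iff: "A = B \<longleftrightarrow> A $ 1 $ 1 = B $ 1 $ 1 \<and> A $ 1 $ 2 = B $ 1 $ 2 \<and> A $ 2 $ 1 = B $ 2 $ 1 \<and> A $ 2 $ 2 = B $ 2 $ 2"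
  for A B :: "'a ^ 2 ^ 2"
  by (auto simp: vec_eq_iff forall_2)

lemma M2_eta: "A = M2 (A $ 1 $ 1) (A $ 1 $ 2) (A $ 2 $ 1) (A $ 2 $ 2)"
  by (simp add: mat2_eq_iff)

lemma M2_cases: obtains a b c d where "A = M2 a b c d"
  using M2_eta by blast

lemma M2_eq [simp]: "M2 a b c d = M2 a' b' c' d' \<longleftrightarrow> a = a' \<and> b = b' \<and> c = c' \<and> d = d'"
  by (simp add: mat2_eq_iff)

lemma M2_mult [simp]: "M2 a b c d ** M2 a' b' c' d' =
    M2 (a * a' + b * c') (a * b' + b * d') (c * a' + d * c') (c * b' + d * d')"
  for a :: "'a::semiring_1"
  by (simp add: mat2_eq_iff matrix_matrix_mult_def sum_2)

lemma M2_add [simp]: "M2 a b c d + M2 a' b' c' d' = M2 (a + a') (b + b') (c + c') (d + d')"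
  by (simp add: mat2_eq_iff)

lemma M2_diff [simp]: "M2 a b c d - M2 a' b' c' d' = M2 (a - a') (b - b') (c - c') (d - d')"
  by (simp add: mat2_eq_iff)

lemma M2_uminus [simp]: "- M2 a b c d = M2 (- a) (- b) (- c) (- d)"
  by (simp add: mat2_eq_iff)

lemma mat_M2: "mat c = M2 c 0 0 c"
  by (simp add: mat2_eq_iff mat_def)

lemma zero_M2: "0 = M2 0 0 0 0"
  by (simp add: mat2_eq_iff)

lemma trace_M2 [simp]: "trace (M2 a b c d) = a + d"
  by (simp add: trace_def sum_2)

abbreviation (input) "vx1 \<equiv> (mvar 1 :: 4 mpoly)"
abbreviation (input) "vy1 \<equiv> (mvar 2 :: 4 mpoly)"
abbreviation (input) "vx2 \<equiv> (mvar 3 :: 4 mpoly)"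
abbreviation (input) "vy2 \<equiv> (mvar 4 :: 4 mpoly)"

text \<open>The Klebanov--Witten quiver: two vertices, arrows \<open>x\<^sub>1, y\<^sub>1\<close> one way and \<open>x\<^sub>2, y\<^sub>2\<close> the other.\<close>

fun Mg :: "conifold_gen \<Rightarrow> 4 mpoly ^ 2 ^ 2" where
  "Mg GX = M2 0 vx1 vx2 0"
| "Mg GY = M2 0 vy1 vy2 0"
| "Mg GZ = M2 1 0 0 (- 1)"

definition model :: "conifold_gen falg \<Rightarrow> 4 mpoly ^ 2 ^ 2" where
  "model f = free_eval mconst Mg f"

lemma fconst_1 [simp]: "fconst 1 = 1"
  by (simp add: fconst_def)

lemma mconst_1 [simp]: "mconst 1 = 1" and mconst_0 [simp]: "mconst 0 = 0"
  by (simp_all add: mconst_def)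

lemma mconst_add: "mconst (c + d) = mconst c + mconst d"
  and mconst_mult: "mconst (c * d) = mconst c * mconst d"
  and mconst_uminus: "mconst (- c) = - mconst c"
  by (simp_all add: mconst_def single_add mult_single single_uminus)

lemma model_simps [simp]:
  "model (f + g) = model f + model g" "model (f * g) = model f ** model g" "model (f - g) = model f - model g" "model (- f) = - model f"
  "model (fconst c) = mat (mconst c)" "model (fvar h) = Mg h" "model 0 = 0" "model 1 = mat 1"
proof -
  show *: "model (f + g) = model f + model g" "model (- f) = - model f" for f g by (simp_all add: model_def)
  show c: "model (f * g) = model f ** model g" "model (fconst c) = mat (mconst c)" "model (fvar h) = Mg h" "model 0 = 0" for g h c
    by (simp_all add: model_def)
  show "model 1 = mat 1" using c(2)[of 1] by simp
  show "model (f - g) = model f - model g" for f g using *(1)[of f "- g"] *(2) by simp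
qed

section \<open>The grading and matrices with homogeneous entries\<close>

definition xdeg :: "(4 \<Rightarrow>\<^sub>0 nat) \<Rightarrow> int" where
  "xdeg m = int (Poly_Mapping.lookup m 1) + int (Poly_Mapping.lookup m 2)
     - int (Poly_Mapping.lookup m 3) - int (Poly_Mapping.lookup m 4)"

definition homog :: "int \<Rightarrow> 4 mpoly \<Rightarrow> bool" where
  "homog d p \<longleftrightarrow> (\<forall>m\<in>Poly_Mapping.keys p. xdeg m = d)"

lemma xdeg_add [simp]: "xdeg (m + n) = xdeg m + xdeg n"
  by (simp add: xdeg_def lookup_add)

lemma homog_0 [simp]: "homog d 0"
  by (simp add: homog_def)

lemma homog_add: "homog d p \<Longrightarrow> homog d q \<Longrightarrow> homog d (p + q)"
  using keys_add[of p q] by (auto simp: homog_def)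

lemma homog_uminus: "homog d p \<Longrightarrow> homog d (- p)"
  by (simp add: homog_def)

lemma homog_mult: "homog d p \<Longrightarrow> homog e q \<Longrightarrow> homog (d + e) (p * q)"
  using keys_mult[of p q] by (fastforce simp: homog_def)

lemma homog_mult': "homog d p \<Longrightarrow> homog e q \<Longrightarrow> d + e = k \<Longrightarrow> homog k (p * q)"
  using homog_mult by blast

lemma homog_single: "homog d (Poly_Mapping.single m c) \<longleftrightarrow> c = 0 \<or> xdeg m = d"
  by (auto simp: homog_def)

lemma homog_mconst [simp]: "homog 0 (mconst c)"
  by (simp add: mconst_def homog_single xdeg_def)

lemma homog_1 [simp]: "homog 0 1"
  using homog_mconst[of 1] by simp

lemma homog_mvar [simp]: "homog 1 vx1" "homog 1 vy1" "homog (- 1) vx2" "homog (- 1) vy2"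
  by (simp_all add: mvar_def homog_single xdeg_def lookup_single when_def)

lemma poly_mapping_eq_sum: "p = (\<Sum>m\<in>Poly_Mapping.keys p. Poly_Mapping.single m (Poly_Mapping.lookup p m))"
proof (rule poly_mapping_eqI)
  fix k
  have "(\<Sum>m\<in>Poly_Mapping.keys p. Poly_Mapping.lookup p m when m = k)
      = (\<Sum>m\<in>Poly_Mapping.keys p. if m = k then Poly_Mapping.lookup p k else 0)"
    by (rule sum.cong) (auto simp: when_def)
  also have "\<dots> = Poly_Mapping.lookup p k" by (auto simp: in_keys_iff)
  finally show "Poly_Mapping.lookup p k =
      Poly_Mapping.lookup (\<Sum>m\<in>Poly_Mapping.keys p. Poly_Mapping.single m (Poly_Mapping.lookup p m)) k"
    by (simp add: lookup_sum lookup_single)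
qed

lemma homog_induct [consumes 1, case_names zero single add]:
  assumes "homog d p" "P 0" "\<And>m c. xdeg m = d \<Longrightarrow> P (Poly_Mapping.single m c)"
    "\<And>p q. P p \<Longrightarrow> P q \<Longrightarrow> P (p + q)"
  shows "P p"
proof -
  have "P (\<Sum>m\<in>A. Poly_Mapping.single m (Poly_Mapping.lookup p m))" if "finite A" "A \<subseteq> Poly_Mapping.keys p" for A
    using that
  proof (induction A rule: finite_induct)
    case empty
    show ?case using assms(2) by simp
  next
    case (insert m A)
    then show ?case using assms(1,3,4) by (auto simp: homog_def)
  qed
  then show ?thesis using poly_mapping_eq_sum[of p] by (metis finite_keys order_refl)
qed

definition graded :: "4 mpoly ^ 2 ^ 2 \<Rightarrow> bool" where
  "graded A \<longleftrightarrow> homog 0 (A $ 1 $ 1) \<and> homog 1 (A $ 1 $ 2) \<and> homog (- 1) (A $ 2 $ 1) \<and> homog 0 (A $ 2 $ 2)"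

lemma graded_M2 [simp]: "graded (M2 a b c d) \<longleftrightarrow> homog 0 a \<and> homog 1 b \<and> homog (- 1) c \<and> homog 0 d"
  by (simp add: graded_def)

lemma graded_mat: "homog 0 p \<Longrightarrow> graded (mat p)"
  by (simp add: mat_M2)

lemma graded_add: "graded A \<Longrightarrow> graded B \<Longrightarrow> graded (A + B)"
  by (cases A rule: M2_cases; cases B rule: M2_cases) (simp add: homog_add)

lemma graded_mult: "graded A \<Longrightarrow> graded B \<Longrightarrow> graded (A ** B)"
  by (cases A rule: M2_cases; cases B rule: M2_cases) (auto intro!: homog_add intro: homog_mult')

lemma graded_Mg: "graded (Mg g)"
  by (cases g) (simp_all add: homog_uminus)

lemma single_FMon_Cons:
  "Poly_Mapping.single (FMon (g # gs)) c = fvar g * Poly_Mapping.single (FMon gs) (c :: complex)"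
  by (simp add: fvar_def mult_single)

lemma single_FMon_Nil: "Poly_Mapping.single (FMon []) c = fconst c"
  by (simp add: fconst_def zero_fmon_def)

text \<open>Words are built from the left, one generator at a time, which matches the recursion of
  \<open>W\<close> and the behaviour of \<open>model_section\<close> under left
  multiplication.\<close>

lemma falg_induct [case_names const mult add]:
  assumes "\<And>c. P (fconst c)" "\<And>g f. P f \<Longrightarrow> P (fvar g * f)" "\<And>f g. P f \<Longrightarrow> P g \<Longrightarrow> P (f + g)"
  shows "P f"
proof (induction f rule: pm_induct)
  case zero
  show ?case using assms(1)[of 0] by (simp add: fconst_def)
next
  case (single w c)
  obtain gs where w: "w = FMon gs" by (cases w)
  show ?case unfolding w
    by (induction gs) (use assms(1,2) in \<open>auto simp: single_FMon_Cons single_FMon_Nil\<close>)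
next
  case (add f g)
  then show ?case by (rule assms(3))
qed

lemma graded_model: "graded (model f)"
  by (induction f rule: falg_induct) (auto simp: graded_mat graded_add intro: graded_mult graded_Mg)

subsection \<open>Congruence modulo the relations\<close>

abbreviation "I_con \<equiv> relation_ideal conifold_relations"

definition cg :: "conifold_gen falg \<Rightarrow> conifold_gen falg \<Rightarrow> bool" (infix \<open>\<approx>\<^sub>c\<close> 50) where
  "f \<approx>\<^sub>c g \<longleftrightarrow> f - g \<in> I_con"

lemma relation_ideal_0: "0 \<in> relation_ideal S"
  and relation_ideal_add: "f \<in> relation_ideal S \<Longrightarrow> g \<in> relation_ideal S \<Longrightarrow> f + g \<in> relation_ideal S"
  and relation_ideal_lmult: "f \<in> relation_ideal S \<Longrightarrow> h * f \<in> relation_ideal S"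
  and relation_ideal_rmult: "f \<in> relation_ideal S \<Longrightarrow> f * h \<in> relation_ideal S"
  and relation_ideal_uminus: "f \<in> relation_ideal S \<Longrightarrow> - f \<in> relation_ideal S"
  and relation_ideal_base: "f \<in> S \<Longrightarrow> f \<in> relation_ideal S"
proof -
  interpret I: ideal "relation_ideal S" "ring_of_type_algebra :: 'a falg ring"
    by (rule ideal_relation_ideal)
  show "0 \<in> relation_ideal S" 
    using additive_subgroup.zero_closed[OF I.additive_subgroup_axioms] by (simp add: type_ring_simps)
  show "f \<in> relation_ideal S \<Longrightarrow> g \<in> relation_ideal S \<Longrightarrow> f + g \<in> relation_ideal S"

    using additive_subgroup.a_closed[OF I.additive_subgroup_axioms] by (simp add: type_ring_simps)
  show l: "f \<in> relation_ideal S \<Longrightarrow> h * f \<in> relation_ideal S" for f h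
    using I.I_l_closed by (simp add: type_ring_simps)
  show "f \<in> relation_ideal S \<Longrightarrow> f * h \<in> relation_ideal S"
    using I.I_r_closed by (simp add: type_ring_simps)
  show "f \<in> relation_ideal S \<Longrightarrow> - f \<in> relation_ideal S" using l[of f "-1"] by simp
  show "f \<in> S \<Longrightarrow> f \<in> relation_ideal S"
    unfolding relation_ideal_def
    using ring.genideal_self[OF ring_falg, of S] by (auto simp: ring_of_type_algebra_def)
qed

text \<open>Induction over the two-sided ideal; closure under negation comes from left
  multiplication by -1.\<close>

lemma relation_ideal_minimal:
  assumes "\<And>f. f \<in> S \<Longrightarrow> P f" "P 0" "\<And>f g. P f \<Longrightarrow> P g \<Longrightarrow> P (f + g)"
    "\<And>f h. P f \<Longrightarrow> P (h * f)" "\<And>f h. P f \<Longrightarrow> P (f * h)" "f \<in> relation_ideal S"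
  shows "P f"
proof -
  interpret R: ring "ring_of_type_algebra :: 'a falg ring" by (rule ring_falg)
  have m: "\<ominus>\<^bsub>ring_of_type_algebra\<^esub> a = - a" for a :: "'a falg"
    by (rule R.minus_equality) (simp_all add: ring_of_type_algebra_def)
  have um: "P f \<Longrightarrow> P (- f)" for f using assms(4)[of f "-1"] by simp
  have "ideal {f. P f} (ring_of_type_algebra :: 'a falg ring)"
  proof (rule idealI)
    show "subgroup {f. P f} (add_monoid (ring_of_type_algebra :: 'a falg ring))"
    proof (rule R.add.subgroupI)
      show "{f. P f} \<noteq> {}" using assms(2) by blast
      show "a \<in> {f. P f} \<Longrightarrow> \<ominus>\<^bsub>ring_of_type_algebra\<^esub> a \<in> {f. P f}" for a
        by (simp add: m um)
    qed (auto simp: ring_of_type_algebra_def assms(3))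
  qed (auto simp: R.ring_axioms type_ring_simps assms(4,5))
  then have "relation_ideal S \<subseteq> {f. P f}"
    unfolding relation_ideal_def by (rule R.genideal_minimal) (use assms(1) in auto)
  then show ?thesis using assms(6) by blast
qed

lemma cg_refl [simp]: "f \<approx>\<^sub>c f"
  by (simp add: cg_def relation_ideal_0)

lemma cg_sym: "f \<approx>\<^sub>c g \<Longrightarrow> g \<approx>\<^sub>c f"
  unfolding cg_def using relation_ideal_uminus by fastforce

lemma cg_trans [trans]: "f \<approx>\<^sub>c g \<Longrightarrow> g \<approx>\<^sub>c h \<Longrightarrow> f \<approx>\<^sub>c h"
  unfolding cg_def using relation_ideal_add by fastforce

lemma cg_add: "f \<approx>\<^sub>c g \<Longrightarrow> f' \<approx>\<^sub>c g' \<Longrightarrow> f + f' \<approx>\<^sub>c g + g'"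
  unfolding cg_def using relation_ideal_add by (metis add_diff_add)

lemma cg_lmult: "f \<approx>\<^sub>c g \<Longrightarrow> h * f \<approx>\<^sub>c h * g"
  unfolding cg_def using relation_ideal_lmult by (metis right_diff_distrib)

lemma cg_rmult: "f \<approx>\<^sub>c g \<Longrightarrow> f * h \<approx>\<^sub>c g * h"
  unfolding cg_def using relation_ideal_rmult by (metis left_diff_distrib)

abbreviation "fx \<equiv> fvar GX"
abbreviation "fy \<equiv> fvar GY"
abbreviation "fz \<equiv> fvar GZ"

lemma con_relations:
  "fz * fz \<approx>\<^sub>c 1" "fx * fz \<approx>\<^sub>c - (fz * fx)" "fy * fz \<approx>\<^sub>c - (fz * fy)"
  "fx * fx * fy \<approx>\<^sub>c fy * fx * fx" "fy * fy * fx \<approx>\<^sub>c fx * fy * fy"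
  by (auto simp: cg_def conifold_relations_def Let_def power2_eq_square mult.assoc intro!: relation_ideal_base)

text \<open>An alternating word: \<open>p\<close> letters \<open>x\<close> and \<open>q\<close>
  letters \<open>y\<close> fill the odd places, \<open>p'\<close> and \<open>q'\<close> the even
  ones, with \<open>x\<close> before \<open>y\<close> in each class. Removing the first letter
  exchanges the classes, hence the swapped arguments. The last clause is a genuine end of the word
  only for \<open>p' = q' = 0\<close>, the only case reached when there are as many odd places as
  even ones or one more.\<close>

function (sequential) W :: "nat \<Rightarrow> nat \<Rightarrow> nat \<Rightarrow> nat \<Rightarrow> conifold_gen falg" where
  "W (Suc p) q p' q' = fx * W p' q' p q"
| "W 0 (Suc q) p' q' = fy * W p' q' 0 q"
| "W 0 0 p' q' = 1"
  by pat_completeness auto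
termination by (relation "Wellfounded.measure (\<lambda>(p, q, p', q'). p + q + p' + q')") auto

text \<open>Letters two places apart commute, so a path is determined by the numbers of
  \<open>x\<close> and \<open>y\<close> among its odd and among its even letters.\<close>

lemma fy_mult_W:
  assumes "p' + q' = p + q \<or> p' + q' = Suc (p + q)"
  shows "fy * W p' q' p q \<approx>\<^sub>c W p (Suc q) p' q'"
  using assms
proof (induction p arbitrary: p' q')
  case 0
  show ?case by simp
next
  case (Suc p)
  show ?case
  proof (cases p')
    \<comment> \<open>The word begins with two letters \<open>x\<close>, and \<open>y\<close> passes
      both of them by the relation between \<open>x * x\<close> and \<open>y\<close>.\<close>
    case (Suc p'')
    have "fy * W p' q' (Suc p) q = (fy * fx * fx) * W p'' q' p q" by (simp add: Suc mult.assoc)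
    also have "\<dots> \<approx>\<^sub>c (fx * fx * fy) * W p'' q' p q" by (rule cg_rmult[OF cg_sym]) (rule con_relations)
    also have "(fx * fx * fy) * W p'' q' p q = (fx * fx) * (fy * W p'' q' p q)" by (simp add: mult.assoc)
    also have "\<dots> \<approx>\<^sub>c (fx * fx) * W p (Suc q) p'' q'"
      by (rule cg_lmult, rule Suc.IH) (use Suc.prems Suc in auto)
    also have "(fx * fx) * W p (Suc q) p'' q' = W (Suc p) (Suc q) p' q'" by (simp add: Suc mult.assoc)
    finally show ?thesis .
  next
    \<comment> \<open>The word now begins with \<open>y x\<close>, so together with the new letter
      it starts with \<open>y y x\<close>; the relation between \<open>y * y\<close> and
      \<open>x\<close> brings the \<open>x\<close> to the front.\<close>
    case 0
    then obtain q'' where q': "q' = Suc q''" using Suc.prems by (cases q') auto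
    have "fy * W p' q' (Suc p) q = (fy * fy * fx) * W 0 q'' p q" by (simp add: 0 q' mult.assoc)
    also have "\<dots> \<approx>\<^sub>c (fx * fy * fy) * W 0 q'' p q" by (rule cg_rmult) (rule con_relations)
    also have "(fx * fy * fy) * W 0 q'' p q = (fx * fy) * (fy * W 0 q'' p q)" by (simp add: mult.assoc)
    also have "\<dots> \<approx>\<^sub>c (fx * fy) * W p (Suc q) 0 q''"
      by (rule cg_lmult, rule Suc.IH) (use Suc.prems 0 q' in auto)
    also have "(fx * fy) * W p (Suc q) 0 q'' = W (Suc p) (Suc q) p' q'" by (simp add: 0 q' mult.assoc)
    finally show ?thesis .
  qed
qed

section \<open>A linear section of the model\<close>

lemma fconst_commute: "f * fconst c = fconst c * f"
proof (induction f rule: pm_induct)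
  case (single k d)
  show ?case by (simp add: fconst_def mult_single mult.commute)
qed (simp_all add: algebra_simps)

lemma fconst_add: "fconst (c + d) = fconst c + fconst d"
  and fconst_mult: "fconst (c * d) = fconst c * fconst d"
  by (simp_all add: fconst_def single_add mult_single)

text \<open>The idempotents of the two quiver vertices modulo the relations; \<open>model\<close>
  sends them to the two diagonal matrix units.\<close>

definition fe1 :: "conifold_gen falg" where "fe1 = fconst (1/2) * (1 + fz)"
definition fe2 :: "conifold_gen falg" where "fe2 = fconst (1/2) * (1 - fz)"

lemma fe_add: "fe1 + fe2 = 1"
proof -
  have "fe1 + fe2 = fconst (1/2) + fconst (1/2)" by (simp add: fe1_def fe2_def algebra_simps)
  also have "\<dots> = 1" by (simp flip: fconst_add)
  finally show ?thesis .
qed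

lemma cg_uminus: "f \<approx>\<^sub>c g \<Longrightarrow> - f \<approx>\<^sub>c - g"
  using cg_lmult[of f g "-1"] by simp

lemma cg_diff: "f \<approx>\<^sub>c g \<Longrightarrow> f' \<approx>\<^sub>c g' \<Longrightarrow> f - f' \<approx>\<^sub>c g - g'"
  using cg_add[of f g "- f'" "- g'"] cg_uminus by simp

lemma fz_fe: "fz * fe1 \<approx>\<^sub>c fe1" "fz * fe2 \<approx>\<^sub>c - fe2"
proof -
  have c: "fz * (fconst (1/2) * g) = fconst (1/2) * (fz * g)" for g
    by (metis fconst_commute mult.assoc)
  have "fz * fe1 = fconst (1/2) * (fz + fz * fz)" by (simp add: fe1_def c distrib_left fconst_commute[of fz])
  also have "\<dots> \<approx>\<^sub>c fconst (1/2) * (fz + 1)" by (intro cg_lmult cg_add cg_refl con_relations)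
  finally show "fz * fe1 \<approx>\<^sub>c fe1" by (simp add: fe1_def add.commute)
  have "fz * fe2 = fconst (1/2) * (fz - fz * fz)" by (simp add: fe2_def c right_diff_distrib fconst_commute[of fz])
  also have "\<dots> \<approx>\<^sub>c fconst (1/2) * (fz - 1)" by (intro cg_lmult cg_diff cg_refl con_relations)
  finally show "fz * fe2 \<approx>\<^sub>c - fe2" by (simp add: fe2_def right_diff_distrib)
qed

lemma fxy_fe:
  assumes "g = GX \<or> g = GY"
  shows "fvar g * fe1 \<approx>\<^sub>c fe2 * fvar g" "fvar g * fe2 \<approx>\<^sub>c fe1 * fvar g"
proof -
  have c: "fvar g * (fconst (1/2) * h) = fconst (1/2) * (fvar g * h)" for h
    by (metis fconst_commute mult.assoc)
  have gz: "fvar g * fz \<approx>\<^sub>c - (fz * fvar g)" using assms con_relations by auto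
  have "fvar g * fe1 = fconst (1/2) * (fvar g + fvar g * fz)" by (simp add: fe1_def c distrib_left fconst_commute[of "fvar g"])
  also have "\<dots> \<approx>\<^sub>c fconst (1/2) * (fvar g + - (fz * fvar g))" by (intro cg_lmult cg_add cg_refl gz)
  finally show "fvar g * fe1 \<approx>\<^sub>c fe2 * fvar g" by (simp add: fe2_def left_diff_distrib mult.assoc)
  have "fvar g * fe2 = fconst (1/2) * (fvar g - fvar g * fz)" by (simp add: fe2_def c right_diff_distrib fconst_commute[of "fvar g"])
  also have "\<dots> \<approx>\<^sub>c fconst (1/2) * (fvar g - - (fz * fvar g))" by (intro cg_lmult cg_diff cg_refl gz)
  finally show "fvar g * fe2 \<approx>\<^sub>c fe1 * fvar g" by (simp add: fe1_def distrib_right mult.assoc)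
qed

definition plin :: "('k \<Rightarrow> 'g falg) \<Rightarrow> ('k \<Rightarrow>\<^sub>0 complex) \<Rightarrow> 'g falg" where
  "plin h p = (\<Sum>m\<in>Poly_Mapping.keys p. fconst (Poly_Mapping.lookup p m) * h m)"

lemma fconst_0 [simp]: "fconst 0 = 0"
  by (simp add: fconst_def)

lemma plin_superset:
  assumes "finite A" "Poly_Mapping.keys p \<subseteq> A"
  shows "plin h p = (\<Sum>m\<in>A. fconst (Poly_Mapping.lookup p m) * h m)"
  unfolding plin_def using assms by (intro sum.mono_neutral_left) (auto simp: in_keys_iff)

lemma plin_0 [simp]: "plin h 0 = 0"
  by (simp add: plin_def)

lemma plin_single [simp]: "plin h (Poly_Mapping.single m c) = fconst c * h m"
  by (subst plin_superset[where A="{m}"]) auto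

lemma plin_add [simp]: "plin h (p + q) = plin h p + plin h q"
  by (subst (1 2 3) plin_superset[where A="Poly_Mapping.keys p \<union> Poly_Mapping.keys q"])
    (use keys_add[of p q] in \<open>auto simp: lookup_add fconst_add distrib_right sum.distrib\<close>)

lemma plin_uminus [simp]: "plin h (- p) = - plin h p"
  using plin_add[of h p "- p"] by (simp add: add_eq_0_iff)

text \<open>A monomial read as a path from either vertex: in \<open>W1\<close> the arrows
  \<open>x\<^sub>1, y\<^sub>1\<close> occupy the odd places, in \<open>W2\<close> the arrows
  \<open>x\<^sub>2, y\<^sub>2\<close> do.\<close>

definition W1 :: "(4 \<Rightarrow>\<^sub>0 nat) \<Rightarrow> conifold_gen falg" where
  "W1 m = W (Poly_Mapping.lookup m 1) (Poly_Mapping.lookup m 2) (Poly_Mapping.lookup m 3) (Poly_Mapping.lookup m 4)"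
definition W2 :: "(4 \<Rightarrow>\<^sub>0 nat) \<Rightarrow> conifold_gen falg" where
  "W2 m = W (Poly_Mapping.lookup m 3) (Poly_Mapping.lookup m 4) (Poly_Mapping.lookup m 1) (Poly_Mapping.lookup m 2)"

text \<open>Row \<open>i\<close> collects the paths at vertex \<open>i\<close>, so its entries are
  expanded into words by \<open>W1\<close> or \<open>W2\<close> and cut out by the idempotent of
  that vertex.\<close>

definition model_section :: "4 mpoly ^ 2 ^ 2 \<Rightarrow> conifold_gen falg" where
  "model_section A = fe1 * (plin W1 (A $ 1 $ 1) + plin W1 (A $ 1 $ 2)) + fe2 * (plin W2 (A $ 2 $ 1) + plin W2 (A $ 2 $ 2))"

lemma model_section_M2 [simp]: "model_section (M2 a b c d) = fe1 * (plin W1 a + plin W1 b) + fe2 * (plin W2 c + plin W2 d)"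
  by (simp add: model_section_def)

lemma model_section_add: "model_section (A + B) = model_section A + model_section B"
  by (simp add: model_section_def algebra_simps)

text \<open>For \<open>x\<close> the normal form gains its first letter by definition. For
  \<open>y\<close> the letter must be moved to its place, and the degree of \<open>p\<close>
  supplies the balance of odd and even letters that \<open>fy_mult_W\<close> requires.\<close>

lemma plin_W_shift:
  assumes "homog d p"
  shows "d = 0 \<or> d = 1 \<Longrightarrow> plin W2 (vx2 * p) \<approx>\<^sub>c fx * plin W1 p"
    and "d = 0 \<or> d = 1 \<Longrightarrow> plin W2 (vy2 * p) \<approx>\<^sub>c fy * plin W1 p"
    and "d = 0 \<or> d = - 1 \<Longrightarrow> plin W1 (vx1 * p) \<approx>\<^sub>c fx * plin W2 p"
    and "d = 0 \<or> d = - 1 \<Longrightarrow> plin W1 (vy1 * p) \<approx>\<^sub>c fy * plin W2 p"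
proof -
  have c: "fvar g * (fconst c * h) = fconst c * (fvar g * h)" for g :: conifold_gen and c h
    by (metis fconst_commute mult.assoc)
  have s: "mvar i * Poly_Mapping.single m c = Poly_Mapping.single (Poly_Mapping.single i 1 + m) c"
    for i m and c :: complex
    by (simp add: mvar_def mult_single)
  note l = lookup_add lookup_single when_def
  show "plin W2 (vx2 * p) \<approx>\<^sub>c fx * plin W1 p" if "d = 0 \<or> d = 1"
    using assms by (induction rule: homog_induct) (auto simp: s c l W1_def W2_def distrib_left intro: cg_add)
  show "plin W1 (vx1 * p) \<approx>\<^sub>c fx * plin W2 p" if "d = 0 \<or> d = - 1"
    using assms by (induction rule: homog_induct) (auto simp: s c l W1_def W2_def distrib_left intro: cg_add)
  show "plin W2 (vy2 * p) \<approx>\<^sub>c fy * plin W1 p" if d: "d = 0 \<or> d = 1"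
    using assms
  proof (induction rule: homog_induct)
    case (single m a)
    then show ?case using d
      by (auto simp: s c l W1_def W2_def xdeg_def intro!: cg_lmult cg_sym[OF fy_mult_W])
  qed (auto simp: distrib_left intro: cg_add)
  show "plin W1 (vy1 * p) \<approx>\<^sub>c fy * plin W2 p" if d: "d = 0 \<or> d = - 1"
    using assms
  proof (induction rule: homog_induct)
    case (single m a)
    then show ?case using d
      by (auto simp: s c l W1_def W2_def xdeg_def intro!: cg_lmult cg_sym[OF fy_mult_W])
  qed (auto simp: distrib_left intro: cg_add)
qed

text \<open>Modulo the relations \<open>x\<close> and \<open>y\<close> exchange the vertex
  idempotents, and \<open>z\<close> acts on them by 1 and -1. This is what \<open>Mg g\<close> does
  to the rows: it swaps them with arrows attached, or changes a sign.\<close>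

lemma model_section_Mg:
  assumes "graded A"
  shows "model_section (Mg g ** A) \<approx>\<^sub>c fvar g * model_section A"
proof -
  obtain a b c d where A: "A = M2 a b c d" by (rule M2_cases)
  have h: "homog 0 a" "homog 1 b" "homog (- 1) c" "homog 0 d" using assms by (simp_all add: A)
  have swap: "fe2 * (fvar g * u) + fe1 * (fvar g * v) \<approx>\<^sub>c fvar g * (fe1 * u + fe2 * v)"
    if "g = GX \<or> g = GY" for u v
  proof -
    have "fe2 * fvar g * u + fe1 * fvar g * v \<approx>\<^sub>c fvar g * fe1 * u + fvar g * fe2 * v"
      by (intro cg_add cg_rmult cg_sym[OF fxy_fe(1)[OF that]] cg_sym[OF fxy_fe(2)[OF that]])
    then show ?thesis by (simp add: mult.assoc distrib_left)
  qed
  show ?thesis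
  proof (cases g)
    case GX
    have "model_section (Mg g ** A) = fe2 * (plin W2 (vx2 * a) + plin W2 (vx2 * b)) + fe1 * (plin W1 (vx1 * c) + plin W1 (vx1 * d))"
      by (simp add: A GX)
    also have "\<dots> \<approx>\<^sub>c fe2 * (fx * plin W1 a + fx * plin W1 b) + fe1 * (fx * plin W2 c + fx * plin W2 d)"
      by (intro cg_add cg_lmult plin_W_shift[OF h(1)] plin_W_shift[OF h(2)] plin_W_shift[OF h(3)]
          plin_W_shift[OF h(4)]) auto
    also have "\<dots> = fe2 * (fx * (plin W1 a + plin W1 b)) + fe1 * (fx * (plin W2 c + plin W2 d))"
      by (simp add: distrib_left)
    also have "\<dots> \<approx>\<^sub>c fx * model_section A" using swap[of "plin W1 a + plin W1 b" "plin W2 c + plin W2 d"] by (simp add: A GX)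
    finally show ?thesis by (simp add: GX)
  next
    case GY
    have "model_section (Mg g ** A) = fe2 * (plin W2 (vy2 * a) + plin W2 (vy2 * b)) + fe1 * (plin W1 (vy1 * c) + plin W1 (vy1 * d))"
      by (simp add: A GY)
    also have "\<dots> \<approx>\<^sub>c fe2 * (fy * plin W1 a + fy * plin W1 b) + fe1 * (fy * plin W2 c + fy * plin W2 d)"
      by (intro cg_add cg_lmult plin_W_shift[OF h(1)] plin_W_shift[OF h(2)] plin_W_shift[OF h(3)]
          plin_W_shift[OF h(4)]) auto
    also have "\<dots> = fe2 * (fy * (plin W1 a + plin W1 b)) + fe1 * (fy * (plin W2 c + plin W2 d))"
      by (simp add: distrib_left)
    also have "\<dots> \<approx>\<^sub>c fy * model_section A" using swap[of "plin W1 a + plin W1 b" "plin W2 c + plin W2 d"] by (simp add: A GY)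
    finally show ?thesis by (simp add: GY)
  next
    case GZ
    have "model_section (Mg g ** A) = fe1 * (plin W1 a + plin W1 b) + - fe2 * (plin W2 c + plin W2 d)"
      by (simp add: A GZ algebra_simps)
    also have "\<dots> \<approx>\<^sub>c fz * fe1 * (plin W1 a + plin W1 b) + fz * fe2 * (plin W2 c + plin W2 d)"
      by (intro cg_add cg_rmult cg_sym[OF fz_fe(1)] cg_sym[OF fz_fe(2)])
    also have "\<dots> = fz * model_section A" by (simp add: A distrib_left mult.assoc)
    finally show ?thesis by (simp add: GZ)
  qed
qed

lemma model_section_model: "model_section (model f) \<approx>\<^sub>c f"
proof (induction f rule: falg_induct)
  case (const c)
  have "model_section (mat (mconst c)) = (fe1 + fe2) * fconst c"
    by (simp add: mat_M2 mconst_def W1_def W2_def distrib_right)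
  then show ?case by (simp add: fe_add)
next
  case (mult g f)
  have "model_section (model (fvar g * f)) \<approx>\<^sub>c fvar g * model_section (model f)" using model_section_Mg[OF graded_model] by simp
  also have "\<dots> \<approx>\<^sub>c fvar g * f" by (rule cg_lmult[OF mult])
  finally show ?case .
next
  case (add f g)
  then show ?case by (simp add: model_section_add cg_add)
qed

lemma model_relations: "model f = 0" if "f \<in> conifold_relations"
  using that by (auto simp: conifold_relations_def Let_def power2_eq_square zero_M2 mat_M2 mult_ac)

text \<open>The relations hold in the model, which gives one inclusion. Conversely \<open>f\<close>
  is congruent to the section of its model, so a vanishing model puts \<open>f\<close> into the
  ideal. The section thereby replaces a confluence argument for the five relations.\<close>

theorem relation_ideal_eq_kernel: "f \<in> I_con \<longleftrightarrow> model f = 0"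
proof
  assume "f \<in> I_con"
  then show "model f = 0"
    by (rule relation_ideal_minimal[rotated 5]) (auto simp: model_relations)
next
  assume "model f = 0"
  then have "0 \<approx>\<^sub>c f" using model_section_model[of f] by (simp add: zero_M2)
  then have "f \<approx>\<^sub>c 0" by (rule cg_sym)
  then show "f \<in> I_con" by (simp add: cg_def)
qed

section \<open>Surjectivity of the model onto the graded matrices\<close>

lemma mvar_power: "mvar i ^ k = Poly_Mapping.single (Poly_Mapping.single i k) 1"
  by (induction k) (simp_all add: mvar_def mult_single flip: single_add)

definition mono4 :: "nat \<Rightarrow> nat \<Rightarrow> nat \<Rightarrow> nat \<Rightarrow> 4 mpoly" where
  "mono4 p q p' q' = vx1 ^ p * vy1 ^ q * vx2 ^ p' * vy2 ^ q'"

lemma single_eq_mono4: "Poly_Mapping.single m c = mconst c *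
    mono4 (Poly_Mapping.lookup m 1) (Poly_Mapping.lookup m 2) (Poly_Mapping.lookup m 3) (Poly_Mapping.lookup m 4)"
proof -
  have "m = Poly_Mapping.single 1 (Poly_Mapping.lookup m 1) + Poly_Mapping.single 2 (Poly_Mapping.lookup m 2)
     + Poly_Mapping.single 3 (Poly_Mapping.lookup m 3) + Poly_Mapping.single 4 (Poly_Mapping.lookup m 4)" (is "m = ?n")
  proof (rule poly_mapping_eqI)
    show "Poly_Mapping.lookup m k = Poly_Mapping.lookup ?n k" for k
      using exhaust_4[of k] by (auto simp: lookup_add lookup_single when_def)
  qed
  then have "Poly_Mapping.single m c = Poly_Mapping.single ?n c" by (rule arg_cong)
  also have "\<dots> = mconst c * mono4 (Poly_Mapping.lookup m 1) (Poly_Mapping.lookup m 2) (Poly_Mapping.lookup m 3) (Poly_Mapping.lookup m 4)"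
    by (simp only: mono4_def mvar_power mconst_def mult_single mult_1_right add_0 mult_1)
  finally show ?thesis .
qed

lemma model_W:
  "p + q = p' + q' \<Longrightarrow> model (W p q p' q') = M2 (mono4 p q p' q') 0 0 (mono4 p' q' p q)"
  "p + q = Suc (p' + q') \<Longrightarrow> model (W p q p' q') = M2 0 (mono4 p q p' q') (mono4 p' q' p q) 0"
proof -
  have "(p + q = p' + q' \<longrightarrow> model (W p q p' q') = M2 (mono4 p q p' q') 0 0 (mono4 p' q' p q)) \<and>
    (p + q = Suc (p' + q') \<longrightarrow> model (W p q p' q') = M2 0 (mono4 p q p' q') (mono4 p' q' p q) 0)"
  proof (induction p q p' q' rule: W.induct)
    case (1 p q p' q')
    then show ?case unfolding W.simps model_simps Mg.simps by (auto simp: mono4_def mult_ac)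
  next
    case (2 q p' q')
    then show ?case unfolding W.simps model_simps Mg.simps mono4_def power_Suc by (auto simp: mult_ac)
  qed (auto simp: mat_M2 mono4_def)
  then show "p + q = p' + q' \<Longrightarrow> model (W p q p' q') = M2 (mono4 p q p' q') 0 0 (mono4 p' q' p q)"
    "p + q = Suc (p' + q') \<Longrightarrow> model (W p q p' q') = M2 0 (mono4 p q p' q') (mono4 p' q' p q) 0"
    by blast+
qed

lemma model_fe [simp]: "model fe1 = M2 1 0 0 0" "model fe2 = M2 0 0 0 1"
proof -
  have "mconst (1/2) + mconst (1/2) = (1 :: 4 mpoly)" by (simp flip: mconst_add)
  then show "model fe1 = M2 1 0 0 0" "model fe2 = M2 0 0 0 1"
    by (simp_all add: fe1_def fe2_def mat_M2 algebra_simps)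
qed

text \<open>The entry \<open>r\<close> comes from reading the same words from the other vertex;
  multiplication by the vertex idempotent in \<open>model_section\<close> deletes it.\<close>

lemma model_plin_W:
  "homog 0 p \<Longrightarrow> \<exists>r. model (plin W1 p) = M2 p 0 0 r"
  "homog 0 p \<Longrightarrow> \<exists>r. model (plin W2 p) = M2 r 0 0 p"
  "homog 1 p \<Longrightarrow> \<exists>r. model (plin W1 p) = M2 0 p r 0"
  "homog (- 1) p \<Longrightarrow> \<exists>r. model (plin W2 p) = M2 0 r p 0"
proof -
  show "homog 0 p \<Longrightarrow> \<exists>r. model (plin W1 p) = M2 p 0 0 r"
  proof (induction rule: homog_induct)
    case (single m c)
    then show ?case by (simp add: W1_def xdeg_def model_W(1) mat_M2) (simp add: single_eq_mono4)
  qed (force simp: zero_M2)+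
  show "homog 0 p \<Longrightarrow> \<exists>r. model (plin W2 p) = M2 r 0 0 p"
  proof (induction rule: homog_induct)
    case (single m c)
    then show ?case by (simp add: W2_def xdeg_def model_W(1) mat_M2) (simp add: single_eq_mono4)
  qed (force simp: zero_M2)+
  show "homog 1 p \<Longrightarrow> \<exists>r. model (plin W1 p) = M2 0 p r 0"
  proof (induction rule: homog_induct)
    case (single m c)
    then show ?case by (simp add: W1_def xdeg_def model_W(2) mat_M2) (simp add: single_eq_mono4)
  qed (force simp: zero_M2)+
  show "homog (- 1) p \<Longrightarrow> \<exists>r. model (plin W2 p) = M2 0 r p 0"
  proof (induction rule: homog_induct)
    case (single m c)
    then show ?case by (simp add: W2_def xdeg_def model_W(2) mat_M2) (simp add: single_eq_mono4)
  qed (force simp: zero_M2)+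
qed

theorem model_model_section:
  assumes "graded A"
  shows "model (model_section A) = A"
proof -
  obtain a b c d where A: "A = M2 a b c d" by (rule M2_cases)
  have h: "homog 0 a" "homog 1 b" "homog (- 1) c" "homog 0 d" using assms by (simp_all add: A)
  show ?thesis
    using model_plin_W(1)[OF h(1)] model_plin_W(3)[OF h(2)] model_plin_W(4)[OF h(3)] model_plin_W(2)[OF h(4)]
    by (auto simp: A)
qed

section \<open>The cone as the ring of invariants\<close>

definition kmap :: "('k \<Rightarrow> 'l) \<Rightarrow> ('k \<Rightarrow>\<^sub>0 complex) \<Rightarrow> ('l \<Rightarrow>\<^sub>0 complex)" where
  "kmap h p = (\<Sum>m\<in>Poly_Mapping.keys p. Poly_Mapping.single (h m) (Poly_Mapping.lookup p m))"

lemma kmap_superset: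
  assumes "finite A" "Poly_Mapping.keys p \<subseteq> A"
  shows "kmap h p = (\<Sum>m\<in>A. Poly_Mapping.single (h m) (Poly_Mapping.lookup p m))"
  unfolding kmap_def using assms by (intro sum.mono_neutral_left) (auto simp: in_keys_iff)

lemma kmap_0 [simp]: "kmap h 0 = 0"
  by (simp add: kmap_def)

lemma kmap_single [simp]: "kmap h (Poly_Mapping.single m c) = Poly_Mapping.single (h m) c"
  by (subst kmap_superset[where A="{m}"]) auto

lemma kmap_add [simp]: "kmap h (p + q) = kmap h p + kmap h q"
  by (subst (1 2 3) kmap_superset[where A="Poly_Mapping.keys p \<union> Poly_Mapping.keys q"])
    (use keys_add[of p q] in \<open>auto simp: lookup_add single_add sum.distrib\<close>)

lemma kmap_uminus [simp]: "kmap h (- p) = - kmap h p"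
  using kmap_add[of h p "- p"] by (simp add: add_eq_0_iff)

lemma kmap_mult:
  fixes h :: "'k::monoid_add \<Rightarrow> 'l::monoid_add"
  assumes "\<And>m n. h (m + n) = h m + h n"
  shows "kmap h (p * q) = kmap h p * kmap h q"
proof (induction p rule: pm_induct)
  case (single k c)
  show ?case
    by (induction q rule: pm_induct) (auto simp: mult_single assms distrib_left)
qed (auto simp: distrib_right)

definition key4 :: "nat \<Rightarrow> nat \<Rightarrow> nat \<Rightarrow> nat \<Rightarrow> (4 \<Rightarrow>\<^sub>0 nat)" where
  "key4 a b c d = Poly_Mapping.single 1 a + Poly_Mapping.single 2 b + Poly_Mapping.single 3 c + Poly_Mapping.single 4 d"

lemma lookup_key4 [simp]:
  "Poly_Mapping.lookup (key4 a b c d) 1 = a" "Poly_Mapping.lookup (key4 a b c d) 2 = b"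
  "Poly_Mapping.lookup (key4 a b c d) 3 = c" "Poly_Mapping.lookup (key4 a b c d) 4 = d"
  by (simp_all add: key4_def lookup_add lookup_single when_def)

lemma key4_eqI:
  assumes "Poly_Mapping.lookup m 1 = Poly_Mapping.lookup n 1" "Poly_Mapping.lookup m 2 = Poly_Mapping.lookup n 2"
    "Poly_Mapping.lookup m 3 = Poly_Mapping.lookup n 3" "Poly_Mapping.lookup m 4 = Poly_Mapping.lookup n 4"
  shows "m = (n :: 4 \<Rightarrow>\<^sub>0 nat)"
proof (rule poly_mapping_eqI)
  show "Poly_Mapping.lookup m k = Poly_Mapping.lookup n k" for k
    using exhaust_4[of k] assms by auto
qed

definition inv_key :: "(4 \<Rightarrow>\<^sub>0 nat) \<Rightarrow> (4 \<Rightarrow>\<^sub>0 nat)" where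
  "inv_key n = (let n1 = Poly_Mapping.lookup n 1; n2 = Poly_Mapping.lookup n 2;
     n3 = Poly_Mapping.lookup n 3; n4 = Poly_Mapping.lookup n 4 in
     key4 (n1 + n3) (n2 + n4) (n1 + n4) (n2 + n3))"

text \<open>The substitution \<open>a = x\<^sub>1 x\<^sub>2, b = y\<^sub>1 y\<^sub>2, c = x\<^sub>1 y\<^sub>2, d = y\<^sub>1 x\<^sub>2\<close>.\<close>

definition cone_subst :: "4 mpoly \<Rightarrow> 4 mpoly" where
  "cone_subst = kmap inv_key"

text \<open>A preimage of a degree-zero monomial that uses at most one of \<open>c\<close> and
  \<open>d\<close>: factors \<open>x\<^sub>1 x\<^sub>2\<close> and
  \<open>y\<^sub>1 y\<^sub>2\<close> are split off as far as possible, and the surplus of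
  \<open>x\<^sub>1\<close> or of \<open>x\<^sub>2\<close> goes into \<open>c\<close> or
  \<open>d\<close>.\<close>

definition sect_key :: "(4 \<Rightarrow>\<^sub>0 nat) \<Rightarrow> (4 \<Rightarrow>\<^sub>0 nat)" where
  "sect_key m = (let m1 = Poly_Mapping.lookup m 1; m2 = Poly_Mapping.lookup m 2;
     m3 = Poly_Mapping.lookup m 3; m4 = Poly_Mapping.lookup m 4 in
     if m3 \<le> m1 then key4 m3 m2 (m1 - m3) 0 else key4 m1 m4 0 (m3 - m1))"

lemma inv_key_add: "inv_key (m + n) = inv_key m + inv_key n"
  by (rule key4_eqI) (simp_all add: inv_key_def Let_def lookup_add)

lemma cone_subst_simps [simp]:
  "cone_subst (p + q) = cone_subst p + cone_subst q" "cone_subst (p * q) = cone_subst p * cone_subst q" "cone_subst 0 = 0" "cone_subst (- p) = - cone_subst p"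
  by (simp_all add: cone_subst_def kmap_mult inv_key_add)

lemma cone_subst_diff [simp]: "cone_subst (p - q) = cone_subst p - cone_subst q"
  using cone_subst_simps(1)[of p "- q"] by simp

lemma cone_subst_mconst [simp]: "cone_subst (mconst c) = mconst c"
proof -
  have "inv_key 0 = 0" by (rule key4_eqI) (simp_all add: inv_key_def Let_def)
  then show ?thesis by (simp add: cone_subst_def mconst_def)
qed

lemma cone_subst_1 [simp]: "cone_subst 1 = 1"
  using cone_subst_mconst[of 1] by simp

lemma homog_cone_subst: "homog 0 (cone_subst p)"
proof (induction p rule: pm_induct)
  case (single k c)
  show ?case by (simp add: cone_subst_def homog_single xdeg_def inv_key_def Let_def)
qed (auto intro: homog_add)

lemma cone_subst_section: "homog 0 p \<Longrightarrow> cone_subst (kmap sect_key p) = p"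
proof (induction rule: homog_induct)
  case (single m c)
  then have "inv_key (sect_key m) = m"
    by (intro key4_eqI) (auto simp: inv_key_def sect_key_def Let_def xdeg_def)
  then show ?case by (simp add: cone_subst_def)
qed auto

lemma cone_subst_mvar [simp]: "cone_subst (mvar 1) = vx1 * vx2" "cone_subst (mvar 2) = vy1 * vy2"
    "cone_subst (mvar 3) = vx1 * vy2" "cone_subst (mvar 4) = vy1 * vx2"
  by (auto simp: cone_subst_def mvar_def mult_single inv_key_def Let_def lookup_single when_def key4_def
      intro!: arg_cong2[where f=Poly_Mapping.single] key4_eqI simp: lookup_add)

lemma ideal_cone_ideal: "ideal cone_ideal ring_of_type_algebra"
proof -
  interpret R: cring "ring_of_type_algebra :: 4 mpoly ring" by (rule cring_from_type_algebra)
  show ?thesis unfolding cone_ideal_def by (rule R.genideal_ideal) (simp add: type_ring_simps)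
qed

lemma type_ring_minus:
  "\<ominus>\<^bsub>ring_of_type_algebra\<^esub> a = - (a :: 'a::comm_ring_1)" "a \<ominus>\<^bsub>ring_of_type_algebra\<^esub> b = a - b"
proof -
  interpret R: cring "ring_of_type_algebra :: 'a ring" by (rule cring_from_type_algebra)
  show *: "\<ominus>\<^bsub>ring_of_type_algebra\<^esub> a = - a" for a :: 'a
    by (rule R.minus_equality) (simp_all add: type_ring_simps)
  show "a \<ominus>\<^bsub>ring_of_type_algebra\<^esub> b = a - b"
    unfolding a_minus_def * by (simp add: type_ring_simps)
qed

lemma type_ideal:
  fixes J :: "'a::comm_ring_1 set"
  assumes "ideal J ring_of_type_algebra"
  shows "0 \<in> J" "p \<in> J \<Longrightarrow> q \<in> J \<Longrightarrow> p + q \<in> J" "p \<in> J \<Longrightarrow> r * p \<in> J" "p \<in> J \<Longrightarrow> - p \<in> J"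
proof -
  interpret J: ideal J "ring_of_type_algebra :: 'a ring" by (rule assms)
  show "0 \<in> J" using additive_subgroup.zero_closed[OF J.additive_subgroup_axioms] by (simp add: type_ring_simps)
  show "p \<in> J \<Longrightarrow> q \<in> J \<Longrightarrow> p + q \<in> J"
    using additive_subgroup.a_closed[OF J.additive_subgroup_axioms] by (simp add: type_ring_simps)
  show l: "p \<in> J \<Longrightarrow> r * p \<in> J" for p r using J.I_l_closed by (simp add: type_ring_simps)
  show "p \<in> J \<Longrightarrow> - p \<in> J" using l[of p "-1"] by simp
qed

lemma type_idealI:
  fixes J :: "'a::comm_ring_1 set"
  assumes "0 \<in> J" "\<And>p q. p \<in> J \<Longrightarrow> q \<in> J \<Longrightarrow> p + q \<in> J" "\<And>p r. p \<in> J \<Longrightarrow> r * p \<in> J"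
  shows "ideal J ring_of_type_algebra"
proof -
  interpret R: cring "ring_of_type_algebra :: 'a ring" by (rule cring_from_type_algebra)
  have "p \<in> J \<Longrightarrow> - p \<in> J" for p using assms(3)[of p "-1"] by simp
  moreover have "p \<in> J \<Longrightarrow> p * r \<in> J" for p r using assms(3)[of p r] by (simp add: mult.commute)
  ultimately show ?thesis
    by (intro idealI R.ring_axioms R.add.subgroupI)
      (use assms in \<open>auto simp: type_ring_simps type_ring_minus\<close>)
qed

definition cone_cg :: "4 mpoly \<Rightarrow> 4 mpoly \<Rightarrow> bool" where
  "cone_cg p q \<longleftrightarrow> p - q \<in> cone_ideal"

lemmas cone_ideal_closed = type_ideal[OF ideal_cone_ideal]

lemma cone_cg_refl [simp]: "cone_cg p p"
  by (simp add: cone_cg_def cone_ideal_closed)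

lemma cone_cg_add: "cone_cg p q \<Longrightarrow> cone_cg p' q' \<Longrightarrow> cone_cg (p + p') (q + q')"
  unfolding cone_cg_def using cone_ideal_closed(2) by (metis add_diff_add)

lemma cone_cg_mult: "cone_cg p q \<Longrightarrow> cone_cg p' q' \<Longrightarrow> cone_cg (p * p') (q * q')"
proof -
  assume "cone_cg p q" "cone_cg p' q'"
  then have "p' * (p - q) + q * (p' - q') \<in> cone_ideal"
    unfolding cone_cg_def using cone_ideal_closed by blast
  then show ?thesis by (simp add: cone_cg_def algebra_simps)
qed

lemma cone_cg_power: "cone_cg p q \<Longrightarrow> cone_cg (p ^ k) (q ^ k)"
  by (induction k) (auto intro: cone_cg_mult)

lemma cone_generator: "mvar 1 * mvar 2 - mvar 3 * mvar 4 \<in> cone_ideal"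
proof -
  interpret R: cring "ring_of_type_algebra :: 4 mpoly ring" by (rule cring_from_type_algebra)
  show ?thesis unfolding cone_ideal_def by (rule R.genideal_self') (simp add: type_ring_simps)
qed

text \<open>Replacing \<open>c d\<close> by \<open>a b\<close> as often as possible brings every
  monomial to the one chosen by \<open>sect_key\<close>; the number of replacements is the smaller
  of the exponents of \<open>c\<close> and \<open>d\<close>.\<close>

lemma cone_cg_section: "cone_cg (kmap sect_key (cone_subst p)) p"
proof (induction p rule: pm_induct)
  case (single n c)
  let ?n1 = "Poly_Mapping.lookup n 1" and ?n2 = "Poly_Mapping.lookup n 2"
    and ?n3 = "Poly_Mapping.lookup n 3" and ?n4 = "Poly_Mapping.lookup n 4"
  define k where "k = min ?n3 ?n4"
  have k: "sect_key (inv_key n) = key4 (?n1 + k) (?n2 + k) (?n3 - k) (?n4 - k)"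
    by (rule key4_eqI) (auto simp: k_def sect_key_def inv_key_def Let_def)
  have "cone_cg ((mconst c * mono4 ?n1 ?n2 (?n3 - k) (?n4 - k)) * (mvar 1 * mvar 2) ^ k)
      ((mconst c * mono4 ?n1 ?n2 (?n3 - k) (?n4 - k)) * (mvar 3 * mvar 4) ^ k)"
    by (rule cone_cg_mult[OF cone_cg_refl cone_cg_power]) (simp add: cone_cg_def cone_generator)
  moreover have "(mconst c * mono4 ?n1 ?n2 (?n3 - k) (?n4 - k)) * (mvar 1 * mvar 2) ^ k
      = Poly_Mapping.single (sect_key (inv_key n)) c"
    unfolding single_eq_mono4 k by (simp add: mono4_def power_add power_mult_distrib mult_ac)
  moreover have "(mconst c * mono4 ?n1 ?n2 (?n3 - k) (?n4 - k)) * (mvar 3 * mvar 4) ^ k = Poly_Mapping.single n c"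
  proof -
    have "mono4 a b (c + k) (d + k) = mono4 a b c d * (mvar 3 * mvar 4) ^ k" for a b c d
      by (simp only: mono4_def power_add power_mult_distrib mult_ac)
    from this[of ?n1 ?n2 "?n3 - k" "?n4 - k"] show ?thesis
      unfolding single_eq_mono4 by (simp add: k_def mult.assoc)
  qed
  ultimately show ?case by (simp add: cone_subst_def)
qed (auto intro: cone_cg_add)

text \<open>A polynomial is congruent to the section of its image, so the substitution kills nothing
  outside the ideal. This is the toric presentation of the cone.\<close>

theorem cone_ideal_eq_kernel: "p \<in> cone_ideal \<longleftrightarrow> cone_subst p = 0"
proof
  interpret R: cring "ring_of_type_algebra :: 4 mpoly ring" by (rule cring_from_type_algebra)
  have "ideal {p. cone_subst p = 0} ring_of_type_algebra" by (rule type_idealI) auto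
  then have "cone_ideal \<subseteq> {p. cone_subst p = 0}"
    unfolding cone_ideal_def by (rule R.genideal_minimal) (simp add: mult_ac)
  then show "p \<in> cone_ideal \<Longrightarrow> cone_subst p = 0" by blast
next
  assume "cone_subst p = 0"
  then have "cone_cg 0 p" using cone_cg_section[of p] by simp
  then show "p \<in> cone_ideal" using cone_ideal_closed(4) by (fastforce simp: cone_cg_def)
qed

lemma type_quotient:
  fixes J :: "'a::comm_ring_1 set"
  assumes J: "ideal J ring_of_type_algebra"
  shows type_quotient_eq_iff: "J +>\<^bsub>ring_of_type_algebra\<^esub> p = J +>\<^bsub>ring_of_type_algebra\<^esub> q \<longleftrightarrow> p - q \<in> J"
    and type_quotient_carrier: "carrier (ring_of_type_algebra Quot J) = range (\<lambda>p. J +>\<^bsub>ring_of_type_algebra\<^esub> p)"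
    and type_quotient_ops:
      "(J +>\<^bsub>ring_of_type_algebra\<^esub> p) \<otimes>\<^bsub>ring_of_type_algebra Quot J\<^esub> (J +>\<^bsub>ring_of_type_algebra\<^esub> q) = J +>\<^bsub>ring_of_type_algebra\<^esub> (p * q)"
      "(J +>\<^bsub>ring_of_type_algebra\<^esub> p) \<oplus>\<^bsub>ring_of_type_algebra Quot J\<^esub> (J +>\<^bsub>ring_of_type_algebra\<^esub> q) = J +>\<^bsub>ring_of_type_algebra\<^esub> (p + q)"
      "\<one>\<^bsub>ring_of_type_algebra Quot J\<^esub> = J +>\<^bsub>ring_of_type_algebra\<^esub> 1"
proof -
  interpret J: ideal J "ring_of_type_algebra :: 'a ring" by (rule J)
  show "J +>\<^bsub>ring_of_type_algebra\<^esub> p = J +>\<^bsub>ring_of_type_algebra\<^esub> q \<longleftrightarrow> p - q \<in> J"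
    using J.quotient_eq_iff_same_a_r_cos[OF J.ideal_axioms, of p q] by (simp add: type_ring_simps type_ring_minus)
  show "carrier (ring_of_type_algebra Quot J) = range (\<lambda>p. J +>\<^bsub>ring_of_type_algebra\<^esub> p)"
    by (auto simp: FactRing_def A_RCOSETS_def RCOSETS_def a_r_coset_def type_ring_simps)
  have hom: "(\<lambda>p. J +>\<^bsub>ring_of_type_algebra\<^esub> p) \<in> ring_hom ring_of_type_algebra (ring_of_type_algebra Quot J)"
    by (rule J.rcos_ring_hom)
  show "(J +>\<^bsub>ring_of_type_algebra\<^esub> p) \<otimes>\<^bsub>ring_of_type_algebra Quot J\<^esub> (J +>\<^bsub>ring_of_type_algebra\<^esub> q) = J +>\<^bsub>ring_of_type_algebra\<^esub> (p * q)"
    "(J +>\<^bsub>ring_of_type_algebra\<^esub> p) \<oplus>\<^bsub>ring_of_type_algebra Quot J\<^esub> (J +>\<^bsub>ring_of_type_algebra\<^esub> q) = J +>\<^bsub>ring_of_type_algebra\<^esub> (p + q)"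
    "\<one>\<^bsub>ring_of_type_algebra Quot J\<^esub> = J +>\<^bsub>ring_of_type_algebra\<^esub> 1"
    using hom by (auto simp: ring_hom_def type_ring_simps)
qed

section \<open>The conifold algebra in matrix coordinates\<close>

abbreviation "\<Lambda> \<equiv> conifold_algebra"

text \<open>Elements of the algebra are named by their matrices. \<open>cl\<close> is total, but its
  injectivity is established on \<open>graded\<close> matrices, hence the grading hypotheses
  throughout.\<close>

definition cl :: "4 mpoly ^ 2 ^ 2 \<Rightarrow> conifold_gen falg set" where
  "cl A = residue_class conifold_relations (model_section A)"

lemma residue_class_eq_cl: "residue_class conifold_relations f = cl (model f)"
  using cg_sym[OF model_section_model[of f]] by (simp add: cl_def residue_class_eq_iff cg_def)

lemma cl_eq_iff: "graded A \<Longrightarrow> graded B \<Longrightarrow> cl A = cl B \<longleftrightarrow> A = B"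
  by (auto simp: cl_def residue_class_eq_iff relation_ideal_eq_kernel model_model_section)

lemma carrier_conifold: "carrier \<Lambda> = cl ` {A. graded A}"
proof -
  have "carrier \<Lambda> = range (residue_class conifold_relations)"
    by (simp add: conifold_algebra_def carrier_presented)
  also have "\<dots> = cl ` {A. graded A}"
  proof (intro equalityI subsetI)
    show "x \<in> cl ` {A. graded A}" if "x \<in> range (residue_class conifold_relations)" for x
      using that graded_model by (auto simp: residue_class_eq_cl)
    show "x \<in> range (residue_class conifold_relations)" if "x \<in> cl ` {A. graded A}" for x
      using that by (auto simp: cl_def)
  qed
  finally show ?thesis .
qed

lemma cl_carrier: "graded A \<Longrightarrow> cl A \<in> carrier \<Lambda>"
  by (simp add: carrier_conifold)

lemma cl_cases: assumes "x \<in> carrier \<Lambda>" obtains A where "graded A" "x = cl A"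
  using assms by (auto simp: carrier_conifold)

lemma cl_ops:
  assumes "graded A" "graded B"
  shows "cl A \<otimes>\<^bsub>\<Lambda>\<^esub> cl B = cl (A ** B)" "cl A \<oplus>\<^bsub>\<Lambda>\<^esub> cl B = cl (A + B)"
proof -
  show "cl A \<otimes>\<^bsub>\<Lambda>\<^esub> cl B = cl (A ** B)"
    unfolding cl_def[of A] cl_def[of B] conifold_algebra_def presented_simps
    unfolding residue_class_eq_cl by (simp add: assms model_model_section)
  show "cl A \<oplus>\<^bsub>\<Lambda>\<^esub> cl B = cl (A + B)"
    unfolding cl_def[of A] cl_def[of B] conifold_algebra_def presented_simps
    unfolding residue_class_eq_cl by (simp add: assms model_model_section)
qed

lemma cl_one: "\<one>\<^bsub>\<Lambda>\<^esub> = cl (mat 1)"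
  by (simp add: conifold_algebra_def presented_simps residue_class_eq_cl)

lemma ring_conifold: "ring \<Lambda>"
  unfolding conifold_algebra_def presented_def
  by (rule ideal.quotient_is_ring[OF ideal_relation_ideal])

interpretation con: ring \<Lambda>
  by (rule ring_conifold)

lemma graded_0 [simp]: "graded 0"
  by (simp add: zero_M2)

lemma graded_1 [simp]: "graded (mat 1)"
  by (simp add: graded_mat)

text \<open>The zero of the quotient is recognized as the only element that equals its own
  double.\<close>

lemma cl_zero: "\<zero>\<^bsub>\<Lambda>\<^esub> = cl 0"
proof -
  have "cl 0 \<oplus>\<^bsub>\<Lambda>\<^esub> cl 0 = cl 0" by (simp add: cl_ops)
  then show ?thesis using con.add.r_cancel_one[of "cl 0" "cl 0"] cl_carrier[of 0] by simp
qed

lemma mvar_neq_0 [simp]: "mvar i \<noteq> 0"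
proof
  assume "mvar i = 0"
  then have "Poly_Mapping.lookup (mvar i) (Poly_Mapping.single i 1) = 0" by simp
  then show False by (simp add: mvar_def)
qed

lemma centre_conifold: "centre \<Lambda> = (\<lambda>p. cl (mat p)) ` {p. homog 0 p}"
proof (intro equalityI subsetI)
  fix z assume z: "z \<in> centre \<Lambda>"
  then obtain A where A: "graded A" "z = cl A" by (auto simp: centre_def carrier_conifold)
  have comm: "A ** B = B ** A" if "graded B" for B
  proof -
    have "cl A \<otimes>\<^bsub>\<Lambda>\<^esub> cl B = cl B \<otimes>\<^bsub>\<Lambda>\<^esub> cl A"
      using z A(2) cl_carrier[OF that] by (auto simp: centre_def)
    then show ?thesis using A(1) that by (simp add: cl_ops cl_eq_iff graded_mult)
  qed
  obtain a b c d where M: "A = M2 a b c d" by (rule M2_cases)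
  \<comment> \<open>Commuting with a vertex idempotent removes the off-diagonal part. Commuting with
    the arrow \<open>x\<^sub>1\<close> identifies the diagonal entries, since
    \<open>x\<^sub>1\<close> is nonzero in a domain.\<close>
  have "b = 0" "c = 0" using comm[of "M2 1 0 0 0"] by (simp_all add: M)
  moreover have "a = d" using comm[of "M2 0 vx1 0 0"] by (simp add: M)
  ultimately have "A = mat a" by (simp add: M mat_M2)
  moreover have "homog 0 a" using A(1) by (simp add: M)
  ultimately show "z \<in> (\<lambda>p. cl (mat p)) ` {p. homog 0 p}" using A(2) by blast
next
  fix z assume "z \<in> (\<lambda>p. cl (mat p)) ` {p. homog 0 p}"
  then obtain p where p: "homog 0 p" "z = cl (mat p)" by blast
  show "z \<in> centre \<Lambda>"
    unfolding centre_def
  proof (intro CollectI conjI ballI)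
    show "z \<in> carrier \<Lambda>" using p by (simp add: cl_carrier graded_mat)
    fix x assume "x \<in> carrier \<Lambda>"
    then obtain A where "graded A" "x = cl A" by (rule cl_cases)
    then show "z \<otimes>\<^bsub>\<Lambda>\<^esub> x = x \<otimes>\<^bsub>\<Lambda>\<^esub> z"
      using p by (simp add: cl_ops graded_mat mat_mult_commute)
  qed
qed

definition sc :: "4 mpoly \<Rightarrow> conifold_gen falg set" where
  "sc p = cl (mat p)"

lemma sc_eq_iff: "homog 0 p \<Longrightarrow> homog 0 q \<Longrightarrow> sc p = sc q \<longleftrightarrow> p = q"
  by (simp add: sc_def cl_eq_iff graded_mat) (simp add: mat_M2)

lemma centre_eq_sc: "centre \<Lambda> = sc ` {p. homog 0 p}"
  by (simp add: centre_conifold sc_def[abs_def])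

lemma sc_centre: "homog 0 p \<Longrightarrow> sc p \<in> centre \<Lambda>"
  by (simp add: centre_eq_sc)

lemma sc_ops:
  assumes "homog 0 p" "homog 0 q"
  shows "sc p \<otimes>\<^bsub>\<Lambda>\<^esub> sc q = sc (p * q)" "sc p \<oplus>\<^bsub>\<Lambda>\<^esub> sc q = sc (p + q)"
  using assms by (simp_all add: sc_def cl_ops graded_mat mat_mult_mat mat_add)

lemma sc_one: "\<one>\<^bsub>\<Lambda>\<^esub> = sc 1" and sc_zero: "\<zero>\<^bsub>\<Lambda>\<^esub> = sc 0"
  by (simp_all add: sc_def cl_one cl_zero)

lemma sc_mult_cl: "homog 0 p \<Longrightarrow> graded A \<Longrightarrow> sc p \<otimes>\<^bsub>\<Lambda>\<^esub> cl A = cl (mat p ** A)"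
  by (simp add: sc_def cl_ops graded_mat)

definition cone_cls :: "4 mpoly \<Rightarrow> 4 mpoly set" where
  "cone_cls p = cone_ideal +>\<^bsub>ring_of_type_algebra\<^esub> p"

lemma cone_cls_eq_iff: "cone_cls p = cone_cls q \<longleftrightarrow> cone_subst p = cone_subst q"
  by (simp add: cone_cls_def type_quotient_eq_iff[OF ideal_cone_ideal] cone_ideal_eq_kernel)

lemma carrier_cone_ring: "carrier cone_ring = range cone_cls"
  by (simp add: cone_ring_def cone_cls_def[abs_def] type_quotient_carrier[OF ideal_cone_ideal])

lemma cone_cls_ops:
  "cone_cls p \<otimes>\<^bsub>cone_ring\<^esub> cone_cls q = cone_cls (p * q)"
  "cone_cls p \<oplus>\<^bsub>cone_ring\<^esub> cone_cls q = cone_cls (p + q)" "\<one>\<^bsub>cone_ring\<^esub> = cone_cls 1"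
  by (simp_all add: cone_ring_def cone_cls_def type_quotient_ops[OF ideal_cone_ideal])

text \<open>A coset is mapped through a chosen representative; equality of cosets is equality after
  substitution, so the choice does not matter.\<close>

definition cone_iso :: "4 mpoly set \<Rightarrow> conifold_gen falg set" where
  "cone_iso C = sc (cone_subst (SOME p. cone_cls p = C))"

lemma cone_iso_cone_cls: "cone_iso (cone_cls p) = sc (cone_subst p)"
proof -
  have "cone_cls (SOME q. cone_cls q = cone_cls p) = cone_cls p" by (rule someI) (rule refl)
  then show ?thesis by (simp add: cone_iso_def cone_cls_eq_iff)
qed

lemma centre_ring_simps:
  "carrier (centre_ring R) = centre R" "x \<otimes>\<^bsub>centre_ring R\<^esub> y = x \<otimes>\<^bsub>R\<^esub> y"
  "x \<oplus>\<^bsub>centre_ring R\<^esub> y = x \<oplus>\<^bsub>R\<^esub> y" "\<one>\<^bsub>centre_ring R\<^esub> = \<one>\<^bsub>R\<^esub>" "\<zero>\<^bsub>centre_ring R\<^esub> = \<zero>\<^bsub>R\<^esub>"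
  by (simp_all add: centre_ring_def)

theorem cone_iso_ring_iso: "cone_iso \<in> ring_iso cone_ring (centre_ring \<Lambda>)"
proof (rule ring_iso_memI)
  show "cone_iso x \<in> carrier (centre_ring \<Lambda>)" if "x \<in> carrier cone_ring" for x
    using that by (auto simp: carrier_cone_ring cone_iso_cone_cls centre_ring_simps sc_centre homog_cone_subst)
  show "cone_iso (x \<otimes>\<^bsub>cone_ring\<^esub> y) = cone_iso x \<otimes>\<^bsub>centre_ring \<Lambda>\<^esub> cone_iso y"
    "cone_iso (x \<oplus>\<^bsub>cone_ring\<^esub> y) = cone_iso x \<oplus>\<^bsub>centre_ring \<Lambda>\<^esub> cone_iso y"
    if "x \<in> carrier cone_ring" "y \<in> carrier cone_ring" for x y
    using that by (auto simp: carrier_cone_ring cone_iso_cone_cls cone_cls_ops centre_ring_simps sc_ops homog_cone_subst)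
  show "cone_iso \<one>\<^bsub>cone_ring\<^esub> = \<one>\<^bsub>centre_ring \<Lambda>\<^esub>"
    by (simp add: cone_cls_ops cone_iso_cone_cls centre_ring_simps sc_one)
  show "bij_betw cone_iso (carrier cone_ring) (carrier (centre_ring \<Lambda>))"
  proof (rule bij_betw_imageI)
    show "inj_on cone_iso (carrier cone_ring)"
    proof (rule inj_onI)
      fix x y assume "x \<in> carrier cone_ring" "y \<in> carrier cone_ring" and eq: "cone_iso x = cone_iso y"
      then obtain p q where "x = cone_cls p" "y = cone_cls q" by (auto simp: carrier_cone_ring)
      then show "x = y" using eq by (simp add: cone_iso_cone_cls sc_eq_iff homog_cone_subst cone_cls_eq_iff)
    qed
    have "sc p \<in> cone_iso ` carrier cone_ring" if "homog 0 p" for p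
    proof -
      have "sc p = cone_iso (cone_cls (kmap sect_key p))" by (simp add: cone_iso_cone_cls cone_subst_section that)
      then show ?thesis by (simp add: carrier_cone_ring)
    qed
    then show "cone_iso ` carrier cone_ring = carrier (centre_ring \<Lambda>)"
      by (auto simp: centre_ring_simps centre_eq_sc carrier_cone_ring cone_iso_cone_cls homog_cone_subst)
  qed
qed

lemma cone_iso_mconst: "cone_iso (cone_ideal +>\<^bsub>ring_of_type_algebra\<^esub> mconst c) = residue_class conifold_relations (fconst c)"
  unfolding cone_cls_def[symmetric] cone_iso_cone_cls by (simp add: sc_def residue_class_eq_cl)

section \<open>Prime ideals\<close>

lemma graded_uminus: "graded A \<Longrightarrow> graded (- A)"
  by (cases A rule: M2_cases) (simp add: homog_uminus)

lemma homog_uminus_iff [simp]: "homog d (- p) \<longleftrightarrow> homog d p"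
  using homog_uminus[of d p] homog_uminus[of d "- p"] by auto

lemma homog_mult_0: "homog 0 p \<Longrightarrow> homog 0 q \<Longrightarrow> homog 0 (p * q)"
  using homog_mult[of 0 p 0 q] by simp

lemma con_uminus: "graded A \<Longrightarrow> \<ominus>\<^bsub>\<Lambda>\<^esub> cl A = cl (- A)"
  by (rule con.minus_equality) (simp_all add: cl_ops cl_zero graded_uminus cl_carrier)

lemma con_sc_uminus: "homog 0 p \<Longrightarrow> \<ominus>\<^bsub>\<Lambda>\<^esub> sc p = sc (- p)"
  using con_uminus[OF graded_mat, of p] by (simp add: sc_def mat_M2)

lemma centre_subset: "centre R \<subseteq> carrier R"
  by (auto simp: centre_def)

lemma cring_centre: "cring (centre_ring \<Lambda>)"
proof -
  have "subring (centre \<Lambda>) \<Lambda>"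
    by (rule con.subringI)
      (auto simp: centre_eq_sc sc_ops sc_one con_sc_uminus intro!: imageI homog_add homog_mult_0,
        auto simp: sc_def cl_carrier graded_mat)
  moreover have "x \<otimes>\<^bsub>\<Lambda>\<^esub> y = y \<otimes>\<^bsub>\<Lambda>\<^esub> x"
    if "x \<in> centre \<Lambda>" "y \<in> centre \<Lambda>" for x y
    using that unfolding centre_def by blast
  ultimately have "subcring (centre \<Lambda>) \<Lambda>"
    by (intro con.subcringI)
  then show ?thesis
    using con.subcring_iff[OF centre_subset] by (simp add: centre_ring_def)
qed

lemma domain_centre: "domain (centre_ring \<Lambda>)"
proof (rule domain.intro[OF cring_centre], unfold_locales)
  show "\<one>\<^bsub>centre_ring \<Lambda>\<^esub> \<noteq> \<zero>\<^bsub>centre_ring \<Lambda>\<^esub>"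
    by (simp add: centre_ring_simps sc_one sc_zero sc_eq_iff)
  fix a b
  assume ab: "a \<otimes>\<^bsub>centre_ring \<Lambda>\<^esub> b = \<zero>\<^bsub>centre_ring \<Lambda>\<^esub>"
    and "a \<in> carrier (centre_ring \<Lambda>)" "b \<in> carrier (centre_ring \<Lambda>)"
  then obtain p q where p: "homog 0 p" "a = sc p" and q: "homog 0 q" "b = sc q"
    by (auto simp: centre_ring_simps centre_eq_sc)
  have "sc (p * q) = sc 0" using ab p q by (simp add: centre_ring_simps sc_ops sc_zero)
  then have "p * q = 0" using p(1) q(1) by (simp add: sc_eq_iff homog_mult_0 del: mult_eq_0_iff)
  then show "a = \<zero>\<^bsub>centre_ring \<Lambda>\<^esub> \<or> b = \<zero>\<^bsub>centre_ring \<Lambda>\<^esub>"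
    using p(2) q(2) by (auto simp: centre_ring_simps sc_zero)
qed

section \<open>Ideals as sets of graded matrices and of degree-zero polynomials\<close>

definition gideal :: "(4 mpoly ^ 2 ^ 2) set \<Rightarrow> bool" where
  "gideal J \<longleftrightarrow> (\<forall>A\<in>J. graded A) \<and> 0 \<in> J \<and> (\<forall>A\<in>J. \<forall>B\<in>J. A + B \<in> J) \<and>
     (\<forall>A\<in>J. \<forall>G. graded G \<longrightarrow> G ** A \<in> J \<and> A ** G \<in> J)"

definition gprime :: "(4 mpoly ^ 2 ^ 2) set \<Rightarrow> bool" where
  "gprime J \<longleftrightarrow> gideal J \<and> mat 1 \<notin> J \<and>
     (\<forall>J1 J2. gideal J1 \<and> gideal J2 \<and> (\<forall>A\<in>J1. \<forall>B\<in>J2. A ** B \<in> J) \<longrightarrow> J1 \<subseteq> J \<or> J2 \<subseteq> J)"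

definition hideal :: "4 mpoly set \<Rightarrow> bool" where
  "hideal J \<longleftrightarrow> (\<forall>p\<in>J. homog 0 p) \<and> 0 \<in> J \<and> (\<forall>p\<in>J. \<forall>q\<in>J. p + q \<in> J) \<and>
     (\<forall>p\<in>J. \<forall>q. homog 0 q \<longrightarrow> q * p \<in> J)"

definition hprime :: "4 mpoly set \<Rightarrow> bool" where
  "hprime J \<longleftrightarrow> hideal J \<and> 1 \<notin> J \<and> (\<forall>p q. homog 0 p \<and> homog 0 q \<and> p * q \<in> J \<longrightarrow> p \<in> J \<or> q \<in> J)"

lemma gidealD:
  assumes "gideal J"
  shows "A \<in> J \<Longrightarrow> graded A" "0 \<in> J" "A \<in> J \<Longrightarrow> B \<in> J \<Longrightarrow> A + B \<in> J"
    "A \<in> J \<Longrightarrow> graded G \<Longrightarrow> G ** A \<in> J" "A \<in> J \<Longrightarrow> graded G \<Longrightarrow> A ** G \<in> J"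
  using assms by (auto simp: gideal_def)

lemma hidealD:
  assumes "hideal J"
  shows "p \<in> J \<Longrightarrow> homog 0 p" "0 \<in> J" "p \<in> J \<Longrightarrow> q \<in> J \<Longrightarrow> p + q \<in> J"
    "p \<in> J \<Longrightarrow> homog 0 q \<Longrightarrow> q * p \<in> J"
  using assms by (auto simp: hideal_def)

lemma cl_image_mem_iff: "gideal J \<Longrightarrow> graded A \<Longrightarrow> cl A \<in> cl ` J \<longleftrightarrow> A \<in> J"
  using gidealD(1) cl_eq_iff by blast

lemma sc_image_mem_iff: "hideal J \<Longrightarrow> homog 0 p \<Longrightarrow> sc p \<in> sc ` J \<longleftrightarrow> p \<in> J"
  using hidealD(1) sc_eq_iff by blast

lemma cl_image_subset_iff:
  assumes "gideal J" "gideal J'"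
  shows "cl ` J \<subseteq> cl ` J' \<longleftrightarrow> J \<subseteq> J'"
proof
  assume sub: "cl ` J \<subseteq> cl ` J'"
  show "J \<subseteq> J'"
  proof
    fix A assume A: "A \<in> J"
    then have "cl A \<in> cl ` J'" using sub by (rule imageI[THEN rev_subsetD])
    then show "A \<in> J'" using cl_image_mem_iff[OF assms(2) gidealD(1)[OF assms(1) A]] by (rule iffD1[rotated])
  qed
qed (rule image_mono)

lemma sc_image_eq_iff:
  assumes "hideal J" "hideal J'"
  shows "sc ` J = sc ` J' \<longleftrightarrow> J = J'"
proof
  assume eq: "sc ` J = sc ` J'"
  have "p \<in> J \<longleftrightarrow> p \<in> J'" if "homog 0 p" for p
    using sc_image_mem_iff[OF assms(1) that] sc_image_mem_iff[OF assms(2) that] eq by simp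
  then show "J = J'" using hidealD(1)[OF assms(1)] hidealD(1)[OF assms(2)] by blast
qed simp

lemma ideal_conifold_iff: "ideal P \<Lambda> \<longleftrightarrow> (\<exists>J. gideal J \<and> P = cl ` J)"
proof
  assume P: "ideal P \<Lambda>"
  interpret P: ideal P \<Lambda> by (rule P)
  define J where "J = {A. graded A \<and> cl A \<in> P}"
  have 0: "cl 0 \<in> P"
    using additive_subgroup.zero_closed[OF P.additive_subgroup_axioms] by (simp add: cl_zero)
  have "cl (A + B) \<in> P" if "graded A" "graded B" "cl A \<in> P" "cl B \<in> P" for A B
    using additive_subgroup.a_closed[OF P.additive_subgroup_axioms that(3,4)] that by (simp add: cl_ops)
  moreover have "cl (G ** A) \<in> P" "cl (A ** G) \<in> P" if "graded A" "graded G" "cl A \<in> P" for A G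
    using P.I_l_closed[OF that(3) cl_carrier[OF that(2)]] P.I_r_closed[OF that(3) cl_carrier[OF that(2)]] that
    by (simp_all add: cl_ops)
  ultimately have "gideal J" using 0 by (auto simp: gideal_def J_def graded_add graded_mult)
  moreover have "P = cl ` J"
    using P.a_subset by (force simp: J_def carrier_conifold)
  ultimately show "\<exists>J. gideal J \<and> P = cl ` J" by blast
next
  assume "\<exists>J. gideal J \<and> P = cl ` J"
  then obtain J where J: "gideal J" "P = cl ` J" by blast
  have um: "- A \<in> J" if "A \<in> J" for A
  proof -
    have "mat (- 1) ** A \<in> J" using gidealD(4)[OF J(1) that] by (simp add: graded_mat)
    then show ?thesis by (cases A rule: M2_cases) (simp add: mat_M2)
  qed
  show "ideal P \<Lambda>"
  proof (intro idealI con.add.subgroupI con.ring_axioms)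
    show "P \<subseteq> carrier \<Lambda>"
      using gidealD(1)[OF J(1)] by (auto simp: J(2) cl_carrier)
    show "P \<noteq> {}" using gidealD(2)[OF J(1)] J(2) by blast
    show "\<ominus>\<^bsub>\<Lambda>\<^esub> a \<in> P" if "a \<in> P" for a
      using that um gidealD(1)[OF J(1)] by (auto simp: J(2) con_uminus)
    show "a \<oplus>\<^bsub>\<Lambda>\<^esub> b \<in> P" if "a \<in> P" "b \<in> P" for a b
      using that gidealD(1,3)[OF J(1)] by (auto simp: J(2) cl_ops)
    show "x \<otimes>\<^bsub>\<Lambda>\<^esub> a \<in> P" "a \<otimes>\<^bsub>\<Lambda>\<^esub> x \<in> P"
      if "a \<in> P" "x \<in> carrier \<Lambda>" for a x
      using that gidealD(1,4,5)[OF J(1)] by (auto simp: J(2) cl_ops carrier_conifold)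
  qed
qed

lemma ideal_centre_iff: "ideal P (centre_ring \<Lambda>) \<longleftrightarrow> (\<exists>J. hideal J \<and> P = sc ` J)"
proof
  assume P: "ideal P (centre_ring \<Lambda>)"
  interpret P: ideal P "centre_ring \<Lambda>" by (rule P)
  define J where "J = {p. homog 0 p \<and> sc p \<in> P}"
  have 0: "sc 0 \<in> P"
    using additive_subgroup.zero_closed[OF P.additive_subgroup_axioms] by (simp add: sc_zero centre_ring_simps)
  have "sc (p + q) \<in> P" if "homog 0 p" "homog 0 q" "sc p \<in> P" "sc q \<in> P" for p q
    using additive_subgroup.a_closed[OF P.additive_subgroup_axioms that(3,4)] that
    by (simp add: sc_ops centre_ring_simps)
  moreover have "sc (q * p) \<in> P" if "homog 0 p" "homog 0 q" "sc p \<in> P" for p q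
    using P.I_l_closed[OF that(3), of "sc q"] that by (simp add: sc_ops centre_ring_simps sc_centre)
  ultimately have "hideal J" using 0 by (auto simp: hideal_def J_def homog_add intro: homog_mult_0)
  moreover have "P = sc ` J"
    using P.a_subset by (force simp: J_def centre_eq_sc centre_ring_simps)
  ultimately show "\<exists>J. hideal J \<and> P = sc ` J" by blast
next
  assume "\<exists>J. hideal J \<and> P = sc ` J"
  then obtain J where J: "hideal J" "P = sc ` J" by blast
  interpret C: cring "centre_ring \<Lambda>" by (rule cring_centre)
  have um: "- p \<in> J" if "p \<in> J" for p
    using hidealD(4)[OF J(1) that, of "- 1"] by simp
  have minus: "\<ominus>\<^bsub>centre_ring \<Lambda>\<^esub> sc p = sc (- p)" if "homog 0 p" for p
    by (rule C.minus_equality) (use that in \<open>simp_all add: centre_ring_simps sc_ops sc_zero sc_centre\<close>)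
  show "ideal P (centre_ring \<Lambda>)"
  proof (intro idealI C.add.subgroupI C.ring_axioms)
    show "P \<subseteq> carrier (centre_ring \<Lambda>)"
      using hidealD(1)[OF J(1)] by (auto simp: J(2) sc_centre centre_ring_simps)
    show "P \<noteq> {}" using hidealD(2)[OF J(1)] J(2) by blast
    show "\<ominus>\<^bsub>centre_ring \<Lambda>\<^esub> a \<in> P" if "a \<in> P" for a
      using that um hidealD(1)[OF J(1)] by (auto simp: J(2) minus)
    show "a \<oplus>\<^bsub>centre_ring \<Lambda>\<^esub> b \<in> P" if "a \<in> P" "b \<in> P" for a b
      using that hidealD(1,3)[OF J(1)] by (auto simp: J(2) sc_ops centre_ring_simps)
    show "x \<otimes>\<^bsub>centre_ring \<Lambda>\<^esub> a \<in> P" "a \<otimes>\<^bsub>centre_ring \<Lambda>\<^esub> x \<in> P"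
      if "a \<in> P" "x \<in> carrier (centre_ring \<Lambda>)" for a x
      using that hidealD(1,4)[OF J(1)]
      by (auto simp: J(2) sc_ops centre_ring_simps centre_eq_sc mult.commute)
  qed
qed

lemma prime_spectrum_conifold_iff: "P \<in> prime_spectrum \<Lambda> \<longleftrightarrow> (\<exists>J. gprime J \<and> P = cl ` J)"
proof -
  have carr: "cl ` J = carrier \<Lambda> \<longleftrightarrow> mat 1 \<in> J" if "gideal J" for J
  proof
    assume "cl ` J = carrier \<Lambda>"
    then show "mat 1 \<in> J" using cl_image_mem_iff[OF that, of "mat 1"] by (simp add: cl_carrier)
  next
    assume "mat 1 \<in> J"
    then have "A \<in> J" if "graded A" for A using gidealD(4)[OF \<open>gideal J\<close> _ that, of "mat 1"] by simp
    then have "J = {A. graded A}" using gidealD(1)[OF that] by blast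
    then show "cl ` J = carrier \<Lambda>" by (simp add: carrier_conifold)
  qed
  have prod: "(\<forall>a\<in>cl ` J1. \<forall>b\<in>cl ` J2. a \<otimes>\<^bsub>\<Lambda>\<^esub> b \<in> cl ` J) \<longleftrightarrow> (\<forall>A\<in>J1. \<forall>B\<in>J2. A ** B \<in> J)"
    if "gideal J" "gideal J1" "gideal J2" for J J1 J2
    using gidealD(1)[OF that(2)] gidealD(1)[OF that(3)]
    by (simp add: cl_ops cl_image_mem_iff[OF that(1)] graded_mult)
  have "gprime J \<longleftrightarrow> cl ` J \<in> prime_spectrum \<Lambda>" if J: "gideal J" for J
  proof
    assume pr: "gprime J"
    show "cl ` J \<in> prime_spectrum \<Lambda>"
      unfolding prime_spectrum_def
    proof (intro CollectI conjI allI impI)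
      show "ideal (cl ` J) \<Lambda>" using J ideal_conifold_iff by blast
      show "cl ` J \<noteq> carrier \<Lambda>" using pr carr[OF J] unfolding gprime_def by blast
      fix A B assume *: "ideal A \<Lambda> \<and> ideal B \<Lambda> \<and>
        (\<forall>a\<in>A. \<forall>b\<in>B. a \<otimes>\<^bsub>\<Lambda>\<^esub> b \<in> cl ` J)"
      obtain J1 where J1: "gideal J1" "A = cl ` J1"
        using *[THEN conjunct1] unfolding ideal_conifold_iff by (elim exE conjE)
      obtain J2 where J2: "gideal J2" "B = cl ` J2"
        using *[THEN conjunct2, THEN conjunct1] unfolding ideal_conifold_iff by (elim exE conjE)
      note J12 = J1 J2
      have "\<forall>A\<in>J1. \<forall>B\<in>J2. A ** B \<in> J" 
        using *[THEN conjunct2, THEN conjunct2] unfolding J12(2,4) prod[OF J J12(1,3)] .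
      then have "J1 \<subseteq> J \<or> J2 \<subseteq> J" using pr J12(1,3) unfolding gprime_def by blast
      then show "A \<subseteq> cl ` J \<or> B \<subseteq> cl ` J" unfolding J12(2,4) by (meson image_mono)
    qed
  next
    assume pr: "cl ` J \<in> prime_spectrum \<Lambda>"
    show "gprime J"
      unfolding gprime_def
    proof (intro conjI allI impI J)
      show "mat 1 \<notin> J" using pr carr[OF J] by (simp add: prime_spectrum_def)
      fix J1 J2 assume *: "gideal J1 \<and> gideal J2 \<and> (\<forall>A\<in>J1. \<forall>B\<in>J2. A ** B \<in> J)"
      then have J12: "gideal J1" "gideal J2" by blast+
      then have "ideal (cl ` J1) \<Lambda>" "ideal (cl ` J2) \<Lambda>"
        unfolding ideal_conifold_iff by blast+
      moreover have "\<forall>a\<in>cl ` J1. \<forall>b\<in>cl ` J2. a \<otimes>\<^bsub>\<Lambda>\<^esub> b \<in> cl ` J"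
        using *[THEN conjunct2, THEN conjunct2] unfolding prod[OF J J12] .
      ultimately have "cl ` J1 \<subseteq> cl ` J \<or> cl ` J2 \<subseteq> cl ` J"
        using pr unfolding prime_spectrum_def by blast
      then show "J1 \<subseteq> J \<or> J2 \<subseteq> J" by (simp only: cl_image_subset_iff[OF J12(1) J] cl_image_subset_iff[OF J12(2) J])
    qed
  qed
  moreover have "gideal J" if "gprime J" for J using that by (simp only: gprime_def)
  moreover have "\<exists>J. gideal J \<and> P = cl ` J" if "P \<in> prime_spectrum \<Lambda>"
    using that unfolding prime_spectrum_def ideal_conifold_iff by blast
  ultimately show ?thesis by blast
qed

lemma primeideal_centre_iff: "primeideal P (centre_ring \<Lambda>) \<longleftrightarrow> (\<exists>J. hprime J \<and> P = sc ` J)"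
proof
  assume "primeideal P (centre_ring \<Lambda>)"
  then interpret P: primeideal P "centre_ring \<Lambda>" .
  obtain J where J: "hideal J" "P = sc ` J" using P.ideal_axioms ideal_centre_iff by blast
  have "1 \<notin> J"
  proof
    assume "1 \<in> J"
    then have "\<one>\<^bsub>centre_ring \<Lambda>\<^esub> \<in> P" by (simp add: J(2) centre_ring_simps sc_one)
    then show False using P.one_imp_carrier P.I_notcarr by simp
  qed
  moreover have "p \<in> J \<or> q \<in> J" if "homog 0 p" "homog 0 q" "p * q \<in> J" for p q
    using P.I_prime[of "sc p" "sc q"] that J sc_image_mem_iff[OF J(1)]
    by (auto simp: centre_ring_simps sc_ops sc_centre)
  ultimately show "\<exists>J. hprime J \<and> P = sc ` J" using J by (auto simp: hprime_def)
next
  assume "\<exists>J. hprime J \<and> P = sc ` J"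
  then obtain J where J: "hprime J" "P = sc ` J" by blast
  then have hJ: "hideal J" by (simp add: hprime_def)
  show "primeideal P (centre_ring \<Lambda>)"
  proof (rule primeidealI)
    show "ideal P (centre_ring \<Lambda>)" using J hJ ideal_centre_iff by blast
    show "cring (centre_ring \<Lambda>)" by (rule cring_centre)
    have "sc 1 \<notin> P" using J hJ by (simp add: sc_image_mem_iff hprime_def)
    then show "carrier (centre_ring \<Lambda>) \<noteq> P"
      using sc_centre[OF homog_1] by (auto simp: centre_ring_simps)
    fix a b
    assume "a \<in> carrier (centre_ring \<Lambda>)" "b \<in> carrier (centre_ring \<Lambda>)"
      and ab: "a \<otimes>\<^bsub>centre_ring \<Lambda>\<^esub> b \<in> P"
    then obtain p q where pq: "homog 0 p" "homog 0 q" "a = sc p" "b = sc q"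
      by (auto simp: centre_ring_simps centre_eq_sc)
    then have "p * q \<in> J"
      using ab J(2) by (simp add: centre_ring_simps sc_ops sc_image_mem_iff[OF hJ] homog_mult_0)
    then show "a \<in> P \<or> b \<in> P" using J pq by (auto simp: hprime_def)
  qed
qed

section \<open>Contraction of primes to the centre and extension from it\<close>

definition contract :: "(4 mpoly ^ 2 ^ 2) set \<Rightarrow> 4 mpoly set" where
  "contract J = {p. homog 0 p \<and> mat p \<in> J}"

lemma contract_Int:
  assumes J: "gideal J"
  shows "cl ` J \<inter> centre \<Lambda> = sc ` contract J"
proof -
  have "sc p \<in> cl ` J \<longleftrightarrow> mat p \<in> J" if "homog 0 p" for p
    using cl_image_mem_iff[OF J graded_mat[OF that]] by (simp add: sc_def)
  then show ?thesis by (auto simp: contract_def centre_eq_sc)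
qed

lemma mat_mult_assoc_swap: "G ** (mat p ** A) = mat p ** (G ** A)"
  for A G :: "'c::comm_ring_1 ^ 'n ^ 'n"
  by (simp only: matrix_mul_assoc mat_mult_commute[of p G])

text \<open>Central elements behave in a prime ideal as in a commutative ring: the ideal generated
  by \<open>mat p\<close>, times the ideal of matrices that \<open>p\<close> sends into
  \<open>J\<close>, lies in \<open>J\<close>, so one of the two is contained in
  \<open>J\<close>.\<close>

lemma gprime_mat_mult:
  assumes J: "gprime J" and p: "homog 0 p" and A: "graded A" and pA: "mat p ** A \<in> J"
  shows "mat p \<in> J \<or> A \<in> J"
proof -
  have gJ: "gideal J" using J by (simp add: gprime_def)
  define J1 where "J1 = {mat p ** B | B. graded B}"
  define J2 where "J2 = {B. graded B \<and> mat p ** B \<in> J}"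
  have "gideal J1" unfolding gideal_def
  proof (intro conjI ballI allI impI)
    show "0 \<in> J1" unfolding J1_def by (rule CollectI, rule exI[of _ 0]) simp
    show "graded B" if "B \<in> J1" for B using that p by (auto simp: J1_def graded_mult graded_mat)
    show "B + C \<in> J1" if BC: "B \<in> J1" "C \<in> J1" for B C
    proof -
      obtain B' C' where "B = mat p ** B'" "graded B'" "C = mat p ** C'" "graded C'"
        using BC by (auto simp: J1_def)
      then show ?thesis unfolding J1_def
        by (intro CollectI exI[of _ "B' + C'"]) (simp add: matrix_add_ldistrib graded_add)
    qed
    fix B G assume B: "B \<in> J1" and G: "graded G"
    then obtain C where C: "B = mat p ** C" "graded C" by (auto simp: J1_def)
    show "G ** B \<in> J1" unfolding C(1) mat_mult_assoc_swap J1_def using graded_mult[OF G C(2)] by blast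
    show "B ** G \<in> J1" unfolding C(1) matrix_mul_assoc[symmetric] J1_def using graded_mult[OF C(2) G] by blast
  qed
  moreover have "gideal J2" unfolding gideal_def
  proof (intro conjI ballI allI impI)
    show "0 \<in> J2" using gidealD(2)[OF gJ] by (simp add: J2_def)
    show "graded B" if "B \<in> J2" for B using that by (simp add: J2_def)
    show "B + C \<in> J2" if "B \<in> J2" "C \<in> J2" for B C
      using that gidealD(3)[OF gJ] by (simp add: J2_def graded_add matrix_add_ldistrib)
    fix B G assume B: "B \<in> J2" and G: "graded G"
    show "G ** B \<in> J2" "B ** G \<in> J2"
      using B G gidealD(4,5)[OF gJ _ G, of "mat p ** B"]
      by (simp_all add: J2_def graded_mult mat_mult_assoc_swap matrix_mul_assoc[symmetric])
  qed
  moreover have "B ** C \<in> J" if BC: "B \<in> J1" "C \<in> J2" for B C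
  proof -
    obtain D where D: "B = mat p ** D" "graded D" using BC(1) by (auto simp: J1_def)
    have "B ** C = D ** (mat p ** C)" unfolding D(1) by (simp add: mat_mult_assoc_swap matrix_mul_assoc[symmetric])
    then show ?thesis using BC(2) gidealD(4)[OF gJ _ D(2)] by (simp add: J2_def)
  qed
  ultimately have "J1 \<subseteq> J \<or> J2 \<subseteq> J" using J unfolding gprime_def by blast
  moreover have "A \<in> J2" unfolding J2_def using A pA by blast
  moreover have "mat p \<in> J1" unfolding J1_def by (rule CollectI, rule exI[of _ "mat 1"]) simp
  ultimately show ?thesis by blast
qed

lemma hprime_contract:
  assumes J: "gprime J"
  shows "hprime (contract J)"
proof -
  have gJ: "gideal J" using J by (simp add: gprime_def)
  have "hideal (contract J)" unfolding hideal_def contract_def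
    using gidealD(2,3,4)[OF gJ] by (auto simp: homog_add homog_mult_0 mat_add graded_mat simp flip: mat_mult_mat)
  moreover have "1 \<notin> contract J" using J by (simp add: contract_def gprime_def)
  moreover have "p \<in> contract J \<or> q \<in> contract J" if "homog 0 p" "homog 0 q" "p * q \<in> contract J" for p q
    using gprime_mat_mult[OF J that(1) graded_mat[OF that(2)]] that by (simp add: contract_def mat_mult_mat)
  ultimately show ?thesis unfolding hprime_def by blast
qed

text \<open>The corner of the algebra at the first vertex is a copy of \<open>S\<^sub>0\<close>. The
  elements all of whose two-sided multiples have their corner in \<open>J\<close> form the largest
  ideal with corner inside \<open>J\<close>; unlike the ideal generated by \<open>J\<close>, it is
  prime also over the vertex of the cone.\<close>

definition extend :: "4 mpoly set \<Rightarrow> (4 mpoly ^ 2 ^ 2) set" where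
  "extend J = {A. graded A \<and> (\<forall>G H. graded G \<longrightarrow> graded H \<longrightarrow> (G ** A ** H) $ 1 $ 1 \<in> J)}"

lemma gideal_extend:
  assumes J: "hideal J"
  shows "gideal (extend J)"
  unfolding gideal_def
proof (intro conjI ballI allI impI)
  show "graded A" if "A \<in> extend J" for A using that by (simp add: extend_def)
  show "0 \<in> extend J" using hidealD(2)[OF J] by (simp add: extend_def)
  show "A + B \<in> extend J" if "A \<in> extend J" "B \<in> extend J" for A B
    using that hidealD(3)[OF J] by (simp add: extend_def graded_add matrix_add_ldistrib matrix_add_rdistrib)
  fix A K assume A: "A \<in> extend J" and K: "graded K"
  have "(G ** (K ** A) ** H) $ 1 $ 1 \<in> J" if "graded G" "graded H" for G H
    using A graded_mult[OF that(1) K] that(2) by (simp add: extend_def matrix_mul_assoc)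
  then show "K ** A \<in> extend J" using A K by (simp add: extend_def graded_mult)
  have "(G ** (A ** K) ** H) $ 1 $ 1 \<in> J" if "graded G" "graded H" for G H
  proof -
    have "(G ** A ** (K ** H)) $ 1 $ 1 \<in> J" using A graded_mult[OF K that(2)] that(1) by (simp add: extend_def)
    then show ?thesis by (simp add: matrix_mul_assoc)
  qed
  then show "A ** K \<in> extend J" using A K by (simp add: extend_def graded_mult)
qed

lemma extendD: "A \<in> extend J \<Longrightarrow> graded G \<Longrightarrow> graded H \<Longrightarrow> (G ** A ** H) $ 1 $ 1 \<in> J"
  unfolding extend_def by blast

lemma contract_extend:
  assumes J: "hideal J"
  shows "contract (extend J) = J"
proof (intro equalityI subsetI)
  fix p assume "p \<in> contract (extend J)"
  then have "mat p \<in> extend J" by (simp only: contract_def mem_Collect_eq)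
  from extendD[OF this graded_1 graded_1] show "p \<in> J" by (simp add: mat_M2)
next
  fix p assume p: "p \<in> J"
  then have hp: "homog 0 p" by (rule hidealD(1)[OF J])
  have "(G ** mat p ** H) $ 1 $ 1 \<in> J" if "graded G" "graded H" for G H
  proof -
    have "(G ** mat p ** H) $ 1 $ 1 = (G ** H) $ 1 $ 1 * p"
      by (simp add: mat_mult_commute[symmetric] matrix_mul_assoc[symmetric] mat_mult_nth(1) mult.commute)
    then show ?thesis using graded_mult[OF that] hidealD(4)[OF J p] by (simp add: graded_def)
  qed
  then show "p \<in> contract (extend J)" using hp by (simp add: contract_def extend_def graded_mat)
qed

lemma corner_mem:
  assumes J: "gideal J" and A: "A \<in> J"
  shows "M2 (A $ 1 $ 1) 0 0 0 \<in> J"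
proof -
  have "M2 1 0 0 0 ** A ** M2 1 0 0 0 \<in> J" by (intro gidealD(4,5)[OF J] A) simp_all
  moreover have "M2 1 0 0 0 ** A ** M2 1 0 0 0 = M2 (A $ 1 $ 1) 0 0 0" by (cases A rule: M2_cases) simp
  ultimately show ?thesis by simp
qed

text \<open>An ideal not contained in \<open>extend J\<close> has a corner element outside
  \<open>J\<close>; two such corner elements multiply as in the centre, where \<open>J\<close> is
  prime.\<close>

lemma gprime_extend:
  assumes J: "hprime J"
  shows "gprime (extend J)"
proof -
  have hJ: "hideal J" using J by (simp add: hprime_def)
  have "mat 1 \<notin> extend J"
    using contract_extend[OF hJ] J by (auto simp: hprime_def contract_def)
  moreover have "J1 \<subseteq> extend J \<or> J2 \<subseteq> extend J"
    if gi: "gideal J1" "gideal J2" and prod: "\<forall>A\<in>J1. \<forall>B\<in>J2. A ** B \<in> extend J" for J1 J2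
  proof (rule ccontr)
    have ex: "\<exists>p. homog 0 p \<and> p \<notin> J \<and> M2 p 0 0 0 \<in> K" if K: "gideal K" and nK: "\<not> K \<subseteq> extend J" for K
    proof -
      obtain A where A: "A \<in> K" "A \<notin> extend J" using nK by blast
      then obtain G H where GH: "graded G" "graded H" "(G ** A ** H) $ 1 $ 1 \<notin> J"
        using gidealD(1)[OF K] by (auto simp: extend_def)
      have K': "G ** A ** H \<in> K" by (intro gidealD(4,5)[OF K] A GH)
      from gidealD(1)[OF K this] have "homog 0 ((G ** A ** H) $ 1 $ 1)" by (simp add: graded_def)
      then show ?thesis using corner_mem[OF K K'] GH(3) by blast
    qed
    assume "\<not> ?thesis"
    then obtain p q where p: "homog 0 p" "p \<notin> J" "M2 p 0 0 0 \<in> J1" and q: "homog 0 q" "q \<notin> J" "M2 q 0 0 0 \<in> J2"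
      using ex[OF gi(1)] ex[OF gi(2)] by blast
    have "M2 p 0 0 0 ** M2 q 0 0 0 \<in> extend J" using prod p q by blast
    from extendD[OF this graded_1 graded_1] have "p * q \<in> J" by (simp add: mat_M2)
    then show False using J p q by (auto simp: hprime_def)
  qed
  ultimately show ?thesis using gideal_extend[OF hJ] unfolding gprime_def by blast
qed

text \<open>Where some \<open>uw\<close> is invertible the algebra is a matrix algebra over its centre,
  and a prime is recovered from its central part.\<close>

lemma gprime_eq_extend:
  assumes J: "gprime J" and u: "homog 1 u" and w: "homog (- 1) w" and uw: "u * w \<notin> contract J"
  shows "J = extend (contract J)"
proof (intro equalityI subsetI)
  have gJ: "gideal J" using J by (simp add: gprime_def)
  have hc: "hprime (contract J)" by (rule hprime_contract[OF J])
  have huw: "homog 0 (u * w)" using homog_mult[OF u w] by simp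
  {
    fix A assume A: "A \<in> J"
    have "(G ** A ** H) $ 1 $ 1 \<in> contract J" if "graded G" "graded H" for G H
    proof -
      define r where "r = (G ** A ** H) $ 1 $ 1"
      have B: "G ** A ** H \<in> J" by (intro gidealD(4,5)[OF gJ] that A)
      have r: "homog 0 r" using gidealD(1)[OF gJ B] by (simp add: graded_def r_def)
      have E: "M2 r 0 0 0 \<in> J" using corner_mem[OF gJ B] by (simp add: r_def)
      \<comment> \<open>The arrows \<open>w\<close> and \<open>u\<close> carry the corner entry
        \<open>r\<close> to the second diagonal place as \<open>u w r\<close>, so the sum is the
        scalar matrix of \<open>u w r\<close>.\<close>
      have "mat (u * w) ** M2 r 0 0 0 + M2 0 0 w 0 ** M2 r 0 0 0 ** M2 0 u 0 0 \<in> J"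
        by (intro gidealD(3,4,5)[OF gJ] E) (use huw u w in \<open>simp_all add: graded_mat\<close>)
      moreover have "mat (u * w) ** M2 r 0 0 0 + M2 0 0 w 0 ** M2 r 0 0 0 ** M2 0 u 0 0 = mat (u * w * r)"
        by (simp add: mat_M2 mult_ac)
      ultimately have "u * w * r \<in> contract J"
        using homog_mult'[OF huw r] by (simp add: contract_def)
      then show ?thesis using hc huw r uw unfolding hprime_def r_def[symmetric] by blast
    qed
    then show "A \<in> extend (contract J)" using gidealD(1)[OF gJ A] by (simp add: extend_def)
  }
  {
    fix A assume A: "A \<in> extend (contract J)"
    have gA: "graded A" using A by (simp add: extend_def)
    obtain a b c d where M: "A = M2 a b c d" by (rule M2_cases)
    \<comment> \<open>All four entries of \<open>A\<close>, brought to the corner by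
      \<open>u\<close> and \<open>w\<close>, become central elements of \<open>J\<close>. Recombined
      they give \<open>A\<close> times the square of \<open>u w\<close>, and that factor is outside
      the prime.\<close>
    have E: "mat ((G ** A ** H) $ 1 $ 1) \<in> J" if "graded G" "graded H" for G H
      using A that by (simp add: extend_def contract_def)
    have "mat a \<in> J" using E[of "mat 1" "mat 1"] by (simp add: M)
    moreover have "mat (b * w) \<in> J" using E[of "mat 1" "M2 0 0 w 0"] w by (simp add: M)
    moreover have "mat (u * c) \<in> J" using E[of "M2 0 u 0 0" "mat 1"] u by (simp add: M)
    moreover have "mat (u * d * w) \<in> J" using E[of "M2 0 u 0 0" "M2 0 0 w 0"] u w by (simp add: M)
    ultimately have "mat a ** M2 (u * w * (u * w)) 0 0 0 + mat (b * w) ** M2 0 (u * (u * w)) 0 0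
       + mat (u * c) ** M2 0 0 (w * (u * w)) 0 + mat (u * d * w) ** M2 0 0 0 (u * w) \<in> J"
      by (intro gidealD(3,5)[OF gJ])
        (use u w huw homog_mult[OF huw huw] homog_mult[OF u huw] homog_mult[OF w huw] in simp_all)
    moreover have "mat a ** M2 (u * w * (u * w)) 0 0 0 + mat (b * w) ** M2 0 (u * (u * w)) 0 0
       + mat (u * c) ** M2 0 0 (w * (u * w)) 0 + mat (u * d * w) ** M2 0 0 0 (u * w) = mat (u * w * (u * w)) ** A"
      by (simp add: mat_M2 M mult_ac)
    ultimately have "mat (u * w * (u * w)) \<in> J \<or> A \<in> J"
      using gprime_mat_mult[OF J _ gA, of "u * w * (u * w)"] homog_mult[OF huw huw] by simp
    moreover have "mat (u * w * (u * w)) \<notin> J"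
      using hc huw uw homog_mult[OF huw huw] unfolding hprime_def by (auto simp: contract_def)
    ultimately show "A \<in> J" by blast
  }
qed

definition vertex_ideal :: "4 mpoly set" where
  "vertex_ideal = {cone_subst f | f. meval f 0 = 0}"

text \<open>If every \<open>u w\<close> lay in \<open>J\<close>, so would the images of
  \<open>a, b, c, d\<close>; then \<open>J\<close> contains the maximal ideal of the vertex, and a
  proper ideal containing it equals it.\<close>

lemma hprime_arrow:
  assumes J: "hprime J" and ne: "J \<noteq> vertex_ideal"
  shows "\<exists>u w. homog 1 u \<and> homog (- 1) w \<and> u * w \<notin> J"
proof (rule ccontr)
  assume "\<not> ?thesis"
  then have all: "u * w \<in> J" if "homog 1 u" "homog (- 1) w" for u w using that by blast
  have hJ: "hideal J" using J by (simp add: hprime_def)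
  have gen: "cone_subst (mvar i) \<in> J" for i
    using exhaust_4[of i] all[OF homog_mvar(1) homog_mvar(3)] all[OF homog_mvar(2) homog_mvar(4)]
      all[OF homog_mvar(1) homog_mvar(4)] all[OF homog_mvar(2) homog_mvar(3)] by auto
  have fac: "cone_subst (mvar i * f) \<in> J" for i f
    using hidealD(4)[OF hJ gen homog_cone_subst] by (simp add: mult.commute)
  \<comment> \<open>Modulo \<open>J\<close> an invariant is its value at the vertex: every
    nonconstant monomial has a factor \<open>mvar i\<close>, whose image lies in
    \<open>J\<close>.\<close>
  have dec: "cone_subst f - mconst (meval f 0) \<in> J" for f
  proof (induction f rule: pm_induct)
    case zero
    show ?case using hidealD(2)[OF hJ] by simp
  next
    case (single n c)
    show ?case
    proof (cases "n = 0")
      case True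
      have "Poly_Mapping.single n c = mconst c" by (simp add: True mconst_def)
      then show ?thesis using hidealD(2)[OF hJ] by simp
    next
      case False
      then obtain i where i: "Poly_Mapping.lookup n i \<noteq> 0" by (metis lookup_zero poly_mapping_eqI)
      have n: "n = Poly_Mapping.single i 1 + (n - Poly_Mapping.single i 1)"
        using i by (intro poly_mapping_eqI) (auto simp: lookup_add lookup_minus lookup_single when_def)
      have "Poly_Mapping.single n c = mvar i * Poly_Mapping.single (n - Poly_Mapping.single i 1) c"
        unfolding mvar_def mult_single using n by simp
      then show ?thesis using fac by simp
    qed
  next
    case (add f g)
    from hidealD(3)[OF hJ add] show ?case by (simp add: mconst_add algebra_simps)
  qed
  have "vertex_ideal \<subseteq> J"
  proof
    fix p assume "p \<in> vertex_ideal"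
    then obtain f where "p = cone_subst f" "meval f 0 = 0" by (auto simp: vertex_ideal_def)
    then show "p \<in> J" using dec[of f] by simp
  qed
  then obtain p where p: "p \<in> J" "p \<notin> vertex_ideal" using ne by blast
  define f where "f = kmap sect_key p"
  have f: "cone_subst f = p" using cone_subst_section hidealD(1)[OF hJ p(1)] by (simp add: f_def)
  define c where "c = meval f 0"
  have c: "c \<noteq> 0" using p(2) f by (auto simp: vertex_ideal_def c_def)
  \<comment> \<open>An element of \<open>J\<close> outside the vertex ideal has a nonzero value
    \<open>c\<close> at the vertex; subtracting its remaining part leaves the unit \<open>c\<close>
    in \<open>J\<close>.\<close>
  have "- 1 * (p - mconst c) \<in> J"
    using hidealD(4)[OF hJ, of "p - mconst c" "- 1"] dec[of f] f by (simp add: c_def)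
  from hidealD(3)[OF hJ this p(1)] have "mconst c \<in> J" by simp
  from hidealD(4)[OF hJ this homog_mconst, of "inverse c"] have "mconst (inverse c * c) \<in> J"
    by (simp only: mconst_mult)
  then show False using c J by (simp add: hprime_def)
qed

lemma cone_iso_point_ideal: "cone_iso ` point_ideal cone_ideal 0 = sc ` vertex_ideal"
proof -
  have "point_ideal cone_ideal 0 = {cone_cls f | f. meval f 0 = 0}"
    by (simp add: point_ideal_def cone_cls_def)
  then show ?thesis unfolding vertex_ideal_def by (auto simp: cone_iso_cone_cls image_iff) (metis cone_iso_cone_cls)
qed

theorem prime_spectrum_centre:
  "(\<lambda>P. P \<inter> centre \<Lambda>)
      \<in> prime_spectrum \<Lambda> \<rightarrow> {p. primeideal p (centre_ring \<Lambda>)}"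
proof
  fix P assume "P \<in> prime_spectrum \<Lambda>"
  then obtain J where J: "gprime J" "P = cl ` J" by (auto simp: prime_spectrum_conifold_iff)
  then have "P \<inter> centre \<Lambda> = sc ` contract J" by (simp add: contract_Int gprime_def)
  then show "P \<inter> centre \<Lambda> \<in> {p. primeideal p (centre_ring \<Lambda>)}"
    using hprime_contract[OF J(1)] primeideal_centre_iff by auto
qed

theorem prime_spectrum_bij:
  "bij_betw (\<lambda>P. P \<inter> centre \<Lambda>)
     {P \<in> prime_spectrum \<Lambda>. P \<inter> centre \<Lambda> \<noteq> cone_iso ` point_ideal cone_ideal 0}
     ({p. primeideal p (centre_ring \<Lambda>)} - {cone_iso ` point_ideal cone_ideal 0})"
    (is "bij_betw ?r ?A ?B")
proof (rule bij_betw_imageI)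
  \<comment> \<open>Away from the vertex \<open>gprime_eq_extend\<close> recovers a prime from its
    contraction, which is injectivity; surjectivity comes from \<open>extend\<close>.\<close>
  have dom: "\<exists>J. gprime J \<and> P = cl ` J \<and> ?r P = sc ` contract J \<and> J = extend (contract J)" if P: "P \<in> ?A" for P
  proof -
    obtain J where J: "gprime J" "P = cl ` J" using P by (auto simp: prime_spectrum_conifold_iff)
    have r: "?r P = sc ` contract J" using J by (simp add: contract_Int gprime_def)
    have hc: "hprime (contract J)" by (rule hprime_contract[OF J(1)])
    have "contract J \<noteq> vertex_ideal" using that r by (auto simp: cone_iso_point_ideal)
    then obtain u w where uw: "homog 1 u" "homog (- 1) w" "u * w \<notin> contract J" using hprime_arrow[OF hc] by blast
    from gprime_eq_extend[OF J(1) uw] J r show ?thesis by (intro exI[of _ J] conjI)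
  qed
  show "inj_on ?r ?A"
  proof (rule inj_onI)
    fix P P' assume P: "P \<in> ?A" and P': "P' \<in> ?A" and eq: "?r P = ?r P'"
    obtain J J' where J: "gprime J" "P = cl ` J" "?r P = sc ` contract J" "J = extend (contract J)"
      and J': "gprime J'" "P' = cl ` J'" "?r P' = sc ` contract J'" "J' = extend (contract J')"
      using dom[OF P] dom[OF P'] by (elim exE conjE)
    have "hideal (contract J)" "hideal (contract J')"
      using hprime_contract J(1) J'(1) by (auto simp: hprime_def)
    then have "contract J = contract J'" using eq J(3) J'(3) sc_image_eq_iff by simp
    then have "J = J'" using J(4) J'(4) by metis
    then show "P = P'" using J(2) J'(2) by (simp only:)
  qed
  show "?r ` ?A = ?B"
  proof (intro equalityI subsetI)
    fix p assume "p \<in> ?r ` ?A"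
    then show "p \<in> ?B" using prime_spectrum_centre by auto
  next
    fix p assume p: "p \<in> ?B"
    then obtain J where J: "hprime J" "p = sc ` J" using primeideal_centre_iff by auto
    have hJ: "hideal J" using J by (simp add: hprime_def)
    have "cl ` extend J \<in> prime_spectrum \<Lambda>"
      using gprime_extend[OF J(1)] prime_spectrum_conifold_iff by blast
    moreover have "?r (cl ` extend J) = p"
      using J(2) contract_Int[OF gideal_extend[OF hJ]] contract_extend[OF hJ] by simp
    ultimately show "p \<in> ?r ` ?A" using p by (auto intro!: image_eqI[of _ _ "cl ` extend J"])
  qed
qed

section \<open>The conifold algebra is an order\<close>

definition fr :: "4 mpoly \<Rightarrow> 4 mpoly fract" where
  "fr p = Fract p 1"

lemma fr_simps [simp]:
  "fr (p + q) = fr p + fr q" "fr (p * q) = fr p * fr q" "fr 0 = 0" "fr 1 = 1" "fr (- p) = - fr p"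
  by (simp_all add: fr_def Zero_fract_def One_fract_def)

lemma fr_eq_iff [simp]: "fr p = fr q \<longleftrightarrow> p = q"
  by (simp add: fr_def eq_fract)

lemma fr_eq_0_iff [simp]: "fr p = 0 \<longleftrightarrow> p = 0"
  using fr_eq_iff[of p 0] by simp

text \<open>The fraction field of \<open>S\<^sub>0\<close> is realized inside that of the polynomial
  ring, so the field laws are inherited and only closure has to be proved.\<close>

definition KF :: "4 mpoly fract set" where
  "KF = {fr p / fr s | p s. homog 0 p \<and> homog 0 s \<and> s \<noteq> 0}"

lemma KF_I: "homog 0 p \<Longrightarrow> homog 0 s \<Longrightarrow> s \<noteq> 0 \<Longrightarrow> fr p / fr s \<in> KF"
  unfolding KF_def by blast

lemma KF_cases:
  assumes "x \<in> KF" obtains p s where "homog 0 p" "homog 0 s" "s \<noteq> 0" "x = fr p / fr s"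
  using assms unfolding KF_def by blast

lemma KF_fr: "homog 0 p \<Longrightarrow> fr p \<in> KF"
  using KF_I[of p 1] by simp

lemma KF_closed [intro]:
  "0 \<in> KF" "1 \<in> KF" "x \<in> KF \<Longrightarrow> y \<in> KF \<Longrightarrow> x + y \<in> KF" "x \<in> KF \<Longrightarrow> y \<in> KF \<Longrightarrow> x * y \<in> KF"
  "x \<in> KF \<Longrightarrow> - x \<in> KF" "x \<in> KF \<Longrightarrow> inverse x \<in> KF"
proof -
  show "0 \<in> KF" "1 \<in> KF" using KF_fr[of 0] KF_fr[of 1] by simp_all
  {
    assume "x \<in> KF" "y \<in> KF"
    then obtain p s q t where x: "homog 0 p" "homog 0 s" "s \<noteq> 0" "x = fr p / fr s"
      and y: "homog 0 q" "homog 0 t" "t \<noteq> 0" "y = fr q / fr t" by (elim KF_cases)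
    have "x + y = fr (p * t + q * s) / fr (s * t)" using x y by (simp add: add_frac_eq)
    then show "x + y \<in> KF" by (rule ssubst) (intro KF_I homog_add homog_mult_0; use x y in simp)
    have "x * y = fr (p * q) / fr (s * t)" using x y by simp
    then show "x * y \<in> KF" by (rule ssubst) (intro KF_I homog_mult_0; use x y in simp)
  }
  {
    assume "x \<in> KF"
    then obtain p s where x: "homog 0 p" "homog 0 s" "s \<noteq> 0" "x = fr p / fr s" by (elim KF_cases)
    have "- x = fr (- p) / fr s" using x by simp
    then show "- x \<in> KF" by (rule ssubst) (intro KF_I; use x in simp)
    have "inverse x = fr s / fr p" using x by simp
    then show "inverse x \<in> KF" using KF_I[OF x(2,1)] \<open>0 \<in> KF\<close> by (cases "p = 0") simp_all
  }
qed

definition MK :: "(4 mpoly fract ^ 2 ^ 2) set" where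
  "MK = {N. \<forall>i j. N $ i $ j \<in> KF}"

lemma MK_M2 [simp]: "M2 a b c d \<in> MK \<longleftrightarrow> a \<in> KF \<and> b \<in> KF \<and> c \<in> KF \<and> d \<in> KF"
  by (simp add: MK_def forall_2)

lemma MK_closed [intro]:
  "N \<in> MK \<Longrightarrow> M \<in> MK \<Longrightarrow> N + M \<in> MK" "N \<in> MK \<Longrightarrow> M \<in> MK \<Longrightarrow> N ** M \<in> MK" "k \<in> KF \<Longrightarrow> mat k \<in> MK"
  "0 \<in> MK" "N \<in> MK \<Longrightarrow> - N \<in> MK"
proof -
  show "N \<in> MK \<Longrightarrow> M \<in> MK \<Longrightarrow> N + M \<in> MK" "N \<in> MK \<Longrightarrow> M \<in> MK \<Longrightarrow> N ** M \<in> MK"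
    by (cases N rule: M2_cases; cases M rule: M2_cases; simp; intro conjI KF_closed; blast)+
  show "k \<in> KF \<Longrightarrow> mat k \<in> MK" "0 \<in> MK" by (auto simp: mat_M2 zero_M2)
  show "N \<in> MK \<Longrightarrow> - N \<in> MK" by (cases N rule: M2_cases) auto
qed

text \<open>Conjugation by \<open>diag(1, x\<^sub>1)\<close> moves the graded matrices into the matrices over the
  fraction field of the centre.\<close>

definition loc_matrix :: "4 mpoly ^ 2 ^ 2 \<Rightarrow> 4 mpoly \<Rightarrow> 4 mpoly fract ^ 2 ^ 2" where
  "loc_matrix A s = M2 (fr (A $ 1 $ 1) / fr s) (fr (A $ 1 $ 2) / (fr s * fr vx1))
     (fr (A $ 2 $ 1) * fr vx1 / fr s) (fr (A $ 2 $ 2) / fr s)"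

lemma loc_matrix_M2 [simp]: "loc_matrix (M2 a b c d) s = M2 (fr a / fr s) (fr b / (fr s * fr vx1)) (fr c * fr vx1 / fr s) (fr d / fr s)"
  by (simp add: loc_matrix_def)

text \<open>Dividing a degree-one entry by \<open>x\<^sub>1\<close> gives a fraction of degree zero
  whose numerator and denominator have degree one; expanding it by \<open>x\<^sub>2\<close> puts it
  into the form that \<open>KF\<close> requires.\<close>

lemma loc_matrix_MK:
  assumes A: "graded A" and s: "homog 0 s" "s \<noteq> 0"
  shows "loc_matrix A s \<in> MK"
proof -
  obtain a b c d where M: "A = M2 a b c d" by (rule M2_cases)
  have "fr b / (fr s * fr vx1) = fr (b * vx2) / fr (s * (vx1 * vx2))" using s by simp
  moreover have "fr c * fr vx1 / fr s = fr (c * vx1) / fr s" by simp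
  moreover have "homog 0 (vx1 * vx2)" using homog_mult[of 1 vx1 "- 1" vx2] by simp
  moreover have "fr (b * vx2) / fr (s * (vx1 * vx2)) \<in> KF" "fr (c * vx1) / fr s \<in> KF"
  proof -
    have "homog 0 (b * vx2)" "homog 0 (c * vx1)"
      using A homog_mult[of 1 b "- 1" vx2] homog_mult[of "- 1" c 1 vx1] by (simp_all add: M)
    moreover have "homog 0 (s * (vx1 * vx2))" by (rule homog_mult_0[OF s(1)]) fact
    ultimately show "fr (b * vx2) / fr (s * (vx1 * vx2)) \<in> KF" "fr (c * vx1) / fr s \<in> KF"
      using s by (simp_all add: KF_I del: fr_simps)
  qed
  moreover have "fr a / fr s \<in> KF" "fr d / fr s \<in> KF" using A s by (intro KF_I; simp add: M)+
  ultimately show ?thesis unfolding M loc_matrix_M2 MK_M2 by (simp only:)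
qed

lemma loc_matrix_mult: "loc_matrix (A ** B) (s * t) = loc_matrix A s ** loc_matrix B t"
  by (cases A rule: M2_cases; cases B rule: M2_cases) (simp add: add_divide_distrib ring_distribs mult_ac)

lemma loc_matrix_add: "s \<noteq> 0 \<Longrightarrow> t \<noteq> 0 \<Longrightarrow> loc_matrix (A ** mat t + B ** mat s) (s * t) = loc_matrix A s + loc_matrix B t"
  by (cases A rule: M2_cases; cases B rule: M2_cases) (simp add: mat_M2 divide_simps algebra_simps)

lemma loc_matrix_eq_iff: "s \<noteq> 0 \<Longrightarrow> t \<noteq> 0 \<Longrightarrow> loc_matrix A s = loc_matrix B t \<longleftrightarrow> A ** mat t = B ** mat s"
  by (cases A rule: M2_cases; cases B rule: M2_cases)
    (simp add: mat_M2 frac_eq_eq mult_ac flip: fr_simps(2))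

lemma loc_matrix_mat: "loc_matrix (mat p) s = mat (fr p / fr s)"
  by (simp add: mat_M2)

lemma loc_matrix_surj:
  assumes "N \<in> MK"
  shows "\<exists>A s. graded A \<and> homog 0 s \<and> s \<noteq> 0 \<and> loc_matrix A s = N"
proof -
  obtain a b c d where N: "N = M2 a b c d" by (rule M2_cases)
  then have "a \<in> KF" "b \<in> KF" "c \<in> KF" "d \<in> KF" using assms by simp_all
  then obtain p1 s1 p2 s2 p3 s3 p4 s4 where
    a: "homog 0 p1" "homog 0 s1" "s1 \<noteq> 0" "a = fr p1 / fr s1" and
    b: "homog 0 p2" "homog 0 s2" "s2 \<noteq> 0" "b = fr p2 / fr s2" and
    c: "homog 0 p3" "homog 0 s3" "s3 \<noteq> 0" "c = fr p3 / fr s3" and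
    d: "homog 0 p4" "homog 0 s4" "s4 \<noteq> 0" "d = fr p4 / fr s4" by (elim KF_cases)
  \<comment> \<open>The common denominator carries the extra factor \<open>u\<close> so that the
    entry in place (2,1), once divided by \<open>x\<^sub>1\<close>, is still a polynomial of degree
    -1.\<close>
  define u where "u = vx1 * vx2"
  have u: "homog 0 u" "u \<noteq> 0" using homog_mult[of 1 vx1 "- 1" vx2] by (simp_all add: u_def)
  define A where "A = M2 (p1 * (s2 * (s3 * (s4 * u)))) (p2 * (s1 * (s3 * (s4 * u))) * vx1)
    (p3 * (s1 * (s2 * s4)) * vx2) (p4 * (s1 * (s2 * (s3 * u))))"
  define s where "s = s1 * (s2 * (s3 * (s4 * u)))"
  have "homog 0 s" "s \<noteq> 0" using a b c d u by (auto simp: s_def intro!: homog_mult_0)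
  moreover have "graded A" unfolding A_def graded_M2
    using a b c d u by (auto intro!: homog_mult_0 homog_mult'[of 0 _ 1 vx1] homog_mult'[of 0 _ "- 1" vx2])
  moreover have "loc_matrix A s = N" using a b c d u by (simp add: A_def N s_def u_def field_simps)
  ultimately show ?thesis by blast
qed

section \<open>The localization as a matrix algebra over the fraction field of the centre\<close>

definition loc_elem :: "4 mpoly fract ^ 2 ^ 2 \<Rightarrow> (conifold_gen falg set \<times> conifold_gen falg set) set" where
  "loc_elem N = {(cl B, sc t) | B t. graded B \<and> homog 0 t \<and> t \<noteq> 0 \<and> loc_matrix B t = N}"

abbreviation "loc \<equiv> central_localization \<Lambda>"

lemma sc_eq_0_iff: "homog 0 p \<Longrightarrow> sc p = \<zero>\<^bsub>\<Lambda>\<^esub> \<longleftrightarrow> p = 0"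
  by (simp add: sc_zero sc_eq_iff)

lemma centre_nonzero: "centre \<Lambda> - {\<zero>\<^bsub>\<Lambda>\<^esub>} = sc ` {s. homog 0 s \<and> s \<noteq> 0}"
  using sc_eq_0_iff by (auto simp: centre_eq_sc)

lemma cl_eq_0_iff: "graded A \<Longrightarrow> cl A = \<zero>\<^bsub>\<Lambda>\<^esub> \<longleftrightarrow> A = 0"
  by (simp add: cl_zero cl_eq_iff)

lemma mat_mult_cancel: "u \<noteq> 0 \<Longrightarrow> mat u ** A = mat u ** B \<longleftrightarrow> A = B" for u :: "'a::idom" and A :: "'a ^ 2 ^ 2"
  by (cases A rule: M2_cases; cases B rule: M2_cases) (simp add: mat_M2)

text \<open>The centre acts without torsion, so the auxiliary multiplier in the relation cancels and
  equivalent fractions are those with the same matrix.\<close>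

lemma central_fraction_rel_iff:
  assumes A: "graded A" and s: "homog 0 s" "s \<noteq> 0"
  shows "((cl A, sc s), y) \<in> central_fraction_rel \<Lambda> \<longleftrightarrow>
    (\<exists>B t. y = (cl B, sc t) \<and> graded B \<and> homog 0 t \<and> t \<noteq> 0 \<and> loc_matrix B t = loc_matrix A s)"
proof -
  have *: "(\<exists>u\<in>centre \<Lambda> - {\<zero>\<^bsub>\<Lambda>\<^esub>}. u \<otimes>\<^bsub>\<Lambda>\<^esub> (cl A \<otimes>\<^bsub>\<Lambda>\<^esub> sc t)
      = u \<otimes>\<^bsub>\<Lambda>\<^esub> (cl B \<otimes>\<^bsub>\<Lambda>\<^esub> sc s)) \<longleftrightarrow> loc_matrix B t = loc_matrix A s"
    if B: "graded B" and t: "homog 0 t" "t \<noteq> 0" for B t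
  proof -
    have "cl A \<otimes>\<^bsub>\<Lambda>\<^esub> sc t = cl (A ** mat t)" "cl B \<otimes>\<^bsub>\<Lambda>\<^esub> sc s = cl (B ** mat s)"
      using A B s t by (simp_all add: sc_def cl_ops graded_mat)
    moreover have "sc u \<otimes>\<^bsub>\<Lambda>\<^esub> cl (A ** mat t) = sc u \<otimes>\<^bsub>\<Lambda>\<^esub> cl (B ** mat s)
        \<longleftrightarrow> A ** mat t = B ** mat s" if "homog 0 u" "u \<noteq> 0" for u
      using A B s t that
      by (simp add: sc_mult_cl cl_eq_iff graded_mult graded_mat mat_mult_cancel)
    ultimately show ?thesis
      unfolding centre_nonzero loc_matrix_eq_iff[OF t(2) s(2)] by (auto intro!: exI[of _ 1])
  qed
  have "((cl A, sc s), y) \<in> central_fraction_rel \<Lambda> \<longleftrightarrow>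
    (\<exists>b t. y = (b, t) \<and> b \<in> carrier \<Lambda> \<and> t \<in> centre \<Lambda> - {\<zero>\<^bsub>\<Lambda>\<^esub>} \<and>
      (\<exists>u\<in>centre \<Lambda> - {\<zero>\<^bsub>\<Lambda>\<^esub>}. u \<otimes>\<^bsub>\<Lambda>\<^esub> (cl A \<otimes>\<^bsub>\<Lambda>\<^esub> t)
      = u \<otimes>\<^bsub>\<Lambda>\<^esub> (b \<otimes>\<^bsub>\<Lambda>\<^esub> sc s)))"
    using cl_carrier[OF A] sc_centre[OF s(1)] sc_eq_0_iff[OF s(1)] s(2)
    by (auto simp: central_fraction_rel_def)
  also have "\<dots> \<longleftrightarrow> (\<exists>B t. y = (cl B, sc t) \<and> graded B \<and> homog 0 t \<and> t \<noteq> 0 \<and>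
      (\<exists>u\<in>centre \<Lambda> - {\<zero>\<^bsub>\<Lambda>\<^esub>}. u \<otimes>\<^bsub>\<Lambda>\<^esub> (cl A \<otimes>\<^bsub>\<Lambda>\<^esub> sc t)
      = u \<otimes>\<^bsub>\<Lambda>\<^esub> (cl B \<otimes>\<^bsub>\<Lambda>\<^esub> sc s)))"
    unfolding carrier_conifold centre_nonzero by blast
  also have "\<dots> \<longleftrightarrow> (\<exists>B t. y = (cl B, sc t) \<and> graded B \<and> homog 0 t \<and> t \<noteq> 0 \<and> loc_matrix B t = loc_matrix A s)"
    using * by (intro ex_cong1 conj_cong refl)
  finally show ?thesis .
qed

lemma central_fraction_eq_loc_elem:
  assumes "graded A" "homog 0 s" "s \<noteq> 0"
  shows "central_fraction \<Lambda> (cl A) (sc s) = loc_elem (loc_matrix A s)"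
  unfolding central_fraction_def Image_singleton central_fraction_rel_iff[OF assms] loc_elem_def by simp

lemma loc_elem_nonempty: "N \<in> MK \<Longrightarrow> loc_elem N \<noteq> {}"
  using loc_matrix_surj[of N] unfolding loc_elem_def by blast

lemma loc_elem_eq_iff:
  assumes "N \<in> MK" "M \<in> MK"
  shows "loc_elem N = loc_elem M \<longleftrightarrow> N = M"
proof
  assume eq: "loc_elem N = loc_elem M"
  obtain A s where A: "graded A" "homog 0 s" "s \<noteq> 0" "loc_matrix A s = N" using loc_matrix_surj[OF assms(1)] by blast
  then have "(cl A, sc s) \<in> loc_elem N" unfolding loc_elem_def by blast
  then have "(cl A, sc s) \<in> loc_elem M" unfolding eq .
  then obtain B t where "cl A = cl B" "sc s = sc t" "graded B" "homog 0 t" "loc_matrix B t = M"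
    unfolding loc_elem_def by blast
  then show "N = M" using A by (simp add: cl_eq_iff sc_eq_iff)
qed simp

lemma carrier_loc: "carrier loc = loc_elem ` MK"
proof -
  have "carrier loc = (\<lambda>x. central_fraction_rel \<Lambda> `` {x}) `
      (carrier \<Lambda> \<times> (centre \<Lambda> - {\<zero>\<^bsub>\<Lambda>\<^esub>}))"
    by (auto simp: central_localization_def quotient_def)
  also have "\<dots> = {central_fraction \<Lambda> (cl A) (sc s) | A s. graded A \<and> homog 0 s \<and> s \<noteq> 0}"
    unfolding carrier_conifold centre_nonzero central_fraction_def by blast
  also have "\<dots> = {loc_elem (loc_matrix A s) | A s. graded A \<and> homog 0 s \<and> s \<noteq> 0}"
  proof (intro Collect_cong ex_cong1)
    fix x A s
    show "(x = central_fraction \<Lambda> (cl A) (sc s) \<and> graded A \<and> homog 0 s \<and> s \<noteq> 0)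
        \<longleftrightarrow> (x = loc_elem (loc_matrix A s) \<and> graded A \<and> homog 0 s \<and> s \<noteq> 0)"
      using central_fraction_eq_loc_elem[of A s] by (metis (no_types))
  qed
  also have "\<dots> = loc_elem ` MK"
  proof (intro equalityI subsetI)
    fix x assume "x \<in> {loc_elem (loc_matrix A s) | A s. graded A \<and> homog 0 s \<and> s \<noteq> 0}"
    then show "x \<in> loc_elem ` MK" using loc_matrix_MK by auto
  next
    fix x assume "x \<in> loc_elem ` MK"
    then obtain N where N: "N \<in> MK" "x = loc_elem N" by (rule imageE)
    obtain A s where "graded A" "homog 0 s" "s \<noteq> 0" "loc_matrix A s = N" using loc_matrix_surj[OF N(1)] by blast
    then show "x \<in> {loc_elem (loc_matrix A s) | A s. graded A \<and> homog 0 s \<and> s \<noteq> 0}" using N(2) by blast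
  qed
  finally show ?thesis .
qed

text \<open>The operations of the localization are unions over all pairs of representatives; they
  collapse once every pair gives the same class.\<close>

lemma Union_const: "p \<noteq> {} \<Longrightarrow> (\<And>a s. (a, s) \<in> p \<Longrightarrow> f a s = c) \<Longrightarrow> (\<Union>(a, s)\<in>p. f a s) = c"
  by fastforce

lemma loc_elem_ops:
  assumes N: "N \<in> MK" and M: "M \<in> MK"
  shows loc_elem_mult: "loc_elem N \<otimes>\<^bsub>loc\<^esub> loc_elem M = loc_elem (N ** M)"
    and loc_elem_add: "loc_elem N \<oplus>\<^bsub>loc\<^esub> loc_elem M = loc_elem (N + M)"
proof -
  have "(\<Union>(a, s)\<in>loc_elem N. \<Union>(b, t)\<in>loc_elem M. central_fraction \<Lambda> (a \<otimes>\<^bsub>\<Lambda>\<^esub> b)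
      (s \<otimes>\<^bsub>\<Lambda>\<^esub> t)) = loc_elem (N ** M)"
  proof (intro Union_const loc_elem_nonempty N M)
    fix a s b t assume "(a, s) \<in> loc_elem N" "(b, t) \<in> loc_elem M"
    then obtain A s' B t' where *: "a = cl A" "s = sc s'" "graded A" "homog 0 s'" "s' \<noteq> 0" "loc_matrix A s' = N"
      "b = cl B" "t = sc t'" "graded B" "homog 0 t'" "t' \<noteq> 0" "loc_matrix B t' = M" unfolding loc_elem_def by blast
    have "central_fraction \<Lambda> (cl (A ** B)) (sc (s' * t')) = loc_elem (loc_matrix (A ** B) (s' * t'))"
      by (rule central_fraction_eq_loc_elem) (use * in \<open>auto simp: graded_mult homog_mult_0\<close>)
    then show "central_fraction \<Lambda> (a \<otimes>\<^bsub>\<Lambda>\<^esub> b) (s \<otimes>\<^bsub>\<Lambda>\<^esub> t) = loc_elem (N ** M)"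
      using * by (simp add: cl_ops sc_ops loc_matrix_mult)
  qed
  then show "loc_elem N \<otimes>\<^bsub>loc\<^esub> loc_elem M = loc_elem (N ** M)" by (simp add: central_localization_def)
  have "(\<Union>(a, s)\<in>loc_elem N. \<Union>(b, t)\<in>loc_elem M. central_fraction \<Lambda>
      ((a \<otimes>\<^bsub>\<Lambda>\<^esub> t) \<oplus>\<^bsub>\<Lambda>\<^esub> (b \<otimes>\<^bsub>\<Lambda>\<^esub> s)) (s \<otimes>\<^bsub>\<Lambda>\<^esub> t)) = loc_elem (N + M)"
  proof (intro Union_const loc_elem_nonempty N M)
    fix a s b t assume "(a, s) \<in> loc_elem N" "(b, t) \<in> loc_elem M"
    then obtain A s' B t' where *: "a = cl A" "s = sc s'" "graded A" "homog 0 s'" "s' \<noteq> 0" "loc_matrix A s' = N"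
      "b = cl B" "t = sc t'" "graded B" "homog 0 t'" "t' \<noteq> 0" "loc_matrix B t' = M" unfolding loc_elem_def by blast
    have "central_fraction \<Lambda> (cl (A ** mat t' + B ** mat s')) (sc (s' * t'))
        = loc_elem (loc_matrix (A ** mat t' + B ** mat s') (s' * t'))"
      by (rule central_fraction_eq_loc_elem) (use * in \<open>auto simp: graded_mult homog_mult_0 graded_add graded_mat\<close>)
    moreover have "cl A \<otimes>\<^bsub>\<Lambda>\<^esub> sc t' = cl (A ** mat t')" "cl B \<otimes>\<^bsub>\<Lambda>\<^esub> sc s' = cl (B ** mat s')"
      using * by (simp_all add: sc_def cl_ops graded_mat)
    ultimately show "central_fraction \<Lambda>
      ((a \<otimes>\<^bsub>\<Lambda>\<^esub> t) \<oplus>\<^bsub>\<Lambda>\<^esub> (b \<otimes>\<^bsub>\<Lambda>\<^esub> s)) (s \<otimes>\<^bsub>\<Lambda>\<^esub> t) = loc_elem (N + M)"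
      using * by (simp add: cl_ops sc_ops graded_mult graded_mat loc_matrix_add)
  qed
  then show "loc_elem N \<oplus>\<^bsub>loc\<^esub> loc_elem M = loc_elem (N + M)" by (simp add: central_localization_def)
qed

lemma loc_elem_one: "\<one>\<^bsub>loc\<^esub> = loc_elem (mat 1)" and loc_elem_zero: "\<zero>\<^bsub>loc\<^esub> = loc_elem 0"
proof -
  have "\<one>\<^bsub>loc\<^esub> = central_fraction \<Lambda> (cl (mat 1)) (sc 1)"
    by (simp add: central_localization_def cl_one sc_def)
  also have "\<dots> = loc_elem (mat 1)" by (subst central_fraction_eq_loc_elem) (simp_all add: loc_matrix_mat)
  finally show "\<one>\<^bsub>loc\<^esub> = loc_elem (mat 1)" .
  have "\<zero>\<^bsub>loc\<^esub> = central_fraction \<Lambda> (cl 0) (sc 1)"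
    by (simp add: central_localization_def cl_zero sc_one)
  also have "\<dots> = loc_elem 0" by (subst central_fraction_eq_loc_elem) (simp_all add: zero_M2)
  finally show "\<zero>\<^bsub>loc\<^esub> = loc_elem 0" .
qed

lemma loc_elem_carrier: "N \<in> MK \<Longrightarrow> loc_elem N \<in> carrier loc"
  by (simp add: carrier_loc)

lemma loc_cases: assumes "x \<in> carrier loc" obtains N where "N \<in> MK" "x = loc_elem N"
  using assms by (auto simp: carrier_loc)

lemma ring_loc: "ring loc"
proof (rule ringI)
  show "abelian_group loc"
  proof (rule abelian_groupI)
    show "\<zero>\<^bsub>loc\<^esub> \<in> carrier loc" by (simp add: loc_elem_zero loc_elem_carrier MK_closed)
    fix x assume x: "x \<in> carrier loc"
    then obtain N where N: "N \<in> MK" "x = loc_elem N" by (rule loc_cases)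
    show "\<zero>\<^bsub>loc\<^esub> \<oplus>\<^bsub>loc\<^esub> x = x" using N by (simp add: loc_elem_zero loc_elem_add MK_closed)
    have "loc_elem (- N) \<oplus>\<^bsub>loc\<^esub> x = \<zero>\<^bsub>loc\<^esub>" using N by (simp add: loc_elem_zero loc_elem_add MK_closed)
    then show "\<exists>y\<in>carrier loc. y \<oplus>\<^bsub>loc\<^esub> x = \<zero>\<^bsub>loc\<^esub>" using N loc_elem_carrier[of "- N"] by (auto simp: MK_closed)
    fix y assume y: "y \<in> carrier loc"
    then obtain M where M: "M \<in> MK" "y = loc_elem M" by (rule loc_cases)
    show "x \<oplus>\<^bsub>loc\<^esub> y \<in> carrier loc" using N M by (simp add: loc_elem_add loc_elem_carrier MK_closed)
    show "x \<oplus>\<^bsub>loc\<^esub> y = y \<oplus>\<^bsub>loc\<^esub> x" using N M by (simp add: loc_elem_add add.commute)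
    fix z assume z: "z \<in> carrier loc"
    then obtain L where L: "L \<in> MK" "z = loc_elem L" by (rule loc_cases)
    show "x \<oplus>\<^bsub>loc\<^esub> y \<oplus>\<^bsub>loc\<^esub> z = x \<oplus>\<^bsub>loc\<^esub> (y \<oplus>\<^bsub>loc\<^esub> z)"
      using N M L by (simp add: loc_elem_add MK_closed add.assoc)
  qed
  show "monoid loc"
  proof (rule monoidI)
    show "\<one>\<^bsub>loc\<^esub> \<in> carrier loc" by (simp add: loc_elem_one loc_elem_carrier MK_closed KF_closed)
    fix x assume x: "x \<in> carrier loc"
    then obtain N where N: "N \<in> MK" "x = loc_elem N" by (rule loc_cases)
    show "\<one>\<^bsub>loc\<^esub> \<otimes>\<^bsub>loc\<^esub> x = x" "x \<otimes>\<^bsub>loc\<^esub> \<one>\<^bsub>loc\<^esub> = x"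
      using N by (simp_all add: loc_elem_one loc_elem_mult MK_closed KF_closed)
    fix y assume y: "y \<in> carrier loc"
    then obtain M where M: "M \<in> MK" "y = loc_elem M" by (rule loc_cases)
    show "x \<otimes>\<^bsub>loc\<^esub> y \<in> carrier loc" using N M by (simp add: loc_elem_mult loc_elem_carrier MK_closed)
    fix z assume z: "z \<in> carrier loc"
    then obtain L where L: "L \<in> MK" "z = loc_elem L" by (rule loc_cases)
    show "x \<otimes>\<^bsub>loc\<^esub> y \<otimes>\<^bsub>loc\<^esub> z = x \<otimes>\<^bsub>loc\<^esub> (y \<otimes>\<^bsub>loc\<^esub> z)"
      using N M L by (simp add: loc_elem_mult MK_closed matrix_mul_assoc)
  qed
  fix x y z assume "x \<in> carrier loc" "y \<in> carrier loc" "z \<in> carrier loc"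
  then obtain N M L where "N \<in> MK" "x = loc_elem N" "M \<in> MK" "y = loc_elem M" "L \<in> MK" "z = loc_elem L"
    by (elim loc_cases)
  then show "(x \<oplus>\<^bsub>loc\<^esub> y) \<otimes>\<^bsub>loc\<^esub> z = x \<otimes>\<^bsub>loc\<^esub> z \<oplus>\<^bsub>loc\<^esub> y \<otimes>\<^bsub>loc\<^esub> z"
    "z \<otimes>\<^bsub>loc\<^esub> (x \<oplus>\<^bsub>loc\<^esub> y) = z \<otimes>\<^bsub>loc\<^esub> x \<oplus>\<^bsub>loc\<^esub> z \<otimes>\<^bsub>loc\<^esub> y"
    by (simp_all add: loc_elem_ops MK_closed matrix_add_rdistrib matrix_add_ldistrib)
qed

interpretation loc: ring loc by (rule ring_loc)

definition Kloc :: "(conifold_gen falg set \<times> conifold_gen falg set) set set" where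
  "Kloc = (\<lambda>k. loc_elem (mat k)) ` KF"

lemma central_fraction_field_conifold: "central_fraction_field \<Lambda> = Kloc"
proof -
  have "central_fraction \<Lambda> (sc r) (sc s) = loc_elem (mat (fr r / fr s))"
    if "homog 0 r" "homog 0 s" "s \<noteq> 0" for r s
    using central_fraction_eq_loc_elem[OF graded_mat, of r s] that by (simp add: sc_def loc_matrix_mat)
  then have "central_fraction_field \<Lambda> = {loc_elem (mat (fr r / fr s)) | r s. homog 0 r \<and> homog 0 s \<and> s \<noteq> 0}"
    unfolding central_fraction_field_def centre_nonzero unfolding centre_eq_sc by blast
  then show ?thesis unfolding Kloc_def KF_def by blast
qed

lemma loc_elem_mat_eq_iff: "k \<in> KF \<Longrightarrow> l \<in> KF \<Longrightarrow> loc_elem (mat k) = loc_elem (mat l) \<longleftrightarrow> k = l"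
  by (simp add: loc_elem_eq_iff MK_closed) (simp add: mat_M2)

lemma loc_elem_mat_ops:
  assumes "k \<in> KF" "l \<in> KF"
  shows "loc_elem (mat k) \<otimes>\<^bsub>loc\<^esub> loc_elem (mat l) = loc_elem (mat (k * l))" "loc_elem (mat k) \<oplus>\<^bsub>loc\<^esub> loc_elem (mat l) = loc_elem (mat (k + l))"
  using assms by (simp_all add: loc_elem_ops MK_closed mat_mult_mat mat_add)

lemma Kloc_subset: "Kloc \<subseteq> carrier loc"
  by (auto simp: Kloc_def loc_elem_carrier MK_closed)

lemma subfield_Kloc: "subfield Kloc loc"
proof -
  have um: "\<ominus>\<^bsub>loc\<^esub> loc_elem (mat k) = loc_elem (mat (- k))" if "k \<in> KF" for k
    by (rule loc.minus_equality)
      (use that in \<open>simp_all add: loc_elem_mat_ops loc_elem_zero loc_elem_carrier MK_closed KF_closed\<close>)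
  have "subring Kloc loc"
  proof (rule loc.subringI)
    show "Kloc \<subseteq> carrier loc" by (rule Kloc_subset)
    show "\<one>\<^bsub>loc\<^esub> \<in> Kloc" by (auto simp: Kloc_def loc_elem_one)
    show "\<ominus>\<^bsub>loc\<^esub> h \<in> Kloc" if "h \<in> Kloc" for h using that by (auto simp: Kloc_def um)
    fix h1 h2 assume "h1 \<in> Kloc" "h2 \<in> Kloc"
    then obtain k l where "k \<in> KF" "h1 = loc_elem (mat k)" "l \<in> KF" "h2 = loc_elem (mat l)" by (auto simp: Kloc_def)
    then show "h1 \<otimes>\<^bsub>loc\<^esub> h2 \<in> Kloc" "h1 \<oplus>\<^bsub>loc\<^esub> h2 \<in> Kloc" by (auto simp: Kloc_def loc_elem_mat_ops)
  qed
  moreover have "h1 \<otimes>\<^bsub>loc\<^esub> h2 = h2 \<otimes>\<^bsub>loc\<^esub> h1" if h: "h1 \<in> Kloc" "h2 \<in> Kloc" for h1 h2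
  proof -
    obtain k l where "k \<in> KF" "h1 = loc_elem (mat k)" "l \<in> KF" "h2 = loc_elem (mat l)" using h by (auto simp: Kloc_def)
    then show ?thesis by (simp add: loc_elem_mat_ops mult.commute)
  qed
  ultimately have sc: "subcring Kloc loc" by (rule loc.subcringI)
  have "Units (loc\<lparr>carrier := Kloc\<rparr>) = Kloc - {\<zero>\<^bsub>loc\<^esub>}"
  proof (intro equalityI subsetI)
    fix x assume "x \<in> Units (loc\<lparr>carrier := Kloc\<rparr>)"
    then obtain y where xy: "x \<in> Kloc" "y \<in> Kloc" "x \<otimes>\<^bsub>loc\<^esub> y = \<one>\<^bsub>loc\<^esub>" by (auto simp: Units_def)
    then obtain k l where kl: "k \<in> KF" "x = loc_elem (mat k)" "l \<in> KF" "y = loc_elem (mat l)" by (auto simp: Kloc_def)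
    then have "k * l = 1" using xy(3) by (simp add: loc_elem_mat_ops loc_elem_one loc_elem_mat_eq_iff KF_closed)
    then have "loc_elem (mat k) \<noteq> loc_elem (mat 0)" using kl by (subst loc_elem_mat_eq_iff) (auto simp: KF_closed)
    then show "x \<in> Kloc - {\<zero>\<^bsub>loc\<^esub>}" using xy kl by (simp add: loc_elem_zero)
  next
    fix x assume x: "x \<in> Kloc - {\<zero>\<^bsub>loc\<^esub>}"
    then obtain k where k: "k \<in> KF" "x = loc_elem (mat k)" by (auto simp: Kloc_def)
    have "k \<noteq> 0" using x k by (auto simp: loc_elem_zero)
    then have "loc_elem (mat (inverse k)) \<otimes>\<^bsub>loc\<^esub> x = \<one>\<^bsub>loc\<^esub>" "x \<otimes>\<^bsub>loc\<^esub> loc_elem (mat (inverse k)) = \<one>\<^bsub>loc\<^esub>"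
      using k by (simp_all add: loc_elem_mat_ops KF_closed loc_elem_one)
    moreover have "loc_elem (mat (inverse k)) \<in> Kloc" using k by (auto simp: Kloc_def)
    ultimately show "x \<in> Units (loc\<lparr>carrier := Kloc\<rparr>)" using x by (auto simp: Units_def)
  qed
  with sc show ?thesis by (rule loc.subfieldI)
qed

lemma centre_loc: "centre loc = Kloc"
proof (intro equalityI subsetI)
  fix z assume z: "z \<in> centre loc"
  then obtain N where N: "N \<in> MK" "z = loc_elem N" by (auto simp: centre_def carrier_loc)
  have comm: "N ** M = M ** N" if "M \<in> MK" for M
  proof -
    have "loc_elem N \<otimes>\<^bsub>loc\<^esub> loc_elem M = loc_elem M \<otimes>\<^bsub>loc\<^esub> loc_elem N" using z N loc_elem_carrier[OF that] unfolding centre_def by blast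
    then show ?thesis using N that by (simp add: loc_elem_mult loc_elem_eq_iff MK_closed)
  qed
  obtain a b c d where M: "N = M2 a b c d" by (rule M2_cases)
  have "b = 0" "c = 0" using comm[of "M2 1 0 0 0"] by (simp_all add: M KF_closed)
  moreover have "a = d" using comm[of "M2 0 1 0 0"] by (simp add: M KF_closed)
  ultimately have "N = mat a" "a \<in> KF" using N by (simp_all add: M mat_M2)
  then show "z \<in> Kloc" using N by (auto simp: Kloc_def)
next
  fix z assume "z \<in> Kloc"
  then obtain k where k: "k \<in> KF" "z = loc_elem (mat k)" by (auto simp: Kloc_def)
  show "z \<in> centre loc" unfolding centre_def
  proof (intro CollectI conjI ballI)
    show "z \<in> carrier loc" using k by (simp add: loc_elem_carrier MK_closed)
    fix x assume "x \<in> carrier loc"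
    then obtain N where "N \<in> MK" "x = loc_elem N" by (rule loc_cases)
    then show "z \<otimes>\<^bsub>loc\<^esub> x = x \<otimes>\<^bsub>loc\<^esub> z" using k by (simp add: loc_elem_mult MK_closed mat_mult_commute)
  qed
qed

text \<open>Matrix units and an inverse move any nonzero entry to the first corner as 1, and from
  there to the second, so a nonzero ideal contains the identity.\<close>

lemma loc_simple:
  assumes I: "ideal I loc"
  shows "I = {\<zero>\<^bsub>loc\<^esub>} \<or> I = carrier loc"
proof (rule disjCI)
  interpret I: ideal I loc by (rule I)
  assume "I \<noteq> carrier loc"
  show "I = {\<zero>\<^bsub>loc\<^esub>}"
  proof (rule ccontr)
    assume "I \<noteq> {\<zero>\<^bsub>loc\<^esub>}"
    moreover have z: "\<zero>\<^bsub>loc\<^esub> \<in> I" by (rule additive_subgroup.zero_closed[OF I.additive_subgroup_axioms])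
    ultimately obtain x where x: "x \<in> I" "x \<noteq> \<zero>\<^bsub>loc\<^esub>" by blast
    then have "x \<in> carrier loc" using I.a_subset by blast
    then obtain N where N: "N \<in> MK" "x = loc_elem N" by (rule loc_cases)
    have "N \<noteq> 0" using x N by (auto simp: loc_elem_zero)
    have mem: "loc_elem (G ** M ** H) \<in> I" if "loc_elem M \<in> I" "M \<in> MK" "G \<in> MK" "H \<in> MK" for G M H
      using I.I_r_closed[OF I.I_l_closed[OF that(1) loc_elem_carrier[OF that(3)]] loc_elem_carrier[OF that(4)]] that
      by (simp add: loc_elem_mult MK_closed)
    obtain a b c d where M: "N = M2 a b c d" by (rule M2_cases)
    have K: "a \<in> KF" "b \<in> KF" "c \<in> KF" "d \<in> KF" using N by (simp_all add: M)
    have "loc_elem (M2 1 0 0 0) \<in> I"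
    proof -
      consider "a \<noteq> 0" | "b \<noteq> 0" | "c \<noteq> 0" | "d \<noteq> 0" using \<open>N \<noteq> 0\<close> by (auto simp: M zero_M2)
      then show ?thesis
      proof cases
        case 1
        then show ?thesis using mem[of N "M2 (inverse a) 0 0 0" "M2 1 0 0 0"] x N K by (simp add: M KF_closed)
      next
        case 2
        then show ?thesis using mem[of N "M2 (inverse b) 0 0 0" "M2 0 0 1 0"] x N K by (simp add: M KF_closed)
      next
        case 3
        then show ?thesis using mem[of N "M2 0 (inverse c) 0 0" "M2 1 0 0 0"] x N K by (simp add: M KF_closed)
      next
        case 4
        then show ?thesis using mem[of N "M2 0 (inverse d) 0 0" "M2 0 0 1 0"] x N K by (simp add: M KF_closed)
      qed
    qed
    moreover from this have "loc_elem (M2 0 0 0 1) \<in> I"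
      using mem[of "M2 1 0 0 0" "M2 0 0 1 0" "M2 0 1 0 0"] by (simp add: KF_closed)
    ultimately have "loc_elem (M2 1 0 0 0) \<oplus>\<^bsub>loc\<^esub> loc_elem (M2 0 0 0 1) \<in> I"
      by (rule additive_subgroup.a_closed[OF I.additive_subgroup_axioms])
    then have "\<one>\<^bsub>loc\<^esub> \<in> I" by (simp add: loc_elem_add loc_elem_one mat_M2 KF_closed)
    then show False using I.one_imp_carrier \<open>I \<noteq> carrier loc\<close> by blast
  qed
qed

section \<open>Dimension four, and finite generation over the centre\<close>

lemma loc_line_extension:
  assumes N: "N \<in> MK" and E: "E \<subseteq> MK"
  shows "loc.line_extension Kloc (loc_elem N) (loc_elem ` E) = loc_elem ` {mat k ** N + M | k M. k \<in> KF \<and> M \<in> E}"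
proof -
  have *: "loc_elem (mat k) \<otimes>\<^bsub>loc\<^esub> loc_elem N \<oplus>\<^bsub>loc\<^esub> loc_elem M = loc_elem (mat k ** N + M)" if "k \<in> KF" "M \<in> E" for k M
    using that N E by (simp add: loc_elem_ops MK_closed subset_iff)
  show ?thesis
  proof (intro equalityI subsetI)
    fix x assume "x \<in> loc.line_extension Kloc (loc_elem N) (loc_elem ` E)"
    then obtain k M where "k \<in> KF" "M \<in> E" "x = loc_elem (mat k) \<otimes>\<^bsub>loc\<^esub> loc_elem N \<oplus>\<^bsub>loc\<^esub> loc_elem M"
      unfolding loc.line_extension_mem_iff Kloc_def by blast
    then show "x \<in> loc_elem ` {mat k ** N + M | k M. k \<in> KF \<and> M \<in> E}" using * by auto
  next
    fix x assume "x \<in> loc_elem ` {mat k ** N + M | k M. k \<in> KF \<and> M \<in> E}"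
    then obtain k M where km: "k \<in> KF" "M \<in> E" "x = loc_elem (mat k ** N + M)" by blast
    then have "x = loc_elem (mat k) \<otimes>\<^bsub>loc\<^esub> loc_elem N \<oplus>\<^bsub>loc\<^esub> loc_elem M" using * by simp
    then show "x \<in> loc.line_extension Kloc (loc_elem N) (loc_elem ` E)"
      unfolding loc.line_extension_mem_iff Kloc_def using km(1,2) by blast
  qed
qed

text \<open>The subspaces \<open>E1\<close>, \<open>E2\<close>, \<open>E3\<close> fill the matrix
  one entry at a time, each by a matrix unit outside the previous subspace; \<open>dimension\<close>
  is built from exactly such line extensions.\<close>

lemma loc_dimension: "loc.dimension 4 Kloc (carrier loc)"
proof -
  define E1 where "E1 = {M2 a 0 0 0 | a. a \<in> KF}"
  define E2 where "E2 = {M2 a b 0 0 | a b. a \<in> KF \<and> b \<in> KF}"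
  define E3 where "E3 = {M2 a b c 0 | a b c. a \<in> KF \<and> b \<in> KF \<and> c \<in> KF}"
  have sub: "E1 \<subseteq> MK" "E2 \<subseteq> MK" "E3 \<subseteq> MK" "{0} \<subseteq> MK" 
    by (auto simp: E1_def E2_def E3_def MK_closed KF_closed)
  have notin: "loc_elem N \<notin> loc_elem ` E" if "N \<in> MK" "E \<subseteq> MK" "N \<notin> E" for N E
    using that loc_elem_eq_iff by (auto simp: subset_iff)
  have "{mat k ** M2 1 0 0 0 + M | k M. k \<in> KF \<and> M \<in> {0}} = E1"
    by (auto simp: E1_def mat_M2)
  then have "loc.line_extension Kloc (loc_elem (M2 1 0 0 0)) (loc_elem ` {0}) = loc_elem ` E1"
    using loc_line_extension[of "M2 1 0 0 0" "{0}"] sub by (simp add: KF_closed)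
  moreover have "loc.dimension 0 Kloc (loc_elem ` {0})"
    using loc.zero_dim[of Kloc] by (simp add: loc_elem_zero)
  moreover have "M2 1 0 0 0 \<notin> {0 :: 4 mpoly fract ^ 2 ^ 2}" by (simp add: zero_M2)
  ultimately have 1: "loc.dimension (Suc 0) Kloc (loc_elem ` E1)"
    using loc.Suc_dim[of "loc_elem (M2 1 0 0 0)" "loc_elem ` {0}" 0 Kloc] notin[of "M2 1 0 0 0" "{0}"] sub
    by (simp add: loc_elem_carrier KF_closed)
  have "{mat k ** M2 0 1 0 0 + M | k M. k \<in> KF \<and> M \<in> E1} = E2"
    by (force simp: E1_def E2_def mat_M2)
  then have "loc.line_extension Kloc (loc_elem (M2 0 1 0 0)) (loc_elem ` E1) = loc_elem ` E2"
    using loc_line_extension[of "M2 0 1 0 0" E1] sub by (simp add: KF_closed)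
  moreover have "M2 0 1 0 0 \<notin> E1" by (auto simp: E1_def)
  ultimately have 2: "loc.dimension (Suc (Suc 0)) Kloc (loc_elem ` E2)"
    using loc.Suc_dim[OF _ _ 1, of "loc_elem (M2 0 1 0 0)"] notin[of "M2 0 1 0 0" E1] sub
    by (simp add: loc_elem_carrier KF_closed)
  have "{mat k ** M2 0 0 1 0 + M | k M. k \<in> KF \<and> M \<in> E2} = E3"
    by (force simp: E2_def E3_def mat_M2)
  then have "loc.line_extension Kloc (loc_elem (M2 0 0 1 0)) (loc_elem ` E2) = loc_elem ` E3"
    using loc_line_extension[of "M2 0 0 1 0" E2] sub by (simp add: KF_closed)
  moreover have "M2 0 0 1 0 \<notin> E2" by (auto simp: E2_def)
  ultimately have 3: "loc.dimension (Suc (Suc (Suc 0))) Kloc (loc_elem ` E3)"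
    using loc.Suc_dim[OF _ _ 2, of "loc_elem (M2 0 0 1 0)"] notin[of "M2 0 0 1 0" E2] sub
    by (simp add: loc_elem_carrier KF_closed)
  have "{mat k ** M2 0 0 0 1 + M | k M. k \<in> KF \<and> M \<in> E3} = MK"
  proof (intro equalityI subsetI)
    fix N assume N: "N \<in> MK"
    obtain a b c d where "N = M2 a b c d" by (rule M2_cases)
    then show "N \<in> {mat k ** M2 0 0 0 1 + M | k M. k \<in> KF \<and> M \<in> E3}"
      using N by (intro CollectI exI[of _ d] exI[of _ "M2 a b c 0"]) (auto simp: E3_def mat_M2)
  qed (auto simp: E3_def mat_M2)
  then have "loc.line_extension Kloc (loc_elem (M2 0 0 0 1)) (loc_elem ` E3) = carrier loc"
    using loc_line_extension[of "M2 0 0 0 1" E3] sub by (simp add: KF_closed carrier_loc)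
  moreover have "M2 0 0 0 1 \<notin> E3" by (auto simp: E3_def)
  ultimately have 4: "loc.dimension (Suc (Suc (Suc (Suc 0)))) Kloc (carrier loc)"
    using loc.Suc_dim[OF _ _ 3, of "loc_elem (M2 0 0 0 1)"] notin[of "M2 0 0 0 1" E3] sub
    by (simp add: loc_elem_carrier KF_closed)
  then show ?thesis by (simp add: eval_nat_numeral)
qed

lemma central_simple_loc: "central_simple_algebra loc Kloc 4"
  unfolding central_simple_algebra_def
  using ring_loc subfield_Kloc centre_loc loc_simple loc_dimension by blast

lemma mvar_inj: "mvar i = mvar j \<longleftrightarrow> i = j"
proof
  assume "mvar i = mvar j"
  then have "Poly_Mapping.lookup (mvar i) (Poly_Mapping.single i 1) = Poly_Mapping.lookup (mvar j) (Poly_Mapping.single i 1)"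
    by simp
  then have "Poly_Mapping.single j 1 = Poly_Mapping.single i (1::nat)"
    by (simp add: mvar_def lookup_single when_def split: if_splits)
  then have "Poly_Mapping.lookup (Poly_Mapping.single j 1) i = Poly_Mapping.lookup (Poly_Mapping.single i (1::nat)) i"
    by simp
  then show "i = j" by (simp add: lookup_single when_def split: if_splits)
qed simp

text \<open>Each monomial of degree \<open>d\<close> contains one of the two variables, and since
  these have degree \<open>d\<close> themselves the cofactor is of degree zero.\<close>

lemma homog_two_generated:
  assumes p: "homog d p" and g: "homog d (mvar i)" "homog d (mvar j)"
    and ij: "\<And>m. xdeg m = d \<Longrightarrow> Poly_Mapping.lookup m i \<noteq> 0 \<or> Poly_Mapping.lookup m j \<noteq> 0"
  shows "\<exists>q r. homog 0 q \<and> homog 0 r \<and> p = q * mvar i + r * mvar j"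
proof -
  have factor: "\<exists>q. homog 0 q \<and> Poly_Mapping.single m c = q * mvar l"
    if m: "xdeg m = d" "Poly_Mapping.lookup m l \<noteq> 0" and l: "homog d (mvar l)" for m l c
  proof -
    define m' where "m' = m - Poly_Mapping.single l 1"
    have eq: "m = m' + Poly_Mapping.single l 1"
      unfolding m'_def using m(2)
      by (intro poly_mapping_eqI) (auto simp: lookup_add lookup_minus lookup_single when_def)
    then have "xdeg m = xdeg m' + xdeg (Poly_Mapping.single l 1)" by simp
    moreover have "xdeg (Poly_Mapping.single l 1) = d" using l by (simp add: mvar_def homog_single)
    ultimately have "homog 0 (Poly_Mapping.single m' c)" using m(1) by (simp add: homog_single)
    moreover have "Poly_Mapping.single m c = Poly_Mapping.single m' c * mvar l"
      by (simp add: eq mvar_def mult_single)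
    ultimately show ?thesis by blast
  qed
  show ?thesis
    using p
  proof (induction rule: homog_induct)
    case zero
    show ?case by (intro exI[of _ 0]) simp
  next
    case (single m c)
    from ij[OF this] show ?case
    proof
      assume "Poly_Mapping.lookup m i \<noteq> 0"
      then obtain q where "homog 0 q" "Poly_Mapping.single m c = q * mvar i" using factor[OF single _ g(1)] by blast
      then show ?case by (intro exI[of _ q] exI[of _ 0]) simp
    next
      assume "Poly_Mapping.lookup m j \<noteq> 0"
      then obtain q where "homog 0 q" "Poly_Mapping.single m c = q * mvar j" using factor[OF single _ g(2)] by blast
      then show ?case by (intro exI[of _ 0] exI[of _ q]) simp
    qed
  next
    case (add p p')
    then obtain q r q' r' where "homog 0 q" "homog 0 r" "p = q * mvar i + r * mvar j"
      "homog 0 q'" "homog 0 r'" "p' = q' * mvar i + r' * mvar j" by blast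
    then show ?case by (intro exI[of _ "q + q'"] exI[of _ "r + r'"]) (simp add: homog_add algebra_simps)
  qed
qed

lemma homog_generated:
  "homog 1 p \<Longrightarrow> \<exists>q r. homog 0 q \<and> homog 0 r \<and> p = q * vx1 + r * vy1"
  "homog (- 1) p \<Longrightarrow> \<exists>q r. homog 0 q \<and> homog 0 r \<and> p = q * vx2 + r * vy2"
proof -
  show "homog 1 p \<Longrightarrow> \<exists>q r. homog 0 q \<and> homog 0 r \<and> p = q * vx1 + r * vy1"
    by (rule homog_two_generated) (auto simp: xdeg_def)
  show "homog (- 1) p \<Longrightarrow> \<exists>q r. homog 0 q \<and> homog 0 r \<and> p = q * vx2 + r * vy2"
    by (rule homog_two_generated) (auto simp: xdeg_def)
qed

text \<open>The two vertex idempotents and the four arrows generate: entries of degree 1 and -1 are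
  combinations of arrows with degree-zero coefficients.\<close>

lemma conifold_finitely_generated:
  "\<exists>G. finite G \<and> G \<subseteq> carrier \<Lambda> \<and>
     (\<forall>a\<in>carrier \<Lambda>. \<exists>c\<in>G \<rightarrow> centre \<Lambda>.
        a = (\<Oplus>\<^bsub>\<Lambda>\<^esub>g\<in>G. c g \<otimes>\<^bsub>\<Lambda>\<^esub> g))"
proof -
  define g1 where "g1 = cl (M2 1 0 0 0)"
  define g2 where "g2 = cl (M2 0 0 0 1)"
  define g3 where "g3 = cl (M2 0 vx1 0 0)"
  define g4 where "g4 = cl (M2 0 vy1 0 0)"
  define g5 where "g5 = cl (M2 0 0 vx2 0)"
  define g6 where "g6 = cl (M2 0 0 vy2 0)"
  note g_def = g1_def g2_def g3_def g4_def g5_def g6_def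
  have carr: "g1 \<in> carrier \<Lambda>" "g2 \<in> carrier \<Lambda>" "g3 \<in> carrier \<Lambda>"
    "g4 \<in> carrier \<Lambda>" "g5 \<in> carrier \<Lambda>" "g6 \<in> carrier \<Lambda>"
    by (simp_all add: g_def cl_carrier)
  have dist: "distinct [g1, g2, g3, g4, g5, g6]"
    by (simp add: g_def cl_eq_iff mvar_inj)
  show ?thesis
  proof (intro exI[of _ "{g1, g2, g3, g4, g5, g6}"] conjI ballI)
    show "{g1, g2, g3, g4, g5, g6} \<subseteq> carrier \<Lambda>" using carr by simp
    fix a assume "a \<in> carrier \<Lambda>"
    then obtain A where A: "graded A" "a = cl A" by (rule cl_cases)
    obtain p b c q where M: "A = M2 p b c q" by (rule M2_cases)
    have h: "homog 0 p" "homog 1 b" "homog (- 1) c" "homog 0 q" using A(1) by (simp_all add: M)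
    obtain b1 b2 where b: "homog 0 b1" "homog 0 b2" "b = b1 * vx1 + b2 * vy1" using homog_generated(1)[OF h(2)] by blast
    obtain c1 c2 where c: "homog 0 c1" "homog 0 c2" "c = c1 * vx2 + c2 * vy2" using homog_generated(2)[OF h(3)] by blast
    \<comment> \<open>The coefficients are selected by comparing generators, so evaluating
      \<open>k\<close> rests on the six classes being distinct.\<close>
    define k where "k g = (if g1 = g then sc p else if g2 = g then sc q else if g3 = g then sc b1
      else if g4 = g then sc b2 else if g5 = g then sc c1 else sc c2)" for g
    have k: "k g1 = sc p" "k g2 = sc q" "k g3 = sc b1" "k g4 = sc b2" "k g5 = sc c1" "k g6 = sc c2"
      using dist by (simp_all add: k_def)
    have kc: "k g \<in> centre \<Lambda>" for g using h b c by (simp add: k_def sc_centre)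
    have kg: "k g \<otimes>\<^bsub>\<Lambda>\<^esub> g \<in> carrier \<Lambda>" if "g \<in> carrier \<Lambda>" for g
      by (rule con.m_closed[OF subsetD[OF centre_subset kc] that])
    have prods: "k g1 \<otimes>\<^bsub>\<Lambda>\<^esub> g1 = cl (M2 p 0 0 0)" "k g2 \<otimes>\<^bsub>\<Lambda>\<^esub> g2 = cl (M2 0 0 0 q)"
      "k g3 \<otimes>\<^bsub>\<Lambda>\<^esub> g3 = cl (M2 0 (b1 * vx1) 0 0)" "k g4 \<otimes>\<^bsub>\<Lambda>\<^esub> g4 = cl (M2 0 (b2 * vy1) 0 0)"
      "k g5 \<otimes>\<^bsub>\<Lambda>\<^esub> g5 = cl (M2 0 0 (c1 * vx2) 0)" "k g6 \<otimes>\<^bsub>\<Lambda>\<^esub> g6 = cl (M2 0 0 (c2 * vy2) 0)"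
      unfolding k using h b c by (simp_all add: g_def sc_mult_cl) (simp_all add: mat_M2)
    have hb: "homog 1 (b1 * vx1)" "homog 1 (b2 * vy1)" "homog (- 1) (c1 * vx2)" "homog (- 1) (c2 * vy2)"
      using homog_mult[of 0 b1 1 vx1] homog_mult[of 0 b2 1 vy1] homog_mult[of 0 c1 "- 1" vx2]
        homog_mult[of 0 c2 "- 1" vy2] b c by simp_all
    have "(\<Oplus>\<^bsub>\<Lambda>\<^esub>g\<in>{g1, g2, g3, g4, g5, g6}. k g \<otimes>\<^bsub>\<Lambda>\<^esub> g)
      = k g1 \<otimes>\<^bsub>\<Lambda>\<^esub> g1 \<oplus>\<^bsub>\<Lambda>\<^esub> (k g2 \<otimes>\<^bsub>\<Lambda>\<^esub> g2 \<oplus>\<^bsub>\<Lambda>\<^esub>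
       (k g3 \<otimes>\<^bsub>\<Lambda>\<^esub> g3 \<oplus>\<^bsub>\<Lambda>\<^esub> (k g4 \<otimes>\<^bsub>\<Lambda>\<^esub> g4 \<oplus>\<^bsub>\<Lambda>\<^esub>
       (k g5 \<otimes>\<^bsub>\<Lambda>\<^esub> g5 \<oplus>\<^bsub>\<Lambda>\<^esub> k g6 \<otimes>\<^bsub>\<Lambda>\<^esub> g6))))"
      using dist kg carr by (simp add: con.finsum_insert Pi_iff)
    also have "\<dots> = a"
      unfolding prods A(2) M using h hb by (simp add: cl_ops homog_add b(3) c(3))
    finally show "\<exists>c\<in>{g1, g2, g3, g4, g5, g6} \<rightarrow> centre \<Lambda>.
        a = (\<Oplus>\<^bsub>\<Lambda>\<^esub>g\<in>{g1, g2, g3, g4, g5, g6}. c g \<otimes>\<^bsub>\<Lambda>\<^esub> g)"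
      using kc by (intro bexI[of _ k]) auto
  qed simp
qed

theorem is_order_conifold: "is_order \<Lambda> 2"
  unfolding is_order_def
proof (intro conjI ballI impI)
  show "ring \<Lambda>" by (rule ring_conifold)
  show "domain (centre_ring \<Lambda>)" by (rule domain_centre)
  show "a = \<zero>\<^bsub>\<Lambda>\<^esub>"
    if s: "s \<in> centre \<Lambda> - {\<zero>\<^bsub>\<Lambda>\<^esub>}" and a: "a \<in> carrier \<Lambda>"
      and sa: "s \<otimes>\<^bsub>\<Lambda>\<^esub> a = \<zero>\<^bsub>\<Lambda>\<^esub>" for s a
  proof -
    obtain p where p: "homog 0 p" "p \<noteq> 0" "s = sc p" using s unfolding centre_nonzero by blast
    obtain A where A: "graded A" "a = cl A" using a by (rule cl_cases)
    have "mat p ** A = mat p ** 0" using sa p A by (simp add: sc_mult_cl cl_eq_0_iff graded_mult graded_mat)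
    then have "A = 0" using mat_mult_cancel[OF p(2), of A 0] by blast
    then show ?thesis by (simp add: A cl_zero)
  qed
  show "\<exists>G. finite G \<and> G \<subseteq> carrier \<Lambda> \<and>
     (\<forall>a\<in>carrier \<Lambda>. \<exists>c\<in>G \<rightarrow> centre \<Lambda>.
        a = (\<Oplus>\<^bsub>\<Lambda>\<^esub>g\<in>G. c g \<otimes>\<^bsub>\<Lambda>\<^esub> g))"
    by (rule conifold_finitely_generated)
  show "central_simple_algebra loc (central_fraction_field \<Lambda>) (2\<^sup>2)"
    using central_simple_loc by (simp add: central_fraction_field_conifold)
qed

section \<open>The reduced trace\<close>

lemma (in abelian_monoid) finsum_UNIV_2:
  assumes "f (1::2) \<in> carrier G" "f 2 \<in> carrier G"
  shows "finsum G f UNIV = f 1 \<oplus>\<^bsub>G\<^esub> f 2"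
  using assms by (simp add: UNIV_2 finsum_insert)

text \<open>An arbitrary splitting with its own field \<open>L\<close>: the description of the
  reduced trace admits all of them, so uniqueness has to be proved for each.\<close>

locale loc_splitting = L: field L for L :: "('l, 'k) ring_scheme" (structure) +
  fixes \<rho> :: "(conifold_gen falg set \<times> conifold_gen falg set) set \<Rightarrow> 2 \<Rightarrow> 2 \<Rightarrow> 'l"
  assumes splitting: "splitting loc Kloc L \<rho>"
begin

lemma closed [simp]: "N \<in> MK \<Longrightarrow> \<rho> (loc_elem N) i j \<in> carrier L"
  using splitting loc_elem_carrier unfolding splitting_def by blast

lemma add:
  assumes "N \<in> MK" "M \<in> MK"
  shows "\<rho> (loc_elem (N + M)) i j = \<rho> (loc_elem N) i j \<oplus> \<rho> (loc_elem M) i j"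
proof -
  have "\<rho> (loc_elem N \<oplus>\<^bsub>loc\<^esub> loc_elem M) i j = \<rho> (loc_elem N) i j \<oplus> \<rho> (loc_elem M) i j"
    using splitting loc_elem_carrier[OF assms(1)] loc_elem_carrier[OF assms(2)] unfolding splitting_def by blast
  then show ?thesis using assms by (simp add: loc_elem_add)
qed

lemma mult:
  assumes "N \<in> MK" "M \<in> MK"
  shows "\<rho> (loc_elem (N ** M)) i j = \<rho> (loc_elem N) i 1 \<otimes> \<rho> (loc_elem M) 1 j \<oplus> \<rho> (loc_elem N) i 2 \<otimes> \<rho> (loc_elem M) 2 j"
proof -
  have "\<rho> (loc_elem N \<otimes>\<^bsub>loc\<^esub> loc_elem M) i j = (\<Oplus>k\<in>UNIV. \<rho> (loc_elem N) i k \<otimes> \<rho> (loc_elem M) k j)"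
    using splitting loc_elem_carrier[OF assms(1)] loc_elem_carrier[OF assms(2)] unfolding splitting_def by blast
  then show ?thesis using assms by (simp add: loc_elem_mult L.finsum_UNIV_2)
qed

lemma one: "\<rho> (loc_elem (mat 1)) i j = (if i = j then \<one> else \<zero>)"
  using splitting unfolding splitting_def loc_elem_one by blast

definition s where "s k = \<rho> (loc_elem (mat k)) 1 1"

lemma scalar: "k \<in> KF \<Longrightarrow> \<rho> (loc_elem (mat k)) i j = (if i = j then s k else \<zero>)"
proof -
  assume "k \<in> KF"
  then have k: "loc_elem (mat k) \<in> Kloc" unfolding Kloc_def by (rule imageI)
  have "\<forall>x\<in>Kloc. \<exists>c\<in>carrier L. \<forall>i j. \<rho> x i j = (if i = j then c else \<zero>)"
    using splitting unfolding splitting_def by (elim conjE)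
  from this[rule_format, OF k] obtain c where "\<And>i j. \<rho> (loc_elem (mat k)) i j = (if i = j then c else \<zero>)"
    by blast
  then show ?thesis by (simp add: s_def)
qed

lemma s_closed [simp]: "k \<in> KF \<Longrightarrow> s k \<in> carrier L"
  by (simp add: s_def MK_closed)

lemma s_add: "k \<in> KF \<Longrightarrow> l \<in> KF \<Longrightarrow> s (k + l) = s k \<oplus> s l"
  unfolding s_def mat_add by (rule add) (simp_all add: MK_closed)

lemma s_1: "s 1 = \<one>"
  by (simp add: s_def one)

lemma scalar_mult: "k \<in> KF \<Longrightarrow> N \<in> MK \<Longrightarrow> \<rho> (loc_elem (mat k ** N)) i j = s k \<otimes> \<rho> (loc_elem N) i j"
  using exhaust_2[of i] by (auto simp: mult MK_closed scalar)

lemma s_mult: "k \<in> KF \<Longrightarrow> l \<in> KF \<Longrightarrow> s (k * l) = s k \<otimes> s l"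
  using scalar_mult[of k "mat l" 1 1] by (simp add: mat_mult_mat MK_closed s_def)

text \<open>A nonzero \<open>d\<close> sent to zero would still have an inverse in
  \<open>KF\<close>, and applying \<open>s\<close> to their product would make one equal to zero in
  \<open>L\<close>.\<close>

lemma s_inj:
  assumes k: "k \<in> KF" and l: "l \<in> KF" and eq: "s k = s l"
  shows "k = l"
proof (rule ccontr)
  assume "k \<noteq> l"
  define d where "d = k + - l"
  have d: "d \<in> KF" "d \<noteq> 0"
    unfolding d_def by (intro KF_closed k l) (simp add: \<open>k \<noteq> l\<close>)
  have "s (l + d) = s l \<oplus> s d" by (rule s_add[OF l d(1)])
  then have "s l = s l \<oplus> s d" using eq by (simp add: d_def)
  then have "s d = \<zero>" using l d by (simp add: L.add.l_cancel_one')
  moreover have "s (d * inverse d) = s d \<otimes> s (inverse d)" using d by (intro s_mult) (auto intro!: KF_closed)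
  ultimately have "\<one> = \<zero>" using d by (simp add: s_1 KF_closed)
  then show False by simp
qed

definition T where "T N = \<rho> (loc_elem N) 1 1 \<oplus> \<rho> (loc_elem N) 2 2"

lemma T_closed [simp]: "N \<in> MK \<Longrightarrow> T N \<in> carrier L"
  by (simp add: T_def)

lemma T_add: "N \<in> MK \<Longrightarrow> M \<in> MK \<Longrightarrow> T (N + M) = T N \<oplus> T M"
  by (simp add: T_def add L.a_ac)

lemma T_commute: "N \<in> MK \<Longrightarrow> M \<in> MK \<Longrightarrow> T (N ** M) = T (M ** N)"
  by (simp add: T_def mult L.a_ac L.m_comm)

lemma T_scalar: "k \<in> KF \<Longrightarrow> N \<in> MK \<Longrightarrow> T (mat k ** N) = s k \<otimes> T N"
  by (simp add: T_def scalar_mult L.r_distr)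

lemma T_0: "T 0 = \<zero>"
  using T_scalar[of 0 0] s_add[of 0 0] L.add.l_cancel_one'[of "s 0" "s 0"] by (simp add: MK_closed KF_closed)

text \<open>The off-diagonal units are commutators of matrix units. The diagonal units are the two
  orders of one product, so they share a value, and its double is \<open>T\<close> of the identity,
  which is 2.\<close>

lemma T_unit:
  "T (M2 0 1 0 0) = \<zero>" "T (M2 0 0 1 0) = \<zero>" "T (M2 1 0 0 0) = \<one>" "T (M2 0 0 0 1) = \<one>"
proof -
  show "T (M2 0 1 0 0) = \<zero>"
    using T_commute[of "M2 1 0 0 0" "M2 0 1 0 0"] T_0 by (simp add: KF_closed zero_M2)
  show "T (M2 0 0 1 0) = \<zero>"
    using T_commute[of "M2 0 0 0 1" "M2 0 0 1 0"] T_0 by (simp add: KF_closed zero_M2)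
  have eq: "T (M2 1 0 0 0) = T (M2 0 0 0 1)"
    using T_commute[of "M2 0 1 0 0" "M2 0 0 1 0"] by (simp add: KF_closed)
  have c: "T (M2 1 0 0 0) \<in> carrier L" by (simp add: KF_closed)
  have "T (M2 1 0 0 0) \<oplus> T (M2 0 0 0 1) = T (mat 1)"
    using T_add[of "M2 1 0 0 0" "M2 0 0 0 1"] by (simp add: KF_closed mat_M2)
  also have "\<dots> = \<one> \<oplus> \<one>" by (simp add: T_def one)
  finally have 2: "T (M2 1 0 0 0) \<oplus> T (M2 1 0 0 0) = \<one> \<oplus> \<one>" by (simp add: eq)
  \<comment> \<open>Halving is possible in \<open>L\<close> because \<open>s\<close> transports 1/2
    from \<open>KF\<close>; nothing else in the locale excludes characteristic 2.\<close>
  have h: "fr (mconst (1/2)) \<in> KF" by (rule KF_fr) simp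
  have "fr (mconst (1/2)) + fr (mconst (1/2)) = 1" by (simp flip: fr_simps(1) mconst_add)
  then have half: "s (fr (mconst (1/2))) \<oplus> s (fr (mconst (1/2))) = \<one>" using s_add[OF h h] s_1 by simp
  define c2 where "c2 = s (fr (mconst (1/2)))"
  have c2: "c2 \<in> carrier L" "c2 \<oplus> c2 = \<one>" using h half by (simp_all add: c2_def)
  have "y = c2 \<otimes> (y \<oplus> y)" if "y \<in> carrier L" for y
  proof -
    have "y = (c2 \<oplus> c2) \<otimes> y" using c2 that by simp
    also have "\<dots> = c2 \<otimes> (y \<oplus> y)" using c2(1) that by (simp add: L.l_distr L.r_distr)
    finally show ?thesis .
  qed
  from this[OF c] this[OF L.one_closed] 2 show "T (M2 1 0 0 0) = \<one>" by simp
  then show "T (M2 0 0 0 1) = \<one>" using eq by simp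
qed

lemma T_eq:
  assumes "N \<in> MK"
  shows "T N = s (trace N)"
proof -
  obtain a b c d where N: "N = M2 a b c d" by (rule M2_cases)
  have K: "a \<in> KF" "b \<in> KF" "c \<in> KF" "d \<in> KF" using assms by (simp_all add: N)
  have "N = mat a ** M2 1 0 0 0 + (mat b ** M2 0 1 0 0 + (mat c ** M2 0 0 1 0 + mat d ** M2 0 0 0 1))"
    by (simp add: N mat_M2)
  also have "T \<dots> = s a \<oplus> s d"
    using K by (simp add: T_add T_scalar T_unit MK_closed KF_closed)
  finally show ?thesis using K by (simp add: N s_add)
qed

lemma trace_condition:
  assumes k: "k \<in> KF" and N: "N \<in> MK"
  shows "(\<forall>i. \<rho> (loc_elem (mat k)) i i = (\<Oplus>j\<in>UNIV. \<rho> (loc_elem N) j j)) \<longleftrightarrow> k = trace N"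
proof -
  have "trace N \<in> KF" using N by (cases N rule: M2_cases) (simp add: KF_closed)
  moreover have "(\<Oplus>j\<in>UNIV. \<rho> (loc_elem N) j j) = T N" using N by (simp add: T_def L.finsum_UNIV_2)
  ultimately show ?thesis using k s_inj[OF k, of "trace N"] by (auto simp: T_eq[OF N] scalar)
qed

end

definition loc_elem_inv :: "(conifold_gen falg set \<times> conifold_gen falg set) set \<Rightarrow> 4 mpoly fract ^ 2 ^ 2" where
  "loc_elem_inv = inv_into MK loc_elem"

lemma loc_elem_inv [simp]: "N \<in> MK \<Longrightarrow> loc_elem_inv (loc_elem N) = N"
  unfolding loc_elem_inv_def using loc_elem_eq_iff by (intro inv_into_f_f inj_onI) auto

lemma mat_nth: "mat c $ i $ j = (if i = j then c else 0)"
  by (simp add: mat_def)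

text \<open>The localization is already split over its centre. Taking the centre itself as
  \<open>L\<close> keeps the entries in the carrier type of the algebra, as
  \<open>reduced_trace\<close> demands.\<close>

lemma splitting_exists:
  "splitting loc Kloc (loc\<lparr>carrier := Kloc\<rparr>) (\<lambda>x (i::2) j. loc_elem (mat (loc_elem_inv x $ i $ j)))"
proof -
  let ?L = "loc\<lparr>carrier := Kloc\<rparr>"
  have L: "field ?L" by (rule loc.subfield_iff(2)[OF subfield_Kloc])
  interpret L: field ?L by (rule L)
  have nth: "N $ i $ j \<in> KF" if "N \<in> MK" for N i j using that by (simp add: MK_def)
  show ?thesis unfolding splitting_def
  proof (intro conjI L ballI allI)
    show "loc_elem (mat (loc_elem_inv x $ i $ j)) \<in> carrier ?L" if "x \<in> carrier loc" for x and i j :: 2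
      using that nth by (auto simp: carrier_loc Kloc_def)
    fix i j :: 2
    show "loc_elem (mat (loc_elem_inv (x \<oplus>\<^bsub>loc\<^esub> y) $ i $ j)) = loc_elem (mat (loc_elem_inv x $ i $ j)) \<oplus>\<^bsub>?L\<^esub> loc_elem (mat (loc_elem_inv y $ i $ j))"
      if x: "x \<in> carrier loc" and y: "y \<in> carrier loc" for x y
    proof -
      obtain N M where *: "N \<in> MK" "x = loc_elem N" "M \<in> MK" "y = loc_elem M" using x y by (elim loc_cases)
      then show ?thesis using nth by (simp add: loc_elem_add[OF *(1,3)] MK_closed loc_elem_mat_ops)
    qed
    show "loc_elem (mat (loc_elem_inv (x \<otimes>\<^bsub>loc\<^esub> y) $ i $ j)) =
        (\<Oplus>\<^bsub>?L\<^esub>k\<in>UNIV. loc_elem (mat (loc_elem_inv x $ i $ k)) \<otimes>\<^bsub>?L\<^esub> loc_elem (mat (loc_elem_inv y $ k $ j)))"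
      if x: "x \<in> carrier loc" and y: "y \<in> carrier loc" for x y
    proof -
      obtain N M where *: "N \<in> MK" "x = loc_elem N" "M \<in> MK" "y = loc_elem M" using x y by (elim loc_cases)
      have c: "loc_elem (mat (N $ i $ k)) \<otimes>\<^bsub>loc\<^esub> loc_elem (mat (M $ k $ j)) \<in> Kloc" for k
        using nth[OF *(1)] nth[OF *(3)] by (auto simp: loc_elem_mat_ops Kloc_def intro!: imageI KF_closed)
      have "(\<Oplus>\<^bsub>?L\<^esub>k\<in>UNIV. loc_elem (mat (loc_elem_inv x $ i $ k)) \<otimes>\<^bsub>?L\<^esub> loc_elem (mat (loc_elem_inv y $ k $ j)))
        = loc_elem (mat (N $ i $ 1)) \<otimes>\<^bsub>loc\<^esub> loc_elem (mat (M $ 1 $ j)) \<oplus>\<^bsub>loc\<^esub> loc_elem (mat (N $ i $ 2)) \<otimes>\<^bsub>loc\<^esub> loc_elem (mat (M $ 2 $ j))"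
        using * c by (subst L.finsum_UNIV_2) simp_all
      moreover have "loc_elem_inv (x \<otimes>\<^bsub>loc\<^esub> y) = N ** M" using * by (simp add: loc_elem_mult MK_closed)
      moreover have "(N ** M) $ i $ j = N $ i $ 1 * M $ 1 $ j + N $ i $ 2 * M $ 2 $ j"
        by (simp add: matrix_matrix_mult_def sum_2)
      ultimately show ?thesis using nth[OF *(1)] nth[OF *(3)] by (simp add: loc_elem_mat_ops KF_closed)
    qed
    show "loc_elem (mat (loc_elem_inv \<one>\<^bsub>loc\<^esub> $ i $ j)) = (if i = j then \<one>\<^bsub>?L\<^esub> else \<zero>\<^bsub>?L\<^esub>)"
      by (simp add: loc_elem_one loc_elem_zero MK_closed KF_closed mat_nth)
  next
    fix x assume "x \<in> Kloc"
    then obtain k where k: "k \<in> KF" "x = loc_elem (mat k)" by (auto simp: Kloc_def)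
    show "\<exists>c\<in>carrier ?L. \<forall>i j :: 2. loc_elem (mat (loc_elem_inv x $ i $ j)) = (if i = j then c else \<zero>\<^bsub>?L\<^esub>)"
      using k by (intro bexI[of _ x]) (auto simp: MK_closed mat_nth loc_elem_zero Kloc_def)
  qed
qed

theorem reduced_trace_loc:
  assumes N: "N \<in> MK"
  shows "reduced_trace TYPE(2) loc Kloc (loc_elem N) = loc_elem (mat (trace N))"
proof -
  have tr: "trace N \<in> KF" using N by (cases N rule: M2_cases) (simp add: KF_closed)
  have *: "(\<forall>i. \<rho> (loc_elem (mat k)) i i = (\<Oplus>\<^bsub>L\<^esub>j\<in>UNIV. \<rho> (loc_elem N) j j)) \<longleftrightarrow> k = trace N"
    if "splitting loc Kloc L \<rho>" "k \<in> KF"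
    for L :: "(conifold_gen falg set \<times> conifold_gen falg set) set ring"
      and \<rho> :: "(conifold_gen falg set \<times> conifold_gen falg set) set \<Rightarrow> 2 \<Rightarrow> 2 \<Rightarrow> _" and k
  proof -
    interpret loc_splitting L \<rho>
      using that unfolding loc_splitting_def loc_splitting_axioms_def splitting_def by blast
    show ?thesis by (rule trace_condition[OF that(2) N])
  qed
  show ?thesis unfolding reduced_trace_def
  proof (rule the_equality)
    show "loc_elem (mat (trace N)) \<in> Kloc \<and> (\<exists>(L :: (conifold_gen falg set \<times> conifold_gen falg set) set ring)
        (\<rho> :: _ \<Rightarrow> 2 \<Rightarrow> 2 \<Rightarrow> _). splitting loc Kloc L \<rho> \<and> (\<forall>i. \<rho> (loc_elem (mat (trace N))) i i = (\<Oplus>\<^bsub>L\<^esub>j\<in>UNIV. \<rho> (loc_elem N) j j)))"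
      using splitting_exists *[OF splitting_exists tr] tr by (auto simp: Kloc_def)
    fix t
    assume t: "t \<in> Kloc \<and> (\<exists>(L :: (conifold_gen falg set \<times> conifold_gen falg set) set ring)
        (\<rho> :: _ \<Rightarrow> 2 \<Rightarrow> 2 \<Rightarrow> _). splitting loc Kloc L \<rho> \<and> (\<forall>i. \<rho> t i i = (\<Oplus>\<^bsub>L\<^esub>j\<in>UNIV. \<rho> (loc_elem N) j j)))"
    then obtain k where k: "k \<in> KF" "t = loc_elem (mat k)" by (auto simp: Kloc_def)
    then show "t = loc_elem (mat (trace N))" using t * by blast
  qed
qed

text \<open>The base change behind \<open>loc_matrix\<close> leaves the diagonal alone, so the
  reduced trace is the trace of the graded matrix, which already has degree zero and thus lies in
  the centre.\<close>

theorem order_trace_conifold: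
  assumes A: "graded A"
  shows "order_trace TYPE(2) \<Lambda> (cl A) = sc (trace A)"
proof -
  have tr: "homog 0 (trace A)" using A by (cases A rule: M2_cases) (simp add: homog_add)
  have "reduced_trace TYPE(2) loc (central_fraction_field \<Lambda>)
      (central_fraction \<Lambda> (cl A) \<one>\<^bsub>\<Lambda>\<^esub>) = loc_elem (mat (trace (loc_matrix A 1)))"
    using central_fraction_eq_loc_elem[OF A, of 1] reduced_trace_loc[OF loc_matrix_MK[OF A, of 1]]
    by (simp add: sc_one central_fraction_field_conifold)
  also have "trace (loc_matrix A 1) = fr (trace A)" by (cases A rule: M2_cases) simp
  finally have red: "reduced_trace TYPE(2) loc (central_fraction_field \<Lambda>)
      (central_fraction \<Lambda> (cl A) \<one>\<^bsub>\<Lambda>\<^esub>) = loc_elem (mat (fr (trace A)))" .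
  have cf: "central_fraction \<Lambda> (sc p) \<one>\<^bsub>\<Lambda>\<^esub> = loc_elem (mat (fr p))" if "homog 0 p" for p
    using central_fraction_eq_loc_elem[OF graded_mat[OF that], of 1] by (simp add: sc_one sc_def loc_matrix_mat)
  show ?thesis unfolding order_trace_def red
  proof (rule the_equality)
    show "sc (trace A) \<in> centre \<Lambda> \<and>
        central_fraction \<Lambda> (sc (trace A)) \<one>\<^bsub>\<Lambda>\<^esub> = loc_elem (mat (fr (trace A)))"
      using tr by (simp add: sc_centre cf)
    fix r assume r: "r \<in> centre \<Lambda> \<and>
        central_fraction \<Lambda> r \<one>\<^bsub>\<Lambda>\<^esub> = loc_elem (mat (fr (trace A)))"
    then obtain p where p: "homog 0 p" "r = sc p" by (auto simp: centre_eq_sc)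
    then have "fr p = fr (trace A)" using r tr by (simp add: cf loc_elem_mat_eq_iff KF_fr)
    then show "r = sc (trace A)" using p by simp
  qed
qed

section \<open>Components and local dimensions\<close>

lemma zariski_closed_Un:
  assumes "zariski_closed A" "zariski_closed B"
  shows "zariski_closed (A \<union> B)"
proof -
  obtain F G where A: "A = zeros F" and B: "B = zeros G" using assms unfolding zariski_closed_def by (elim exE)
  have "A \<union> B = zeros {f * g | f g. f \<in> F \<and> g \<in> G}"
  proof (intro equalityI subsetI)
    fix v assume "v \<in> A \<union> B"
    then show "v \<in> zeros {f * g | f g. f \<in> F \<and> g \<in> G}" by (auto simp: A B zeros_def)
  next
    fix v assume v: "v \<in> zeros {f * g | f g. f \<in> F \<and> g \<in> G}"
    show "v \<in> A \<union> B"
    proof (rule ccontr)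
      assume "v \<notin> A \<union> B"
      then obtain f g where "f \<in> F" "meval f v \<noteq> 0" "g \<in> G" "meval g v \<noteq> 0"
        by (auto simp: A B zeros_def)
      moreover from this have "meval (f * g) v = 0" using v unfolding zeros_def by blast
      ultimately show False by simp
    qed
  qed
  then show ?thesis by (simp only: zariski_closed_zeros)
qed

lemma irreducible_closed_singleton: "irreducible_closed {p}"
proof -
  have "{p} = zeros {mvar i - mconst (p $ i) | i. True}"
  proof (intro equalityI subsetI)
    fix v assume v: "v \<in> zeros {mvar i - mconst (p $ i) | i. True}"
    have "v $ i = p $ i" for i
    proof -
      have "meval (mvar i - mconst (p $ i)) v = 0" using v unfolding zeros_def by blast
      then show ?thesis by simp
    qed
    then show "v \<in> {p}" by (simp add: vec_eq_iff)
  qed (auto simp: zeros_def)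
  then have "zariski_closed {p}" by (simp only: zariski_closed_zeros)
  then show ?thesis by (auto simp: irreducible_closed_def)
qed

lemma irreducible_closedD:
  "irreducible_closed Z \<Longrightarrow> zariski_closed A \<Longrightarrow> zariski_closed B \<Longrightarrow> Z \<subseteq> A \<union> B \<Longrightarrow> Z \<subseteq> A \<or> Z \<subseteq> B"
  unfolding irreducible_closed_def by blast

lemma irreducible_closed_closed: "irreducible_closed Z \<Longrightarrow> zariski_closed Z"
  and irreducible_closed_nonempty: "irreducible_closed Z \<Longrightarrow> Z \<noteq> {}"
  unfolding irreducible_closed_def by blast+

lemma irreducible_components_three:
  assumes irr: "irreducible_closed A" "irreducible_closed B" "irreducible_closed C"
    and disj: "A \<inter> B = {}" "A \<inter> C = {}" "B \<inter> C = {}"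
  shows "irreducible_components (A \<union> B \<union> C) = {A, B, C}"
proof -
  note cl = irr[THEN irreducible_closed_closed]
  note ne = irr[THEN irreducible_closed_nonempty]
  have sub: "Z \<subseteq> A \<or> Z \<subseteq> B \<or> Z \<subseteq> C" if "irreducible_closed Z" "Z \<subseteq> A \<union> B \<union> C" for Z
    using irreducible_closedD[OF that(1) zariski_closed_Un[OF cl(1,2)] cl(3) that(2)]
      irreducible_closedD[OF that(1) cl(1,2)] by blast
  have max: "XX \<in> irreducible_components (A \<union> B \<union> C)" if XX: "XX \<in> {A, B, C}" for XX
  proof -
    have "Z' = XX" if "irreducible_closed Z'" "XX \<subseteq> Z'" "Z' \<subseteq> A \<union> B \<union> C" for Z'
      using sub[OF that(1,3)] that(2) XX disj ne by blast
    moreover have "irreducible_closed XX" "XX \<subseteq> A \<union> B \<union> C" using XX irr by auto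
    ultimately show ?thesis unfolding irreducible_components_def by blast
  qed
  moreover have "Z \<in> {A, B, C}" if Z: "Z \<in> irreducible_components (A \<union> B \<union> C)" for Z
  proof -
    have irrZ: "irreducible_closed Z" "Z \<subseteq> A \<union> B \<union> C"
      and m: "\<And>Z'. irreducible_closed Z' \<Longrightarrow> Z \<subseteq> Z' \<Longrightarrow> Z' \<subseteq> A \<union> B \<union> C \<Longrightarrow> Z' = Z"
      using Z unfolding irreducible_components_def by blast+
    from sub[OF irrZ] show ?thesis using m[OF irr(1)] m[OF irr(2)] m[OF irr(3)] by blast
  qed
  ultimately show ?thesis by blast
qed

section \<open>Chains of irreducible sets through a point\<close>

lemma Sup_enat_eqI:
  assumes "\<And>n. P n \<Longrightarrow> n \<le> m" "P m"
  shows "Sup {enat n | n. P n} = enat m"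
proof (rule antisym)
  show "Sup {enat n | n. P n} \<le> enat m" using assms(1) by (intro Sup_least) auto
  show "enat m \<le> Sup {enat n | n. P n}" using assms(2) by (intro Sup_upper) auto
qed

lemma irreducible_chain_mono:
  assumes "irreducible_chain V n C" "k \<le> n"
  shows "C 0 \<subseteq> C k"
  using assms(2)
proof (induction k)
  case (Suc k)
  then have "C k \<subset> C (Suc k)" using assms(1) unfolding irreducible_chain_def by auto
  then show ?case using Suc by auto
qed simp

text \<open>Every member of the chain contains \<open>v\<close>, which is not in \<open>B\<close>,
  so irreducibility confines it to \<open>A\<close>. Local dimension is thus computed in the
  component through \<open>v\<close>.\<close>

lemma irreducible_chain_in_component:
  assumes C: "irreducible_chain (A \<union> B) n C" and v: "v \<in> C 0" "v \<notin> B"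
    and A: "zariski_closed A" and B: "zariski_closed B"
  shows "irreducible_chain A n C"
proof -
  have "C k \<subseteq> A" if k: "k \<le> n" for k
  proof -
    have "irreducible_closed (C k)" "C k \<subseteq> A \<union> B" using C k unfolding irreducible_chain_def by auto
    moreover have "v \<in> C k" using irreducible_chain_mono[OF C k] v(1) by blast
    ultimately show ?thesis using irreducible_closedD[OF _ A B] v(2) by blast
  qed
  then show ?thesis using C unfolding irreducible_chain_def by auto
qed

lemma irreducible_chain_superset: "irreducible_chain A n C \<Longrightarrow> A \<subseteq> V \<Longrightarrow> irreducible_chain V n C"
  unfolding irreducible_chain_def by blast

lemma irreducible_chain_singleton:
  assumes "irreducible_chain {p} n C" shows "n = 0"
proof (rule ccontr)
  assume "n \<noteq> 0"
  then have "C 0 \<subset> C 1" "C 0 \<noteq> {}" "C 1 \<subseteq> {p}" using assms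
    unfolding irreducible_chain_def irreducible_closed_def by auto
  then show False by auto
qed

lemma irreducible_chain_point: "p \<in> V \<Longrightarrow> irreducible_chain V 0 (\<lambda>_. {p})"
  by (simp add: irreducible_chain_def irreducible_closed_singleton)

section \<open>Two-dimensional representations of the conifold algebra\<close>

definition mkpt :: "complex ^ 2 ^ 2 \<Rightarrow> complex ^ 2 ^ 2 \<Rightarrow> complex ^ 2 ^ 2 \<Rightarrow> complex ^ (conifold_gen \<times> 2 \<times> 2)" where
  "mkpt XX Y Z = (\<chi> k. (case fst k of GX \<Rightarrow> XX | GY \<Rightarrow> Y | GZ \<Rightarrow> Z) $ fst (snd k) $ snd (snd k))"

lemma point_matrix_mkpt [simp]:
  "point_matrix (mkpt XX Y Z) GX = XX" "point_matrix (mkpt XX Y Z) GY = Y" "point_matrix (mkpt XX Y Z) GZ = Z"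
  by (simp_all add: point_matrix_def mkpt_def vec_eq_iff)

lemma mkpt_nth [simp]: "mkpt XX Y Z $ (GX, i, j) = XX $ i $ j" "mkpt XX Y Z $ (GY, i, j) = Y $ i $ j"
    "mkpt XX Y Z $ (GZ, i, j) = Z $ i $ j"
  by (simp_all add: mkpt_def)

lemma mkpt_eq_iff [simp]: "mkpt XX Y Z = mkpt XX' Y' Z' \<longleftrightarrow> XX = XX' \<and> Y = Y' \<and> Z = Z'"
  by (metis point_matrix_mkpt)

lemma mkpt_cases: obtains XX Y Z where "v = mkpt XX Y Z"
proof
  show "v = mkpt (point_matrix v GX) (point_matrix v GY) (point_matrix v GZ)"
    by (auto simp: vec_eq_iff mkpt_def point_matrix_def split: conifold_gen.split)
qed

definition con_rel :: "complex ^ 2 ^ 2 \<Rightarrow> complex ^ 2 ^ 2 \<Rightarrow> complex ^ 2 ^ 2 \<Rightarrow> bool" where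
  "con_rel XX Y Z \<longleftrightarrow> Z ** Z = mat 1 \<and> XX ** Z + Z ** XX = 0 \<and> Y ** Z + Z ** Y = 0 \<and>
     XX ** XX ** Y = Y ** (XX ** XX) \<and> Y ** Y ** XX = XX ** (Y ** Y)"

lemma free_eval_1 [simp]: "free_eval (\<lambda>c. c) M 1 = mat 1"
  using id_map.free_eval_fconst[of M 1] by simp

lemma free_eval_diff [simp]: "free_eval (\<lambda>c. c) M (f - g) = free_eval (\<lambda>c. c) M f - free_eval (\<lambda>c. c) M g"
  using id_map.free_eval_add[of M f "- g"] by simp

lemma zeros_conifold_rep2_iff:
  "v \<in> zeros conifold_rep2 \<longleftrightarrow> (\<forall>f\<in>I_con. free_eval (\<lambda>c. c) (point_matrix v) f = 0)"
  unfolding conifold_rep2_def zeros_rep_ideal algebra_map_iff ..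

lemma zeros_conifold_rep2: "mkpt XX Y Z \<in> zeros conifold_rep2 \<longleftrightarrow> con_rel XX Y Z"
proof -
  let ?ev = "free_eval (\<lambda>c. c) (point_matrix (mkpt XX Y Z))"
  have rel: "con_rel XX Y Z \<longleftrightarrow> (\<forall>f\<in>conifold_relations. ?ev f = 0)"
    by (auto simp: con_rel_def conifold_relations_def Let_def power2_eq_square)
  have "(\<forall>f\<in>I_con. ?ev f = 0) \<longleftrightarrow> (\<forall>f\<in>conifold_relations. ?ev f = 0)"
  proof
    show "\<forall>f\<in>I_con. ?ev f = 0 \<Longrightarrow> \<forall>f\<in>conifold_relations. ?ev f = 0"
      using relation_ideal_base by blast
    assume *: "\<forall>f\<in>conifold_relations. ?ev f = 0"
    show "\<forall>f\<in>I_con. ?ev f = 0"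
    proof
      fix f assume "f \<in> I_con"
      then show "?ev f = 0" by (rule relation_ideal_minimal[rotated 5]) (use * in auto)
    qed
  qed
  then show ?thesis unfolding zeros_conifold_rep2_iff rel .
qed

text \<open>That \<open>X ** X\<close> commutes with \<open>Y\<close>, and \<open>Y ** Y\<close>
  with \<open>X\<close>, is implied: matrices anticommuting with such a \<open>Z\<close> have scalar
  squares.\<close>

definition Trep :: "(complex ^ (conifold_gen \<times> 2 \<times> 2)) set" where
  "Trep = {mkpt XX Y Z | XX Y Z. Z ** Z = mat 1 \<and> trace Z = 0 \<and> XX ** Z + Z ** XX = 0 \<and> Y ** Z + Z ** Y = 0}"

lemma Trep_iff: "mkpt XX Y Z \<in> Trep \<longleftrightarrow> Z ** Z = mat 1 \<and> trace Z = 0 \<and> XX ** Z + Z ** XX = 0 \<and> Y ** Z + Z ** Y = 0"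
  by (auto simp: Trep_def)

section \<open>Conjugation, and charts of the trace-zero component\<close>

definition Dg :: "complex ^ 2 ^ 2" where "Dg = M2 1 0 0 (- 1)"
definition AD :: "complex \<Rightarrow> complex \<Rightarrow> complex ^ 2 ^ 2" where "AD x x' = M2 0 x x' 0"
definition Lo :: "complex \<Rightarrow> complex ^ 2 ^ 2" where "Lo t = M2 1 0 t 1"
definition Up :: "complex \<Rightarrow> complex ^ 2 ^ 2" where "Up t = M2 1 t 0 1"

lemma Lo_Up_inverse [simp]: "Lo t ** Lo (- t) = mat 1" "Lo (- t) ** Lo t = mat 1"
    "Up t ** Up (- t) = mat 1" "Up (- t) ** Up t = mat 1"
  by (simp_all add: Lo_def Up_def mat_M2)

text \<open>The inverse is carried along explicitly, because charts need it as a polynomial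
  expression in the parameters.\<close>

definition inv_pair :: "complex ^ 2 ^ 2 \<Rightarrow> complex ^ 2 ^ 2 \<Rightarrow> bool" where
  "inv_pair h k \<longleftrightarrow> h ** k = mat 1 \<and> k ** h = mat 1"

lemma inv_pair_mult: "inv_pair h k \<Longrightarrow> inv_pair h' k' \<Longrightarrow> inv_pair (h ** h') (k' ** k)"
proof -
  assume *: "inv_pair h k" "inv_pair h' k'"
  have "h ** h' ** (k' ** k) = h ** (h' ** k') ** k" "k' ** k ** (h ** h') = k' ** (k ** h) ** h'"
    by (simp_all add: matrix_mul_assoc)
  then show ?thesis using * by (simp add: inv_pair_def)
qed

lemma inv_pair_sym: "inv_pair h k \<Longrightarrow> inv_pair k h"
  by (simp add: inv_pair_def)

lemma inv_pair_1 [simp]: "inv_pair (mat 1) (mat 1)" and inv_pair_Lo [simp]: "inv_pair (Lo t) (Lo (- t))"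
  and inv_pair_Up [simp]: "inv_pair (Up t) (Up (- t))"
  by (simp_all add: inv_pair_def)

lemma conj_mult:
  assumes "inv_pair h k"
  shows "(h ** A ** k) ** (h ** B ** k) = h ** (A ** B) ** k"
proof -
  have "(h ** A ** k) ** (h ** B ** k) = h ** A ** (k ** h) ** B ** k" by (simp add: matrix_mul_assoc)
  also have "\<dots> = h ** A ** B ** k" using assms by (simp add: inv_pair_def)
  finally show ?thesis by (simp add: matrix_mul_assoc)
qed

lemma conj_add: "h ** A ** k + h ** B ** k = h ** (A + B) ** k" for h :: "complex ^ 2 ^ 2"
  by (simp add: matrix_add_ldistrib matrix_add_rdistrib)

lemma conj_trace:
  assumes "inv_pair h k" shows "trace (h ** A ** k) = trace A"
proof -
  have "trace (h ** A ** k) = trace (k ** h ** A)"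
    using trace_mul_sym[of "h ** A" k] by (simp add: matrix_mul_assoc)
  then show ?thesis using assms by (simp add: inv_pair_def)
qed

lemma conj_mat:
  assumes "inv_pair h k" shows "h ** mat c ** k = mat c"
proof -
  have "h ** mat c ** k = mat c ** (h ** k)"
    unfolding mat_mult_commute[of c h, symmetric] by (rule matrix_mul_assoc[symmetric])
  then show ?thesis using assms by (simp add: inv_pair_def)
qed

lemma conj_cancel:
  assumes "inv_pair h k" shows "h ** (k ** A ** h) ** k = A"
proof -
  have "h ** (k ** A ** h) ** k = (h ** k) ** A ** (h ** k)" by (simp add: matrix_mul_assoc)
  then show ?thesis using assms by (simp add: inv_pair_def)
qed

lemma Trep_conj:
  assumes hk: "inv_pair h k" and T: "mkpt XX Y Z \<in> Trep"
  shows "mkpt (h ** XX ** k) (h ** Y ** k) (h ** Z ** k) \<in> Trep"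
  using T conj_mat[OF hk, of 1] by (simp add: Trep_iff conj_mult[OF hk] conj_add conj_trace[OF hk])

text \<open>The chart \<open>Up s Lo t\<close> of the variety of pairs of distinct lines, times the antidiagonal
  matrices, moved by a fixed base change \<open>h\<close>.\<close>

definition chart :: "complex ^ 2 ^ 2 \<Rightarrow> complex ^ 2 ^ 2 \<Rightarrow> (nat \<Rightarrow> complex) \<Rightarrow> complex ^ (conifold_gen \<times> 2 \<times> 2)" where
  "chart h k w = (let h' = h ** (Up (w 5) ** Lo (w 4)); k' = Lo (- w 4) ** Up (- w 5) ** k in
     mkpt (h' ** AD (w 0) (w 1) ** k') (h' ** AD (w 2) (w 3) ** k') (h' ** Dg ** k'))"

lemma chart_Trep:
  assumes "inv_pair h k"
  shows "chart h k w \<in> Trep"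
proof -
  have "mkpt (AD (w 0) (w 1)) (AD (w 2) (w 3)) Dg \<in> Trep"
    by (simp add: Trep_iff AD_def Dg_def mat_M2 zero_M2)
  moreover have "inv_pair (h ** (Up (w 5) ** Lo (w 4))) (Lo (- w 4) ** Up (- w 5) ** k)"
    by (intro inv_pair_mult assms) simp_all
  ultimately show ?thesis unfolding chart_def Let_def by (rule Trep_conj[rotated])
qed

lemma chart_surj:
  assumes T: "mkpt XX Y Z \<in> Trep" and r: "Z $ 2 $ 1 \<noteq> 0"
  shows "\<exists>w. mkpt XX Y Z = chart (mat 1) (mat 1) w"
proof -
  obtain p q r p' where Z: "Z = M2 p q r p'" by (rule M2_cases)
  have p': "p' = - p" using T by (simp add: Trep_iff Z add_eq_0_iff)
  have pq: "p * p + q * r = 1" using T by (simp add: Trep_iff Z mat_M2)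
  have r0: "r \<noteq> 0" using r by (simp add: Z)
  \<comment> \<open>Conjugating \<open>Dg\<close> by \<open>Up s ** Lo t\<close> gives lower left
    entry \<open>2 * t\<close> and upper left entry \<open>1 + 2 * (s * t)\<close>. Matching them
    with \<open>r\<close> and \<open>p\<close> determines \<open>t\<close> and \<open>s\<close>, and
    \<open>Z ** Z = mat 1\<close> settles the remaining entry.\<close>
  define t where "t = r / 2"
  define s where "s = (p - 1) / r"
  define h where "h = Up s ** Lo t"
  define k where "k = Lo (- t) ** Up (- s)"
  have hk: "inv_pair h k" unfolding h_def k_def by (intro inv_pair_mult) simp_all
  have hZ: "h ** Dg ** k = Z"
  proof -
    have st: "s * t = (p - 1) / 2" using r0 by (simp add: s_def t_def)
    have "h ** Dg ** k = M2 (1 + 2 * (s * t)) (- (2 * s * (1 + s * t))) (2 * t) (- (1 + 2 * (s * t)))"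
      by (simp add: h_def k_def Up_def Lo_def Dg_def algebra_simps)
    moreover have "2 * s * (1 + s * t) = (p * p - 1) / r" unfolding st by (simp add: s_def field_simps)
    moreover have "(p * p - 1) / r = - q" using pq r0 by (simp add: field_simps)
    ultimately show ?thesis using st by (simp add: Z p' t_def)
  qed
  \<comment> \<open>Undoing the conjugation turns anticommuting with \<open>Z\<close> into
    anticommuting with \<open>Dg\<close>, that is, into having zero diagonal.\<close>
  have anti: "\<exists>x x'. A = h ** AD x x' ** k" if A: "A ** Z + Z ** A = 0" for A
  proof -
    define B where "B = k ** A ** h"
    have kZ: "k ** Z ** h = Dg" using conj_cancel[OF inv_pair_sym[OF hk], of Dg] by (simp add: hZ)
    have "B ** Dg + Dg ** B = k ** (A ** Z + Z ** A) ** h"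
      unfolding B_def kZ[symmetric] conj_mult[OF inv_pair_sym[OF hk]] conj_add ..
    then have B0: "B ** Dg + Dg ** B = 0" by (simp add: A)
    obtain a b c d where M: "B = M2 a b c d" by (rule M2_cases)
    have "B = AD b c" using B0 by (simp add: M Dg_def AD_def zero_M2)
    then show ?thesis using conj_cancel[OF hk, of A] by (metis B_def)
  qed
  obtain x x' where XX: "XX = h ** AD x x' ** k" using anti[of XX] T unfolding Trep_iff by blast
  obtain y y' where Y: "Y = h ** AD y y' ** k" using anti[of Y] T unfolding Trep_iff by blast
  define w :: "nat \<Rightarrow> complex" where "w i = [x, x', y, y', t, s] ! i" for i
  have "chart (mat 1) (mat 1) w = mkpt XX Y Z"
    by (simp add: chart_def Let_def w_def XX Y hZ h_def[symmetric] k_def[symmetric])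
  then show ?thesis by metis
qed

lemma Trep_chart:
  assumes "v \<in> Trep"
  shows "\<exists>e w. v = chart (Lo e) (Lo (- e)) w"
proof -
  obtain XX Y Z where v: "v = mkpt XX Y Z" by (rule mkpt_cases)
  obtain p q r p' where Z: "Z = M2 p q r p'" by (rule M2_cases)
  have p': "p' = - p" using assms by (simp add: v Trep_iff Z add_eq_0_iff)
  have pq: "p * p + q * r = 1" using assms by (simp add: v Trep_iff Z mat_M2)
  have "(Lo (- e) ** Z ** Lo e) $ 2 $ 1 = r - 2 * e * p - e * e * q" for e
    by (simp add: Lo_def Z p' algebra_simps)
  \<comment> \<open>The entry is quadratic in \<open>e\<close>. If it vanished at 0, 1 and -1, then
    \<open>p\<close> and \<open>r\<close> would be 0, against
    \<open>p * p + q * r = 1\<close>.\<close>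
  moreover have "\<exists>e. r - 2 * e * p - e * e * q \<noteq> 0"
  proof (rule ccontr)
    assume "\<not> ?thesis"
    then have *: "r - 2 * e * p - e * e * q = 0" for e by blast
    have r: "r = 0" and 1: "- 2 * p = q" and 2: "2 * p = q" using *[of 0] *[of 1] *[of "- 1"] by simp_all
    have "p = 0" using 1 2 by simp
    then show False using pq r by simp
  qed
  ultimately obtain e where e: "(Lo (- e) ** Z ** Lo e) $ 2 $ 1 \<noteq> 0" by metis
  have inv: "inv_pair (Lo (- e)) (Lo e)" using inv_pair_Lo[of "- e"] by simp
  have "mkpt (Lo (- e) ** XX ** Lo e) (Lo (- e) ** Y ** Lo e) (Lo (- e) ** Z ** Lo e) \<in> Trep"
    by (rule Trep_conj[OF inv]) (use assms v in simp)
  from chart_surj[OF this e] obtain w where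
    w: "mkpt (Lo (- e) ** XX ** Lo e) (Lo (- e) ** Y ** Lo e) (Lo (- e) ** Z ** Lo e) = chart (mat 1) (mat 1) w" by blast
  define h where "h = Up (w 5) ** Lo (w 4)"
  define k where "k = Lo (- w 4) ** Up (- w 5)"
  have "A = Lo e ** h ** B ** (k ** Lo (- e))" if "Lo (- e) ** A ** Lo e = h ** B ** k" for A B
  proof -
    have "A = Lo e ** (Lo (- e) ** A ** Lo e) ** Lo (- e)" using conj_cancel[OF inv_pair_Lo] by simp
    then show ?thesis unfolding that by (simp add: matrix_mul_assoc)
  qed
  then have "v = chart (Lo e) (Lo (- e)) w"
    using w unfolding v chart_def Let_def by (simp flip: h_def k_def)
  then show ?thesis by blast
qed

section \<open>Polynomial parametrization and irreducibility of the trace-zero component\<close>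

definition pmat :: "nat \<Rightarrow> ((nat \<Rightarrow> complex) \<Rightarrow> complex ^ 2 ^ 2) \<Rightarrow> bool" where
  "pmat n F \<longleftrightarrow> (\<forall>i j. pfun n (\<lambda>w. F w $ i $ j))"

lemma pmat_const: "pmat n (\<lambda>_. A)"
  by (simp add: pmat_def pfun.const)

lemma pmat_mult: "pmat n F \<Longrightarrow> pmat n G \<Longrightarrow> pmat n (\<lambda>w. F w ** G w)"
  unfolding pmat_def matrix_matrix_mult_def by (auto intro!: pfun_sum pfun.mult)

lemma pmat_M2:
  "pfun n a \<Longrightarrow> pfun n b \<Longrightarrow> pfun n c \<Longrightarrow> pfun n d \<Longrightarrow> pmat n (\<lambda>w. M2 (a w) (b w) (c w) (d w))"
  unfolding pmat_def forall_2 M2_nth by blast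

lemma pmap_mkpt: "pmat n F \<Longrightarrow> pmat n G \<Longrightarrow> pmat n H \<Longrightarrow> pmap n (\<lambda>w. mkpt (F w) (G w) (H w))"
proof -
  assume *: "pmat n F" "pmat n G" "pmat n H"
  have "pfun n (\<lambda>w. mkpt (F w) (G w) (H w) $ (g, i, j))" for g i j
    using * by (cases g) (auto simp: pmat_def)
  then show ?thesis by (simp add: pmap_def)
qed

lemma pmap_chart:
  assumes "pmat n h" "pmat n k" "\<And>i. i < 6 \<Longrightarrow> pfun n (\<lambda>w. u w i)"
  shows "pmap n (\<lambda>w. chart (h w) (k w) (u w))"
  unfolding chart_def Let_def
  by (intro pmap_mkpt pmat_mult assms(1,2)) 
    (auto simp: Up_def Lo_def AD_def Dg_def intro!: pmat_M2 pmat_const pfun.const pfun_uminus assms(3))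

text \<open>The position \<open>e\<close> of the chart becomes a seventh parameter, so that one
  polynomial map covers the whole component. It serves irreducibility; the dimension bound comes
  from a single six-parameter chart.\<close>

lemma range_cover_chart: "Trep = range (\<lambda>w. chart (Lo (w 6)) (Lo (- w 6)) w)"
proof (intro equalityI subsetI)
  fix v assume "v \<in> Trep"
  then obtain e w where v: "v = chart (Lo e) (Lo (- e)) w" using Trep_chart by blast
  have "chart (Lo e) (Lo (- e)) w = chart (Lo e) (Lo (- e)) (w(6 := e))" by (simp add: chart_def Let_def)
  then show "v \<in> range (\<lambda>w. chart (Lo (w 6)) (Lo (- w 6)) w)"
    unfolding v by (intro image_eqI[of _ _ "w(6 := e)"]) auto
qed (auto intro: chart_Trep)

definition evm :: "complex ^ 4 \<Rightarrow> 4 mpoly ^ 2 ^ 2 \<Rightarrow> complex ^ 2 ^ 2" where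
  "evm c A = (\<chi> i j. meval (A $ i $ j) c)"

lemma evm_mult: "evm c (A ** B) = evm c A ** evm c B"
  by (simp add: evm_def vec_eq_iff matrix_matrix_mult_def)

lemma evm_add: "evm c (A + B) = evm c A + evm c B"
  by (simp add: evm_def vec_eq_iff)

lemma evm_mat: "evm c (mat p) = mat (meval p c)"
  by (simp add: evm_def mat2_eq_iff mat_M2)

lemma evm_M2: "evm c (M2 p q r s) = M2 (meval p c) (meval q c) (meval r c) (meval s c)"
  by (simp add: evm_def mat2_eq_iff)

lemma trace_evm: "trace (evm c A) = meval (trace A) c"
  by (simp add: evm_def trace_def sum_2)

text \<open>A point of \<open>Trep\<close> is conjugate to a specialization of the matrix model, so it factors
  through the conifold algebra and preserves traces.\<close>

lemma Trep_specialization: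
  assumes "v \<in> Trep"
  shows "\<exists>h k c. inv_pair h k \<and> (\<forall>f. free_eval (\<lambda>c. c) (point_matrix v) f = h ** evm c (model f) ** k)"
proof -
  obtain e w where v: "v = chart (Lo e) (Lo (- e)) w" using Trep_chart[OF assms] by blast
  define h where "h = Lo e ** (Up (w 5) ** Lo (w 4))"
  define k where "k = Lo (- w 4) ** Up (- w 5) ** Lo (- e)"
  have hk: "inv_pair h k" unfolding h_def k_def by (intro inv_pair_mult) simp_all
  have v': "v = mkpt (h ** AD (w 0) (w 1) ** k) (h ** AD (w 2) (w 3) ** k) (h ** Dg ** k)"
    by (simp add: v chart_def Let_def h_def k_def)
  define c :: "complex ^ 4" where "c = vector [w 0, w 2, w 1, w 3]"
  have c: "c $ 1 = w 0" "c $ 2 = w 2" "c $ 3 = w 1" "c $ 4 = w 3" by (simp_all add: c_def vector_def)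
  have gen: "point_matrix v g = h ** evm c (Mg g) ** k" for g
    by (cases g) (simp_all add: v' evm_M2 c AD_def Dg_def)
  have "free_eval (\<lambda>c. c) (point_matrix v) f = h ** evm c (model f) ** k" for f
  proof (induction f rule: falg_induct)
    case (const a)
    show ?case by (simp add: evm_mat conj_mat[OF hk])
  next
    case (mult g f)
    then show ?case by (simp add: gen evm_mult conj_mult[OF hk])
  next
    case (add f g)
    then show ?case by (simp add: evm_add conj_add)
  qed
  then show ?thesis using hk by blast
qed

lemma Trep_subset_rep2: "Trep \<subseteq> zeros conifold_rep2"
proof
  fix v assume "v \<in> Trep"
  then obtain h k c where "\<And>f. free_eval (\<lambda>c. c) (point_matrix v) f = h ** evm c (model f) ** k"
    using Trep_specialization by metis
  then show "v \<in> zeros conifold_rep2"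
    unfolding zeros_conifold_rep2_iff by (auto simp: relation_ideal_eq_kernel) (simp add: evm_def zero_vec_def[symmetric])
qed

lemma order_trace_residue_class:
  "order_trace TYPE(2) (presented conifold_relations) (residue_class conifold_relations f)
    = residue_class conifold_relations (model_section (mat (trace (model f))))"
  using order_trace_conifold[OF graded_model, of f]
  by (simp add: conifold_algebra_def residue_class_eq_cl[of f] sc_def cl_def)

text \<open>In one direction the reduced trace of the class of \<open>fz\<close> is 0, which forces
  the trace of \<open>Z\<close> to vanish. In the other, \<open>Trep_specialization\<close> applies,
  since specialization and conjugation both respect the trace.\<close>

theorem zeros_conifold_trep2: "zeros conifold_trep2 = Trep"
proof -
  let ?tr = "order_trace TYPE(2) (presented conifold_relations)"
  let ?rc = "residue_class conifold_relations"
  have carr: "carrier (presented conifold_relations) = range ?rc" by (rule carrier_presented)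
  have iff: "v \<in> zeros conifold_trep2 \<longleftrightarrow> (\<exists>\<psi>\<in>algebra_maps conifold_relations.
       (\<forall>g. \<psi> (?rc (fvar g)) = point_matrix v g) \<and>
       (\<forall>a\<in>carrier (presented conifold_relations). \<psi> (?tr a) = mat (trace (\<psi> a))))" for v
    unfolding conifold_trep2_def
    by (rule zeros_trep_ideal) (auto simp: carr order_trace_residue_class)
  show ?thesis
  proof (intro equalityI subsetI)
    fix v assume "v \<in> zeros conifold_trep2"
    then obtain \<psi> where \<psi>: "\<psi> \<in> algebra_maps conifold_relations" "\<And>g. \<psi> (?rc (fvar g)) = point_matrix v g"
      "\<And>a. a \<in> carrier (presented conifold_relations) \<Longrightarrow> \<psi> (?tr a) = mat (trace (\<psi> a))"
      using iff by blast
    have ev: "\<psi> (?rc f) = free_eval (\<lambda>c. c) (point_matrix v) f" for f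
      by (rule algebra_map_eq_free_eval[OF \<psi>(1,2)])
    obtain XX Y Z where v: "v = mkpt XX Y Z" by (rule mkpt_cases)
    have "v \<in> zeros conifold_rep2"
      unfolding conifold_rep2_def zeros_rep_ideal using \<psi>(1,2) by blast
    then have rel: "con_rel XX Y Z" by (simp add: v zeros_conifold_rep2)
    have "\<psi> (?tr (?rc fz)) = mat (trace (\<psi> (?rc fz)))" by (rule \<psi>(3)) (simp add: carr)
    moreover have "?tr (?rc fz) = ?rc 0"
    proof -
      have "model_section (mat (trace (model fz))) = 0" by (simp add: model_section_def)
      then show ?thesis by (simp add: order_trace_residue_class)
    qed
    ultimately have "mat (trace Z) = (0 :: complex ^ 2 ^ 2)" by (simp add: ev v)
    then have "trace Z = 0" by (simp add: mat_M2 zero_M2)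
    then show "v \<in> Trep" using rel by (simp add: v Trep_iff con_rel_def)
  next
    fix v assume v: "v \<in> Trep"
    then obtain h k c where hk: "inv_pair h k"
      and ev: "\<And>f. free_eval (\<lambda>c. c) (point_matrix v) f = h ** evm c (model f) ** k"
      using Trep_specialization by metis
    have "\<forall>f\<in>I_con. free_eval (\<lambda>c. c) (point_matrix v) f = 0"
      using Trep_subset_rep2 v zeros_conifold_rep2_iff by blast
    then obtain \<psi> where \<psi>: "\<psi> \<in> algebra_maps conifold_relations" "\<And>g. \<psi> (?rc (fvar g)) = point_matrix v g"
      using algebra_map_iff by metis
    have ev': "\<psi> (?rc f) = h ** evm c (model f) ** k" for f
      using algebra_map_eq_free_eval[OF \<psi>] ev by simp
    have "\<psi> (?tr a) = mat (trace (\<psi> a))" if a': "a \<in> carrier (presented conifold_relations)" for a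
    proof -
      obtain f where a: "a = ?rc f" using a' carr by auto
      have "graded (mat (trace (model f)))"
        using graded_model[of f] by (cases "model f" rule: M2_cases) (simp add: graded_mat homog_add)
      then have "model (model_section (mat (trace (model f)))) = mat (trace (model f))" by (rule model_model_section)
      then show ?thesis
        unfolding a order_trace_residue_class ev' by (simp add: evm_mat conj_mat[OF hk] conj_trace[OF hk] trace_evm)
    qed
    then show "v \<in> zeros conifold_trep2" using iff \<psi> by blast
  qed
qed

lemma irreducible_Trep: "irreducible_closed Trep"
proof -
  have p: "pmap 7 (\<lambda>w. chart (Lo (w 6)) (Lo (- w 6)) w)"
    by (rule pmap_chart) (auto simp: Lo_def intro!: pmat_M2 pfun.intros pfun_uminus)
  have "zariski_closed Trep" by (simp only: zariski_closed_zeros flip: zeros_conifold_trep2)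
  then show ?thesis using irreducible_closed_range[OF p] by (simp flip: range_cover_chart)
qed

text \<open>The chart reaches every point whose \<open>Z\<close> has nonzero lower left entry, and
  irreducibility lets that coordinate be cancelled.\<close>

lemma Trep_chart_dense:
  assumes p: "\<And>w. meval p (chart (mat 1) (mat 1) w) = 0" and v: "v \<in> Trep"
  shows "meval p v = 0"
proof -
  have z: "meval (mvar (GZ, 2, 1)) z * meval p z = 0" if zT: "z \<in> Trep" for z
  proof (cases "z $ (GZ, 2, 1) = 0")
    case False
    obtain XX Y Z where z: "z = mkpt XX Y Z" by (rule mkpt_cases)
    then obtain w where "z = chart (mat 1) (mat 1) w" using chart_surj[of XX Y Z] zT False by auto
    then show ?thesis using p by simp
  qed simp
  define w :: "nat \<Rightarrow> complex" where "w i = (if i = 4 then 1 else 0)" for i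
  have "meval (mvar (GZ, 2, 1)) (chart (mat 1) (mat 1) w) \<noteq> 0"
    by (simp add: chart_def Let_def w_def Up_def Lo_def Dg_def)
  from irreducible_closed_mult_zero[OF irreducible_Trep z chart_Trep[OF inv_pair_1] this v]
  show ?thesis .
qed

section \<open>Dimension of the trace-zero component\<close>

lemma Trep_chain_le: "irreducible_chain Trep n C \<Longrightarrow> n \<le> 6"
proof (rule irreducible_chain_length_le)
  show "pmap 6 (chart (mat 1) (mat 1))"
    by (rule pmap_chart) (auto intro: pmat_const pfun.coord)
qed (rule Trep_chart_dense)

definition cmat :: "complex ^ 2 ^ 2 \<Rightarrow> (conifold_gen \<times> 2 \<times> 2) mpoly ^ 2 ^ 2" where
  "cmat A = (\<chi> i j. mconst (A $ i $ j))"

text \<open>Entries taken after a fixed base change are still polynomials in the coordinates. They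
  read off chart parameters and will separate the members of a chain.\<close>

lemma meval_conj_generic: "meval ((cmat k ** generic_matrix g ** cmat h) $ i $ j) v = (k ** point_matrix v g ** h) $ i $ j"
proof -
  have "(\<chi> i j. meval (cmat A $ i $ j) v) = A" for A by (simp add: cmat_def vec_eq_iff)
  moreover have "(\<chi> i j. meval (generic_matrix g $ i $ j) v) = point_matrix v g"
    by (simp add: vec_eq_iff generic_matrix_def point_matrix_def)
  moreover have "(\<chi> i j. meval ((cmat k ** generic_matrix g) $ i $ j) v)
     = (\<chi> i j. meval (cmat k $ i $ j) v) ** (\<chi> i j. meval (generic_matrix g $ i $ j) v)"
    unfolding vec_eq_iff by (simp add: meval_matrix_mult)
  ultimately show ?thesis by (simp add: meval_matrix_mult)
qed

text \<open>The values of \<open>w 4\<close> and \<open>w 5\<close> are absorbed into the base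
  change, so every point sits at the origin of the line parameters of some chart.\<close>

lemma Trep_centred:
  assumes "v \<in> Trep"
  shows "\<exists>h k w. inv_pair h k \<and> v = chart h k w \<and> w 4 = 0 \<and> w 5 = 0"
proof -
  obtain e w where v: "v = chart (Lo e) (Lo (- e)) w" using Trep_chart[OF assms] by blast
  define h where "h = Lo e ** (Up (w 5) ** Lo (w 4))"
  define k where "k = Lo (- w 4) ** Up (- w 5) ** Lo (- e)"
  have hk: "inv_pair h k" unfolding h_def k_def by (intro inv_pair_mult) simp_all
  have 0: "Lo 0 = mat 1" "Up 0 = mat 1" by (simp_all add: Lo_def Up_def mat_M2)
  have "v = chart h k (w(4 := 0, 5 := 0))"
    by (simp add: v chart_def Let_def 0 flip: h_def k_def)
  then show ?thesis using hk by (intro exI[of _ h] exI[of _ k] exI[of _ "w(4 := 0, 5 := 0)"]) simp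
qed

lemma Trep_chain:
  assumes "v \<in> Trep"
  shows "\<exists>C. irreducible_chain Trep 6 C \<and> v \<in> C 0"
proof -
  obtain h k w0 where hk: "inv_pair h k" and v: "v = chart h k w0" and w0: "w0 4 = 0" "w0 5 = 0"
    using Trep_centred[OF assms] by blast
  \<comment> \<open>The first \<open>n\<close> parameters are free and the others stay at those of
    \<open>v\<close>, which gives a flag of coordinate subspaces through \<open>v\<close>.\<close>
  define \<tau> where "\<tau> n w = (\<lambda>i. if i < n then w i else w0 i)" for n and w :: "nat \<Rightarrow> complex"
  define G where "G n w = chart h k (\<tau> n w)" for n w
  have 0: "Lo 0 = mat 1" "Up 0 = mat 1" by (simp_all add: Lo_def Up_def mat_M2)
  have kGh: "k ** point_matrix (chart h k w) GX ** h = Up (w 5) ** Lo (w 4) ** AD (w 0) (w 1) ** (Lo (- w 4) ** Up (- w 5))"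
    "k ** point_matrix (chart h k w) GY ** h = Up (w 5) ** Lo (w 4) ** AD (w 2) (w 3) ** (Lo (- w 4) ** Up (- w 5))"
    "k ** point_matrix (chart h k w) GZ ** h = Up (w 5) ** Lo (w 4) ** Dg ** (Lo (- w 4) ** Up (- w 5))" for w
  proof -
    have *: "k ** (h ** a ** b ** (c ** k)) ** h = a ** b ** c" for a b c
    proof -
      have "k ** (h ** a ** b ** (c ** k)) ** h = (k ** h) ** a ** b ** c ** (k ** h)" by (simp add: matrix_mul_assoc)
      then show ?thesis using hk by (simp add: inv_pair_def)
    qed
    show "k ** point_matrix (chart h k w) GX ** h = Up (w 5) ** Lo (w 4) ** AD (w 0) (w 1) ** (Lo (- w 4) ** Up (- w 5))"
      "k ** point_matrix (chart h k w) GY ** h = Up (w 5) ** Lo (w 4) ** AD (w 2) (w 3) ** (Lo (- w 4) ** Up (- w 5))"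
      "k ** point_matrix (chart h k w) GZ ** h = Up (w 5) ** Lo (w 4) ** Dg ** (Lo (- w 4) ** Up (- w 5))"
      unfolding chart_def Let_def point_matrix_mkpt by (rule *)+
  qed
  let ?q = "\<lambda>g i j. (cmat k ** generic_matrix g ** cmat h) $ i $ j"
  note eval = meval_conj_generic kGh G_def \<tau>_def w0 0 AD_def Dg_def
  have sep: "\<exists>p. (\<forall>w. meval p (G n w) = 0) \<and> (\<exists>w. meval p (G (Suc n) w) \<noteq> 0)" if n: "n < 6" for n
  proof -
    \<comment> \<open>While \<open>w 4\<close> and \<open>w 5\<close> are 0, the off-diagonal
      entries of the conjugated \<open>X\<close> and \<open>Y\<close> are the parameters themselves.
      The last two links are detected on the conjugated \<open>Z\<close>: its lower left entry is
      \<open>2 * w 4\<close>, and its upper right entry vanishes for \<open>w 5 = 0\<close>.\<close>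
    consider "n = 0" | "n = 1" | "n = 2" | "n = 3" | "n = 4" | "n = 5" using n by linarith
    then show ?thesis
    proof cases
      case 1
      then show ?thesis
        by (intro exI[of _ "?q GX 1 2 - mconst (w0 0)"] conjI exI[of _ "\<lambda>_. w0 0 + 1"]) (auto simp: eval)
    next
      case 2
      then show ?thesis
        by (intro exI[of _ "?q GX 2 1 - mconst (w0 1)"] conjI exI[of _ "\<lambda>_. w0 1 + 1"]) (auto simp: eval)
    next
      case 3
      then show ?thesis
        by (intro exI[of _ "?q GY 1 2 - mconst (w0 2)"] conjI exI[of _ "\<lambda>_. w0 2 + 1"]) (auto simp: eval)
    next
      case 4
      then show ?thesis
        by (intro exI[of _ "?q GY 2 1 - mconst (w0 3)"] conjI exI[of _ "\<lambda>_. w0 3 + 1"]) (auto simp: eval)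
    next
      case 5
      then show ?thesis
        by (intro exI[of _ "?q GZ 2 1"] conjI exI[of _ "\<lambda>_. 1"]) (auto simp: eval Lo_def)
    next
      case 6
      then show ?thesis
        by (intro exI[of _ "?q GZ 1 2"] conjI exI[of _ "\<lambda>i. if i = 5 then 1 else 0"])
          (auto simp: eval, auto simp: Lo_def Up_def)
    qed
  qed
  have "irreducible_chain Trep 6 (\<lambda>n. Zariski_closure (range (G n)))"
  proof (rule irreducible_chainI[where m=6])
    have "pfun 6 (\<lambda>w. \<tau> n w i)" if "i < 6" for n i
      using that by (cases "i < n") (simp_all add: \<tau>_def pfun.intros)
    then show "pmap 6 (G n)" for n
      unfolding G_def by (intro pmap_chart pmat_const)
    show "zariski_closed Trep" by (rule irreducible_closed_closed[OF irreducible_Trep])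
    show "G 6 w \<in> Trep" for w unfolding G_def by (rule chart_Trep[OF hk])
    show "range (G n) \<subseteq> range (G (Suc n))" for n
    proof
      fix x assume "x \<in> range (G n)"
      then obtain w where "x = G n w" by blast
      also have "G n w = G (Suc n) (\<tau> n w)" unfolding G_def by (rule arg_cong[of _ _ "chart h k"]) (auto simp: \<tau>_def)
      finally show "x \<in> range (G (Suc n))" by blast
    qed
  qed (rule sep)
  moreover have "v \<in> Zariski_closure (range (G 0))"
    by (rule subsetD[OF Zariski_closure_superset]) (auto simp: v G_def \<tau>_def)
  ultimately show ?thesis by (intro exI[of _ "\<lambda>n. Zariski_closure (range (G n))"] conjI)
qed

lemma variety_dim_Trep: "variety_dim Trep = 6"
proof -
  have "chart (mat 1) (mat 1) (\<lambda>_. 0) \<in> Trep" by (rule chart_Trep) simp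
  then have "\<exists>C. irreducible_chain Trep 6 C" using Trep_chain by blast
  then have "variety_dim Trep = enat 6"
    unfolding variety_dim_def using Trep_chain_le by (intro Sup_enat_eqI) auto
  then show ?thesis by (simp add: numeral_eq_enat)
qed

lemma local_dim_Trep: "v \<in> Trep \<Longrightarrow> local_dim Trep v = enat 6"
  unfolding local_dim_def using Trep_chain_le Trep_chain by (intro Sup_enat_eqI) blast+

section \<open>Components of the representation variety\<close>

abbreviation "rep_p \<equiv> mkpt 0 0 (mat 1)"
abbreviation "rep_q \<equiv> mkpt 0 0 (mat (- 1))"

lemma zeros_rep2_decomp: "zeros conifold_rep2 = Trep \<union> {rep_p} \<union> {rep_q}"
proof (intro equalityI subsetI)
  fix v assume v: "v \<in> zeros conifold_rep2"
  obtain XX Y Z where v': "v = mkpt XX Y Z" by (rule mkpt_cases)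
  have rel: "con_rel XX Y Z" using v by (simp add: v' zeros_conifold_rep2)
  show "v \<in> Trep \<union> {rep_p} \<union> {rep_q}"
  proof (cases "trace Z = 0")
    case True
    then show ?thesis using rel by (simp add: v' Trep_iff con_rel_def)
  next
    case False
    obtain p q r s where Z: "Z = M2 p q r s" by (rule M2_cases)
    have ps: "p + s \<noteq> 0" using False by (simp add: Z)
    have Z2: "p * p + q * r = 1" "p * q + q * s = 0" "r * p + s * r = 0" "r * q + s * s = 1"
      using rel by (simp_all add: con_rel_def Z mat_M2)
    \<comment> \<open>An involution with nonzero trace is scalar: the trace \<open>p + s\<close>
      divides out of the off-diagonal equations and of the difference of the diagonal ones.\<close>
    have "q * (p + s) = 0" "r * (p + s) = 0" using Z2(2,3) by (simp_all add: algebra_simps)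
    then have qr: "q = 0" "r = 0" using ps by simp_all
    have "(p - s) * (p + s) = 0" using Z2(1,4) qr by (simp add: algebra_simps)
    then have "s = p" using ps by simp
    then have Zp: "Z = mat p" by (simp add: Z qr mat_M2)
    have "(p - 1) * (p + 1) = 0" using Z2(1) qr by (simp add: algebra_simps)
    then have p: "p = 1 \<or> p = - 1" by (auto simp: add_eq_0_iff2)
    have anti: "A = 0" if "A ** Z + Z ** A = 0" for A
      using that p by (cases A rule: M2_cases) (auto simp: Zp mat_M2 zero_M2)
    have "XX = 0" "Y = 0" using rel unfolding con_rel_def by (blast intro: anti)+
    then show ?thesis using p by (auto simp: v' Zp)
  qed
next
  fix v assume "v \<in> Trep \<union> {rep_p} \<union> {rep_q}"
  then consider "v \<in> Trep" | "v = rep_p" | "v = rep_q" by blast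
  then show "v \<in> zeros conifold_rep2"
  proof cases
    case 1
    then show ?thesis using Trep_subset_rep2 by blast
  qed (simp_all add: zeros_conifold_rep2 con_rel_def mat_mult_mat)
qed

lemma rep_pq_notin: "rep_p \<notin> Trep" "rep_q \<notin> Trep" "rep_p \<noteq> rep_q"
  by (simp_all add: Trep_iff mat_M2)

lemma zariski_closed_singleton: "zariski_closed {p}"
  by (rule irreducible_closed_closed[OF irreducible_closed_singleton])

lemma irreducible_components_rep2:
  "irreducible_components (zeros conifold_rep2) = {Trep, {rep_p}, {rep_q}}"
  unfolding zeros_rep2_decomp
  by (rule irreducible_components_three)
    (use rep_pq_notin in \<open>auto simp: irreducible_Trep irreducible_closed_singleton\<close>)

lemma local_dim_rep2_Trep:
  assumes v: "v \<in> Trep"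
  shows "local_dim (zeros conifold_rep2) v = enat 6"
proof -
  have eq: "zeros conifold_rep2 = Trep \<union> ({rep_p} \<union> {rep_q})" by (simp add: zeros_rep2_decomp Un_assoc)
  have nin: "v \<notin> {rep_p} \<union> {rep_q}" using v rep_pq_notin by auto
  have cl: "zariski_closed ({rep_p} \<union> {rep_q})"
    by (intro zariski_closed_Un zariski_closed_singleton)
  note T = irreducible_closed_closed[OF irreducible_Trep]
  show ?thesis unfolding local_dim_def
  proof (rule Sup_enat_eqI)
    fix n assume "\<exists>C. irreducible_chain (zeros conifold_rep2) n C \<and> v \<in> C 0"
    then obtain C where "irreducible_chain (Trep \<union> ({rep_p} \<union> {rep_q})) n C" "v \<in> C 0" unfolding eq by blast
    then show "n \<le> 6" using irreducible_chain_in_component[OF _ _ nin T cl] Trep_chain_le by blast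
  next
    obtain C where "irreducible_chain Trep 6 C" "v \<in> C 0" using Trep_chain[OF v] by blast
    then show "\<exists>C. irreducible_chain (zeros conifold_rep2) 6 C \<and> v \<in> C 0"
      using irreducible_chain_superset[OF _ Trep_subset_rep2] by blast
  qed
qed

lemma local_dim_isolated:
  assumes V: "V = {p} \<union> B" and B: "zariski_closed B" and p: "p \<notin> B"
  shows "local_dim V p = enat 0"
  unfolding local_dim_def
proof (rule Sup_enat_eqI)
  fix n assume "\<exists>C. irreducible_chain V n C \<and> p \<in> C 0"
  then obtain C where "irreducible_chain ({p} \<union> B) n C" "p \<in> C 0" unfolding V by blast
  then have "irreducible_chain {p} n C"
    by (rule irreducible_chain_in_component) (rule p zariski_closed_singleton B)+
  then show "n \<le> 0" using irreducible_chain_singleton by auto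
next
  have "irreducible_chain V 0 (\<lambda>_. {p})" by (rule irreducible_chain_point) (simp add: V)
  then show "\<exists>C. irreducible_chain V 0 C \<and> p \<in> C 0" by (intro exI[of _ "\<lambda>_. {p}"]) simp
qed

section \<open>Tangent spaces\<close>

definition dirm :: "('v::finite) mpoly ^ 2 ^ 2 \<Rightarrow> complex ^ 'v \<Rightarrow> complex ^ 'v \<Rightarrow> complex ^ 2 ^ 2" where
  "dirm A v \<xi> = (\<chi> i j. dir_deriv (A $ i $ j) v \<xi>)"

definition evmat :: "('v::finite) mpoly ^ 2 ^ 2 \<Rightarrow> complex ^ 'v \<Rightarrow> complex ^ 2 ^ 2" where
  "evmat A v = (\<chi> i j. meval (A $ i $ j) v)"

lemma dirm_simps:
  "dirm (A + B) v \<xi> = dirm A v \<xi> + dirm B v \<xi>" "dirm (A - B) v \<xi> = dirm A v \<xi> - dirm B v \<xi>"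
  "dirm (A ** B) v \<xi> = dirm A v \<xi> ** evmat B v + evmat A v ** dirm B v \<xi>" "dirm (mat 1) v \<xi> = 0"
  by (simp_all add: dirm_def evmat_def mat2_eq_iff matrix_matrix_mult_def sum_2 mat_nth algebra_simps)

lemma dirm_generic: "dirm (generic_matrix g) v \<xi> = point_matrix \<xi> g" "evmat (generic_matrix g) v = point_matrix v g"
  by (simp_all add: dirm_def evmat_def generic_matrix_def point_matrix_def)

lemma generic_eval_diff: "generic_eval (f - g) = generic_eval f - generic_eval g"
  using mconst_map.free_eval_add[of _ f "- g"] by simp

lemma generic_eval_1: "generic_eval 1 = mat 1"
  using mconst_map.free_eval_fconst[of _ 1] by simp

text \<open>The first three relations differentiated in the direction \<open>(A, B, C)\<close>; on
  the large component they already cut the tangent space down to its final size.\<close>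

definition con_lin :: "complex ^ (conifold_gen \<times> 2 \<times> 2) \<Rightarrow> complex ^ (conifold_gen \<times> 2 \<times> 2) \<Rightarrow> bool" where
  "con_lin v \<xi> \<longleftrightarrow> (let XX = point_matrix v GX; Y = point_matrix v GY; Z = point_matrix v GZ;
       A = point_matrix \<xi> GX; B = point_matrix \<xi> GY; C = point_matrix \<xi> GZ in
     C ** Z + Z ** C = 0 \<and> (A ** Z + XX ** C) + (C ** XX + Z ** A) = 0 \<and> (B ** Z + Y ** C) + (C ** Y + Z ** B) = 0)"

text \<open>Stated for any \<open>J\<close> containing the entries of the relations, so that one
  upper bound covers both representation ideals.\<close>

lemma tangent_con_lin:
  assumes J: "\<And>f i j. f \<in> I_con \<Longrightarrow> generic_eval f $ i $ j \<in> J" and \<xi>: "\<xi> \<in> tangent_space J v"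
  shows "con_lin v \<xi>"
proof -
  have d: "dirm (generic_eval f) v \<xi> = 0" if "f \<in> conifold_relations" for f
    using \<xi> J[OF relation_ideal_base[OF that]]
    by (simp add: dirm_def mat2_eq_iff tangent_space_dir_deriv)
  have r: "fz * fz - 1 \<in> conifold_relations" "fx * fz + fz * fx \<in> conifold_relations" "fy * fz + fz * fy \<in> conifold_relations"
    by (simp_all add: conifold_relations_def Let_def power2_eq_square)
  show ?thesis
    using d[OF r(1)] d[OF r(2)] d[OF r(3)]
    by (simp add: con_lin_def Let_def generic_eval_diff generic_eval_1 dirm_simps dirm_generic)
qed

text \<open>The velocity at the centre of a chart. Moving the eigenlines is an infinitesimal
  conjugation, visible in the commutators with \<open>N\<close>; the other four directions move the
  entries of \<open>X\<close> and \<open>Y\<close>. The index type has six elements, one for each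
  direction.\<close>

definition vel :: "complex ^ 2 ^ 2 \<Rightarrow> complex ^ 2 ^ 2 \<Rightarrow> (nat \<Rightarrow> complex) \<Rightarrow>
    complex ^ (conifold_gen \<times> 2) \<Rightarrow> complex ^ (conifold_gen \<times> 2 \<times> 2)" where
  "vel h k w u = (let N = AD (u $ (GZ, 1)) (u $ (GZ, 2)) in
     mkpt (h ** (N ** AD (w 0) (w 1) - AD (w 0) (w 1) ** N + AD (u $ (GX, 1)) (u $ (GX, 2))) ** k)
       (h ** (N ** AD (w 2) (w 3) - AD (w 2) (w 3) ** N + AD (u $ (GY, 1)) (u $ (GY, 2))) ** k)
       (h ** (N ** Dg - Dg ** N) ** k))"

lemma vel_eq: "vel h k w u = mkpt
   (h ** M2 (u $ (GZ, 1) * w 1 - w 0 * u $ (GZ, 2)) (u $ (GX, 1)) (u $ (GX, 2)) (u $ (GZ, 2) * w 0 - w 1 * u $ (GZ, 1)) ** k)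
   (h ** M2 (u $ (GZ, 1) * w 3 - w 2 * u $ (GZ, 2)) (u $ (GY, 1)) (u $ (GY, 2)) (u $ (GZ, 2) * w 2 - w 3 * u $ (GZ, 1)) ** k)
   (h ** M2 0 (- 2 * u $ (GZ, 1)) (2 * u $ (GZ, 2)) 0 ** k)"
  by (simp add: vel_def Let_def AD_def Dg_def)

lemma has_derivative_conj:
  fixes h k :: "complex ^ 2 ^ 2"
  assumes "\<And>i j. ((\<lambda>s. F s $ i $ j) has_field_derivative F' $ i $ j) (at 0)"
  shows "((\<lambda>s. (h ** F s ** k) $ i $ j) has_field_derivative (h ** F' ** k) $ i $ j) (at 0)"
  unfolding matrix_matrix_mult_def vec_lambda_beta
  by (intro DERIV_sum DERIV_cmult_right DERIV_cmult assms)

text \<open>The curve stays in \<open>Trep\<close>, so its velocity is tangent to every ideal that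
  vanishes there, whatever the scheme structure.\<close>

lemma vel_tangent:
  assumes hk: "inv_pair h k" and J: "Trep \<subseteq> zeros J" and w: "w 4 = 0" "w 5 = 0"
  shows "vel h k w u \<in> tangent_space J (chart h k w)"
proof -
  \<comment> \<open>The chart lists the lower triangular parameter before the upper one, while
    \<open>vel\<close> lists the upper entry of \<open>N\<close> first; hence the order of the last
    two items.\<close>
  define u' :: "nat \<Rightarrow> complex" where
    "u' i = [u $ (GX, 1), u $ (GX, 2), u $ (GY, 1), u $ (GY, 2), u $ (GZ, 2), u $ (GZ, 1)] ! i" for i
  define \<gamma> where "\<gamma> s = chart h k (\<lambda>i. w i + s * u' i)" for s
  define F where "F s B = Up (s * u' 5) ** Lo (s * u' 4) ** B ** (Lo (- (s * u' 4)) ** Up (- (s * u' 5)))" for s B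
  have u': "u' 0 = u $ (GX, 1)" "u' (Suc 0) = u $ (GX, 2)" "u' 2 = u $ (GY, 1)" "u' 3 = u $ (GY, 2)"
    "u' 4 = u $ (GZ, 2)" "u' 5 = u $ (GZ, 1)" by (simp_all add: u'_def)
  have \<gamma>: "\<gamma> s = mkpt (h ** F s (AD (w 0 + s * u' 0) (w 1 + s * u' 1)) ** k)
      (h ** F s (AD (w 2 + s * u' 2) (w 3 + s * u' 3)) ** k) (h ** F s Dg ** k)" for s
    by (simp add: \<gamma>_def chart_def Let_def F_def w matrix_mul_assoc)
  have dAD: "((\<lambda>s. F s (AD (a + s * a') (b + s * b')) $ i $ j) has_field_derivative
      (M2 (u' 5 * b - a * u' 4) a' b' (u' 4 * a - b * u' 5)) $ i $ j) (at 0)" for a a' b b' and i j :: 2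
    using exhaust_2[of i] exhaust_2[of j] unfolding F_def Up_def Lo_def AD_def M2_mult
    by (elim disjE; simp) (auto intro!: derivative_eq_intros)
  have dDg: "((\<lambda>s. F s Dg $ i $ j) has_field_derivative
      (M2 0 (- 2 * u' 5) (2 * u' 4) 0) $ i $ j) (at 0)" for i j :: 2
    using exhaust_2[of i] exhaust_2[of j] unfolding F_def Up_def Lo_def Dg_def M2_mult
    by (elim disjE; simp) (auto intro!: derivative_eq_intros)
  have deriv: "((\<lambda>s. \<gamma> s $ l) has_field_derivative vel h k w u $ l) (at 0)" for l
  proof -
    obtain g i j where l: "l = (g, i, j)" by (cases l)
    have "((\<lambda>s. (h ** F s (AD (w 0 + s * u' 0) (w 1 + s * u' 1)) ** k) $ i $ j) has_field_derivative
        (h ** M2 (u' 5 * w 1 - w 0 * u' 4) (u' 0) (u' 1) (u' 4 * w 0 - w 1 * u' 5) ** k) $ i $ j) (at 0)"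
      "((\<lambda>s. (h ** F s (AD (w 2 + s * u' 2) (w 3 + s * u' 3)) ** k) $ i $ j) has_field_derivative
        (h ** M2 (u' 5 * w 3 - w 2 * u' 4) (u' 2) (u' 3) (u' 4 * w 2 - w 3 * u' 5) ** k) $ i $ j) (at 0)"
      "((\<lambda>s. (h ** F s Dg ** k) $ i $ j) has_field_derivative
        (h ** M2 0 (- 2 * u' 5) (2 * u' 4) 0 ** k) $ i $ j) (at 0)"
      by (intro has_derivative_conj dAD dDg)+
    then show ?thesis unfolding l \<gamma> vel_eq
      by (cases g) (simp_all add: u')
  qed
  have "meval p (\<gamma> s) = 0" if "p \<in> J" for p s
    using chart_Trep[OF hk, of "\<lambda>i. w i + s * u' i"] J that unfolding \<gamma>_def zeros_def by blast
  moreover have "\<gamma> 0 = chart h k w" by (simp add: \<gamma>_def)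
  ultimately show ?thesis
    unfolding tangent_space_dir_deriv using dir_deriv_curve[of \<gamma>, OF deriv] by blast
qed

lemma conj_inj:
  assumes "inv_pair h k" "h ** A ** k = h ** B ** k" shows "A = B"
  using assms conj_cancel[OF inv_pair_sym[OF assms(1)]] by metis

text \<open>At the centre of the chart \<open>C\<close> must be antidiagonal, which determines
  \<open>N\<close>. The mixed terms then force the diagonals of \<open>A\<close> and
  \<open>B\<close>, whose off-diagonal entries stay free.\<close>

lemma con_lin_vel:
  assumes hk: "inv_pair h k" and w: "w 4 = 0" "w 5 = 0" and lin: "con_lin (chart h k w) \<xi>"
  shows "\<xi> \<in> range (vel h k w)"
proof -
  have 0: "Lo 0 = mat 1" "Up 0 = mat 1" by (simp_all add: Lo_def Up_def mat_M2)
  have v: "chart h k w = mkpt (h ** AD (w 0) (w 1) ** k) (h ** AD (w 2) (w 3) ** k) (h ** Dg ** k)"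
    by (simp add: chart_def Let_def w 0)
  obtain A0 B0 C0 where \<xi>0: "\<xi> = mkpt A0 B0 C0" by (rule mkpt_cases)
  define A where "A = k ** A0 ** h"
  define B where "B = k ** B0 ** h"
  define C where "C = k ** C0 ** h"
  have \<xi>: "\<xi> = mkpt (h ** A ** k) (h ** B ** k) (h ** C ** k)"
    unfolding \<xi>0 A_def B_def C_def conj_cancel[OF hk] ..
  have z: "h ** M ** k = 0 \<Longrightarrow> M = 0" for M using conj_inj[OF hk, of M 0] by simp
  have C: "C ** Dg + Dg ** C = 0"
    and A: "(A ** Dg + AD (w 0) (w 1) ** C) + (C ** AD (w 0) (w 1) + Dg ** A) = 0"
    and B: "(B ** Dg + AD (w 2) (w 3) ** C) + (C ** AD (w 2) (w 3) + Dg ** B) = 0"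
    using lin unfolding con_lin_def Let_def v \<xi> point_matrix_mkpt conj_mult[OF hk] conj_add
    by (auto intro: z)
  obtain a1 a2 a3 a4 where MA: "A = M2 a1 a2 a3 a4" by (rule M2_cases)
  obtain b1 b2 b3 b4 where MB: "B = M2 b1 b2 b3 b4" by (rule M2_cases)
  obtain c1 c2 c3 c4 where MC: "C = M2 c1 c2 c3 c4" by (rule M2_cases)
  have c: "c1 = 0" "c4 = 0" using C by (simp_all add: MC Dg_def zero_M2)
  have a: "a1 = - c2 / 2 * w 1 - w 0 * (c3 / 2)" "a4 = c3 / 2 * w 0 - w 1 * (- c2 / 2)"
  proof -
    have "a1 + w 0 * c3 + (c2 * w 1 + a1) = 0" "w 1 * c2 - a4 + (c3 * w 0 - a4) = 0"
      using A by (simp_all add: MA MC c Dg_def AD_def zero_M2)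
    moreover have "a1 * 2 = (a1 + w 0 * c3 + (c2 * w 1 + a1)) - (w 0 * c3 + c2 * w 1)"
      "a4 * 2 = (w 1 * c2 + c3 * w 0) - (w 1 * c2 - a4 + (c3 * w 0 - a4))" by simp_all
    ultimately have "a1 * 2 = - (w 0 * c3 + c2 * w 1)" "a4 * 2 = w 1 * c2 + c3 * w 0"
      by (simp_all only: diff_0 diff_0_right)
    then show "a1 = - c2 / 2 * w 1 - w 0 * (c3 / 2)" "a4 = c3 / 2 * w 0 - w 1 * (- c2 / 2)"
      by (simp_all add: field_simps eq_neg_iff_add_eq_0)
  qed
  have b: "b1 = - c2 / 2 * w 3 - w 2 * (c3 / 2)" "b4 = c3 / 2 * w 2 - w 3 * (- c2 / 2)"
  proof -
    have "b1 + w 2 * c3 + (c2 * w 3 + b1) = 0" "w 3 * c2 - b4 + (c3 * w 2 - b4) = 0"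
      using B by (simp_all add: MB MC c Dg_def AD_def zero_M2)
    moreover have "b1 * 2 = (b1 + w 2 * c3 + (c2 * w 3 + b1)) - (w 2 * c3 + c2 * w 3)"
      "b4 * 2 = (w 3 * c2 + c3 * w 2) - (w 3 * c2 - b4 + (c3 * w 2 - b4))" by simp_all
    ultimately have "b1 * 2 = - (w 2 * c3 + c2 * w 3)" "b4 * 2 = w 3 * c2 + c3 * w 2"
      by (simp_all only: diff_0 diff_0_right)
    then show "b1 = - c2 / 2 * w 3 - w 2 * (c3 / 2)" "b4 = c3 / 2 * w 2 - w 3 * (- c2 / 2)"
      by (simp_all add: field_simps eq_neg_iff_add_eq_0)
  qed
  \<comment> \<open>The halves compensate for \<open>N ** Dg - Dg ** N\<close>, which doubles the
    entries of \<open>N\<close> and changes the sign of the upper one.\<close>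
  define u :: "complex ^ (conifold_gen \<times> 2)" where "u = (\<chi> l. case fst l of
      GX \<Rightarrow> (if snd l = 1 then a2 else a3) | GY \<Rightarrow> (if snd l = 1 then b2 else b3) | GZ \<Rightarrow> (if snd l = 1 then - c2 / 2 else c3 / 2))"
  have "vel h k w u = \<xi>"
    unfolding vel_eq \<xi> by (simp add: u_def MA MB MC a b c)
  then show ?thesis by (metis rangeI)
qed

lemma linear_vel: "Vector_Spaces.linear (*s) (*s) (vel h k w)"
proof unfold_locales
  obtain h1 h2 h3 h4 where h: "h = M2 h1 h2 h3 h4" by (rule M2_cases)
  obtain k1 k2 k3 k4 where k: "k = M2 k1 k2 k3 k4" by (rule M2_cases)
  show "vel h k w (u + u') = vel h k w u + vel h k w u'" for u u'
  proof (rule vec_eq_iff[THEN iffD2], rule allI)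
    fix l :: "conifold_gen \<times> 2 \<times> 2"
    obtain g i j where l: "l = (g, i, j)" by (cases l)
    show "vel h k w (u + u') $ l = (vel h k w u + vel h k w u') $ l"
      using exhaust_2[of i] exhaust_2[of j] unfolding vel_eq h k l
      by (cases g) (auto simp: algebra_simps)
  qed
  show "vel h k w (c *s u) = c *s vel h k w u" for c u
  proof (rule vec_eq_iff[THEN iffD2], rule allI)
    fix l :: "conifold_gen \<times> 2 \<times> 2"
    obtain g i j where l: "l = (g, i, j)" by (cases l)
    show "vel h k w (c *s u) $ l = (c *s vel h k w u) $ l"
      using exhaust_2[of i] exhaust_2[of j] unfolding vel_eq h k l
      by (cases g) (auto simp: algebra_simps)
  qed
qed

lemma inj_vel:
  assumes hk: "inv_pair h k" shows "inj (vel h k w)"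
proof (rule injI)
  fix u u' assume "vel h k w u = vel h k w u'"
  then have eq: "h ** M2 (u $ (GZ, 1) * w 1 - w 0 * u $ (GZ, 2)) (u $ (GX, 1)) (u $ (GX, 2)) (u $ (GZ, 2) * w 0 - w 1 * u $ (GZ, 1)) ** k
      = h ** M2 (u' $ (GZ, 1) * w 1 - w 0 * u' $ (GZ, 2)) (u' $ (GX, 1)) (u' $ (GX, 2)) (u' $ (GZ, 2) * w 0 - w 1 * u' $ (GZ, 1)) ** k"
    "h ** M2 (u $ (GZ, 1) * w 3 - w 2 * u $ (GZ, 2)) (u $ (GY, 1)) (u $ (GY, 2)) (u $ (GZ, 2) * w 2 - w 3 * u $ (GZ, 1)) ** k
      = h ** M2 (u' $ (GZ, 1) * w 3 - w 2 * u' $ (GZ, 2)) (u' $ (GY, 1)) (u' $ (GY, 2)) (u' $ (GZ, 2) * w 2 - w 3 * u' $ (GZ, 1)) ** k"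
    "h ** M2 0 (- 2 * u $ (GZ, 1)) (2 * u $ (GZ, 2)) 0 ** k = h ** M2 0 (- 2 * u' $ (GZ, 1)) (2 * u' $ (GZ, 2)) 0 ** k"
    unfolding vel_eq mkpt_eq_iff by blast+
  have e: "u $ (GX, 1) = u' $ (GX, 1)" "u $ (GX, 2) = u' $ (GX, 2)" "u $ (GY, 1) = u' $ (GY, 1)"
    "u $ (GY, 2) = u' $ (GY, 2)" "u $ (GZ, 1) = u' $ (GZ, 1)" "u $ (GZ, 2) = u' $ (GZ, 2)"
    using conj_inj[OF hk eq(1)] conj_inj[OF hk eq(2)] conj_inj[OF hk eq(3)] by simp_all
  show "u = u'"
  proof (rule vec_eq_iff[THEN iffD2], rule allI)
    fix l :: "conifold_gen \<times> 2"
    obtain g i where l: "l = (g, i)" by (cases l)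
    show "u $ l = u' $ l" using exhaust_2[of i] e unfolding l by (cases g) auto
  qed
qed

lemma card_conifold_gen: "CARD(conifold_gen) = 3"
proof -
  have "(UNIV :: conifold_gen set) = {GX, GY, GZ}" using conifold_gen.exhaust by auto
  moreover have "card {GX, GY, GZ} = 3" by simp
  ultimately show ?thesis by (simp only:)
qed

text \<open>Velocities give one inclusion and the linearized relations the other; \<open>vel\<close>
  is linear and injective on a six-dimensional space.\<close>

lemma dim_tangent_Trep:
  assumes gen: "\<And>f i j. f \<in> I_con \<Longrightarrow> generic_eval f $ i $ j \<in> J" and J: "Trep \<subseteq> zeros J" and v: "v \<in> Trep"
  shows "vec.dim (tangent_space J v) = 6"
proof -
  obtain h k w where hk: "inv_pair h k" and v': "v = chart h k w" and w: "w 4 = 0" "w 5 = 0"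
    using Trep_centred[OF v] by blast
  have "tangent_space J v = range (vel h k w)"
  proof (intro equalityI subsetI)
    fix \<xi> assume "\<xi> \<in> tangent_space J v"
    then have "con_lin v \<xi>" using tangent_con_lin[OF gen] by blast
    then show "\<xi> \<in> range (vel h k w)" unfolding v' by (rule con_lin_vel[where \<xi>=\<xi>, OF hk w])
  next
    fix \<xi> assume "\<xi> \<in> range (vel h k w)"
    then obtain u where "\<xi> = vel h k w u" by blast
    then show "\<xi> \<in> tangent_space J v" using vel_tangent[OF hk J w] v' by simp
  qed
  moreover have "vec.dim (range (vel h k w)) = vec.dim (UNIV :: (complex ^ (conifold_gen \<times> 2)) set)"
    by (rule vec.dim_image_eq[OF linear_vel]) (rule inj_on_subset[OF inj_vel[OF hk] subset_UNIV])
  moreover have "vec.dim (UNIV :: (complex ^ (conifold_gen \<times> 2)) set) = 6"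
    by (simp add: vec.dim_UNIV card_cart_basis card_conifold_gen)
  ultimately show ?thesis by simp
qed

lemma mpoly_genideal_self: "F \<subseteq> genideal ring_of_type_algebra (F :: 'v mpoly set)"
proof -
  interpret R: cring "ring_of_type_algebra :: 'v mpoly ring" by (rule cring_from_type_algebra)
  show ?thesis by (rule R.genideal_self) (simp add: type_ring_simps)
qed

lemma generic_rep: "f \<in> I_con \<Longrightarrow> generic_eval f $ i $ j \<in> conifold_rep2"
  unfolding conifold_rep2_def rep_ideal_def by (rule subsetD[OF mpoly_genideal_self]) blast

lemma generic_trep: "f \<in> I_con \<Longrightarrow> generic_eval f $ i $ j \<in> conifold_trep2"
  unfolding conifold_trep2_def trep_ideal_def by (rule subsetD[OF mpoly_genideal_self]) blast

text \<open>Where \<open>X\<close> and \<open>Y\<close> vanish and \<open>Z\<close> is a nonzero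
  scalar, the linearized relations make each direction matrix anticommute with that scalar.\<close>

lemma tangent_isolated:
  assumes "c \<noteq> 0"
  shows "vec.dim (tangent_space conifold_rep2 (mkpt 0 0 (mat c))) = 0"
proof -
  have "\<xi> = 0" if t: "\<xi> \<in> tangent_space conifold_rep2 (mkpt 0 0 (mat c))" for \<xi>
  proof -
    have lin: "con_lin (mkpt 0 0 (mat c)) \<xi>" using tangent_con_lin[OF generic_rep t] .
    obtain A B C where \<xi>: "\<xi> = mkpt A B C" by (rule mkpt_cases)
    have z: "M = 0" if "M ** mat c + mat c ** M = 0" for M :: "complex ^ 2 ^ 2"
      using that assms by (cases M rule: M2_cases) (simp add: mat_M2 zero_M2)
    have "A = 0" "B = 0" "C = 0" using lin unfolding con_lin_def Let_def \<xi> point_matrix_mkpt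
      by (auto intro: z)
    moreover have "mkpt 0 0 0 = 0" by (simp add: mkpt_def vec_eq_iff split: conifold_gen.split)
    ultimately show ?thesis by (simp add: \<xi>)
  qed
  then show ?thesis unfolding vec.dim_eq_0 by blast
qed

theorem smooth_rep2: "smooth_scheme conifold_rep2"
  unfolding smooth_scheme_def smooth_at_def
proof
  fix v assume "v \<in> zeros conifold_rep2"
  then consider "v \<in> Trep" | "v = rep_p" | "v = rep_q" unfolding zeros_rep2_decomp by blast
  then show "enat (vec.dim (tangent_space conifold_rep2 v)) = local_dim (zeros conifold_rep2) v"
  proof cases
    case 1
    then show ?thesis
      using dim_tangent_Trep[OF generic_rep Trep_subset_rep2] local_dim_rep2_Trep by simp
  next
    case 2
    have "local_dim (zeros conifold_rep2) rep_p = enat 0"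
    proof (rule local_dim_isolated)
      show "zeros conifold_rep2 = {rep_p} \<union> (Trep \<union> {rep_q})" unfolding zeros_rep2_decomp by blast
      show "zariski_closed (Trep \<union> {rep_q})"
        by (intro zariski_closed_Un zariski_closed_singleton irreducible_closed_closed[OF irreducible_Trep])
    qed (use rep_pq_notin in auto)
    then show ?thesis using tangent_isolated[of 1] by (simp add: 2)
  next
    case 3
    have "local_dim (zeros conifold_rep2) rep_q = enat 0"
    proof (rule local_dim_isolated)
      show "zeros conifold_rep2 = {rep_q} \<union> (Trep \<union> {rep_p})" unfolding zeros_rep2_decomp by blast
      show "zariski_closed (Trep \<union> {rep_p})"
        by (intro zariski_closed_Un zariski_closed_singleton irreducible_closed_closed[OF irreducible_Trep])
    qed (use rep_pq_notin in auto)
    then show ?thesis using tangent_isolated[of "- 1"] by (simp add: 3)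
  qed
qed

theorem smooth_trep2: "smooth_scheme conifold_trep2"
  unfolding smooth_scheme_def smooth_at_def
proof
  fix v assume "v \<in> zeros conifold_trep2"
  then have v: "v \<in> Trep" by (simp add: zeros_conifold_trep2)
  show "enat (vec.dim (tangent_space conifold_trep2 v)) = local_dim (zeros conifold_trep2) v"
    using dim_tangent_Trep[OF generic_trep _ v] local_dim_Trep[OF v] by (simp add: zeros_conifold_trep2)
qed

theorem smooth_order_conifold: "smooth_order TYPE(2) conifold_relations"
  unfolding smooth_order_def
  using is_order_conifold smooth_trep2 by (simp add: conifold_algebra_def conifold_trep2_def)

section \<open>The singular point of the cone\<close>

definition cone_points :: "(complex ^ 4) set" where
  "cone_points = {v. v $ 1 * v $ 2 = v $ 3 * v $ 4}"

lemma zeros_cone_ideal: "zeros cone_ideal = cone_points"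
  unfolding cone_ideal_def zeros_genideal by (auto simp: zeros_def cone_points_def)

definition cone_form :: "complex ^ 4 \<Rightarrow> complex ^ 4 \<Rightarrow> complex" where
  "cone_form v \<xi> = \<xi> $ 1 * v $ 2 + v $ 1 * \<xi> $ 2 - (\<xi> $ 3 * v $ 4 + v $ 3 * \<xi> $ 4)"

text \<open>Polynomials vanishing at \<open>v\<close> and to first order along \<open>\<xi>\<close>
  form an ideal, so the single generator decides tangency. Vanishing at \<open>v\<close> is what
  makes this set closed under multiplication.\<close>

lemma tangent_cone:
  assumes "v \<in> cone_points"
  shows "tangent_space cone_ideal v = {\<xi>. cone_form v \<xi> = 0}"
proof (intro equalityI subsetI)
  fix \<xi> assume "\<xi> \<in> tangent_space cone_ideal v"
  then have "dir_deriv (mvar 1 * mvar 2 - mvar 3 * mvar 4) v \<xi> = 0"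
    using cone_generator unfolding tangent_space_dir_deriv by blast
  then show "\<xi> \<in> {\<xi>. cone_form v \<xi> = 0}" by (simp add: cone_form_def)
next
  fix \<xi> assume \<xi>: "\<xi> \<in> {\<xi>. cone_form v \<xi> = 0}"
  interpret R: cring "ring_of_type_algebra :: 4 mpoly ring" by (rule cring_from_type_algebra)
  let ?J = "{p. meval p v = 0 \<and> dir_deriv p v \<xi> = 0}"
  have "ideal ?J ring_of_type_algebra" by (rule type_idealI) auto
  moreover have "{mvar 1 * mvar 2 - mvar 3 * mvar 4} \<subseteq> ?J"
    using \<xi> assms by (simp add: cone_form_def cone_points_def)
  ultimately have "cone_ideal \<subseteq> ?J" unfolding cone_ideal_def by (rule R.genideal_minimal)
  then show "\<xi> \<in> tangent_space cone_ideal v" unfolding tangent_space_dir_deriv by blast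
qed

lemma cone_form_linear: "cone_form v (x + y) = cone_form v x + cone_form v y"
    "cone_form v (c *s x) = c * cone_form v x"
  by (simp_all add: cone_form_def algebra_simps)

text \<open>The tangent space is the kernel of a nonzero linear form on four-space, and any
  \<open>e\<close> outside it spans a complement.\<close>

lemma dim_tangent_cone:
  assumes v: "v \<in> cone_points" "v \<noteq> 0"
  shows "vec.dim (tangent_space cone_ideal v) = 3"
proof -
  let ?S = "{\<xi>. cone_form v \<xi> = 0}"
  have f0: "cone_form v 0 = 0" by (simp add: cone_form_def)
  obtain i where "v $ i \<noteq> 0" using v(2) by (auto simp: vec_eq_iff)
  then have "cone_form v (axis 1 1) \<noteq> 0 \<or> cone_form v (axis 2 1) \<noteq> 0 \<or> cone_form v (axis 3 1) \<noteq> 0 \<or> cone_form v (axis 4 1) \<noteq> 0"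
    using exhaust_4[of i] by (auto simp: cone_form_def axis_def)
  then obtain e where e: "cone_form v e \<noteq> 0" by blast
  then have e0: "e \<noteq> 0" using f0 by auto
  let ?T = "vec.span {e}"
  have S: "vec.subspace ?S" by (rule vec.subspaceI) (auto simp: cone_form_linear f0)
  have "x \<in> {x + y | x y. x \<in> ?S \<and> y \<in> ?T}" for x
  proof -
    define c where "c = cone_form v x / cone_form v e"
    have "cone_form v (x + (- c) *s e) = 0" using e by (simp only: cone_form_linear) (simp add: c_def)
    moreover have "c *s e \<in> ?T" by (intro vec.span_scale vec.span_base) simp
    moreover have "x = (x + (- c) *s e) + c *s e" by (simp add: vec_eq_iff)
    ultimately show ?thesis by blast
  qed
  then have sum: "{x + y | x y. x \<in> ?S \<and> y \<in> ?T} = UNIV" by blast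
  have "y = 0" if y: "y \<in> ?S \<inter> ?T" for y
  proof -
    obtain c where "y = c *s e" using y by (auto simp: vec.span_singleton)
    then show ?thesis using y e by (auto simp: cone_form_linear)
  qed
  then have int: "vec.dim (?S \<inter> ?T) = 0" unfolding vec.dim_eq_0 by blast
  have "vec.dim ?S + vec.dim ?T = 4"
    using vec.dim_sums_Int[OF S vec.subspace_span[of "{e}"]] unfolding sum int
    by (simp add: vec.dim_UNIV card_cart_basis)
  moreover have "vec.dim ?T = 1" using e0 by (simp add: vec.dim_singleton)
  ultimately show ?thesis by (simp add: tangent_cone[OF v(1)])
qed

section \<open>Parametrizations and dimension of the cone\<close>

lemma vector4_nth [simp]:
  "vector [a, b, c, d] $ (1 :: 4) = (a :: complex)" "vector [a, b, c, d] $ (2 :: 4) = (b :: complex)"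
  "vector [a, b, c, d] $ (3 :: 4) = (c :: complex)" "vector [a, b, c, d] $ (4 :: 4) = (d :: complex)"
  by (simp_all add: vector_def)

lemma pmap_vector4:
  assumes "pfun n a" "pfun n b" "pfun n c" "pfun n d"
  shows "pmap n (\<lambda>w. vector [a w, b w, c w, d w] :: complex ^ 4)"
  using assms by (simp add: pmap_def forall_4)

text \<open>Points of the cone are 2 by 2 matrices of rank at most one, written as a column times a
  row; the cases choose an entry to divide by.\<close>

lemma cone_param: "cone_points = range (\<lambda>w :: nat \<Rightarrow> complex. vector [w 0 * w 2, w 1 * w 3, w 0 * w 3, w 1 * w 2])"
proof (intro equalityI subsetI)
  fix v :: "complex ^ 4" assume v: "v \<in> cone_points"
  then have v': "v $ 1 * v $ 2 = v $ 3 * v $ 4" by (simp add: cone_points_def)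
  have "\<exists>x1 y1 x2 y2. v $ 1 = x1 * x2 \<and> v $ 2 = y1 * y2 \<and> v $ 3 = x1 * y2 \<and> v $ 4 = y1 * x2"
  proof -
    consider "v $ 1 \<noteq> 0" | "v $ 1 = 0" "v $ 3 \<noteq> 0" | "v $ 1 = 0" "v $ 3 = 0" by blast
    then show ?thesis
    proof cases
      case 1
      then show ?thesis using v'
        by (intro exI[of _ 1] exI[of _ "v $ 4 / v $ 1"] exI[of _ "v $ 1"] exI[of _ "v $ 3"]) (simp add: field_simps)
    next
      case 2
      then show ?thesis using v'
        by (intro exI[of _ 1] exI[of _ "v $ 2 / v $ 3"] exI[of _ "v $ 1"] exI[of _ "v $ 3"]) simp
    next
      case 3
      then show ?thesis by (intro exI[of _ 0] exI[of _ 1] exI[of _ "v $ 4"] exI[of _ "v $ 2"]) simp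
    qed
  qed
  then obtain x1 y1 x2 y2 where *: "v $ 1 = x1 * x2" "v $ 2 = y1 * y2" "v $ 3 = x1 * y2" "v $ 4 = y1 * x2" by blast
  define w :: "nat \<Rightarrow> complex" where "w i = [x1, y1, x2, y2] ! i" for i
  have "v = vector [w 0 * w 2, w 1 * w 3, w 0 * w 3, w 1 * w 2]"
    by (simp add: vec_eq_iff forall_4 * w_def)
  then show "v \<in> range (\<lambda>w :: nat \<Rightarrow> complex. vector [w 0 * w 2, w 1 * w 3, w 0 * w 3, w 1 * w 2])" by blast
qed (auto simp: cone_points_def)

lemma irreducible_cone: "irreducible_closed cone_points"
proof -
  have "pmap 4 (\<lambda>w. vector [w 0 * w 2, w 1 * w 3, w 0 * w 3, w 1 * w 2] :: complex ^ 4)"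
    by (intro pmap_vector4 pfun.intros) simp_all
  moreover have "zariski_closed cone_points" by (simp only: zariski_closed_zeros flip: zeros_cone_ideal)
  ultimately show ?thesis unfolding cone_param by (rule irreducible_closed_range)
qed

text \<open>Two affine charts whose images cover the cone minus its vertex, exchanged by
  \<open>a \<leftrightarrow> b\<close>, \<open>c \<leftrightarrow> d\<close>.\<close>

definition cone_chart :: "bool \<Rightarrow> (nat \<Rightarrow> complex) \<Rightarrow> complex ^ 4" where
  "cone_chart sw w = (if sw then vector [w 2 * w 1, w 0, w 0 * w 2, w 1] else vector [w 0, w 2 * w 1, w 1, w 0 * w 2])"

lemma cone_chart_cone: "cone_chart sw w \<in> cone_points"
  by (simp add: cone_chart_def cone_points_def)

lemma pmap_cone_chart:
  assumes "\<And>i. i < 3 \<Longrightarrow> pfun n (\<lambda>w. u w i)"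
  shows "pmap n (\<lambda>w. cone_chart sw (u w))"
  using assms by (cases sw) (simp_all add: cone_chart_def pmap_vector4 pfun.intros)

lemma cone_chart_surj:
  assumes v: "v \<in> cone_points"
  shows "v $ 1 \<noteq> 0 \<or> v $ 3 \<noteq> 0 \<Longrightarrow> \<exists>w. v = cone_chart False w"
    and "v $ 2 \<noteq> 0 \<or> v $ 4 \<noteq> 0 \<Longrightarrow> \<exists>w. v = cone_chart True w"
proof -
  have v': "v $ 1 * v $ 2 = v $ 3 * v $ 4" using v by (simp add: cone_points_def)
  {
    assume "v $ 1 \<noteq> 0 \<or> v $ 3 \<noteq> 0"
    define y where "y = (if v $ 1 \<noteq> 0 then v $ 4 / v $ 1 else v $ 2 / v $ 3)"
    define w :: "nat \<Rightarrow> complex" where "w i = [v $ 1, v $ 3, y] ! i" for i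
    have "v = cone_chart False w"
      using v' \<open>v $ 1 \<noteq> 0 \<or> v $ 3 \<noteq> 0\<close>
      by (auto simp: cone_chart_def vec_eq_iff forall_4 w_def y_def field_simps)
    then show "\<exists>w. v = cone_chart False w" by blast
  }
  {
    assume "v $ 2 \<noteq> 0 \<or> v $ 4 \<noteq> 0"
    define y where "y = (if v $ 2 \<noteq> 0 then v $ 3 / v $ 2 else v $ 1 / v $ 4)"
    define w :: "nat \<Rightarrow> complex" where "w i = [v $ 2, v $ 4, y] ! i" for i
    have "v = cone_chart True w"
      using v' \<open>v $ 2 \<noteq> 0 \<or> v $ 4 \<noteq> 0\<close>
      by (auto simp: cone_chart_def vec_eq_iff forall_4 w_def y_def field_simps)
    then show "\<exists>w. v = cone_chart True w" by blast
  }
qed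

text \<open>The three-parameter chart covers the part where the first coordinate is nonzero, and
  irreducibility makes that part dense in the cone.\<close>

lemma cone_chain_le: "irreducible_chain cone_points n C \<Longrightarrow> n \<le> 3"
proof (rule irreducible_chain_length_le)
  show "pmap 3 (cone_chart False)" by (rule pmap_cone_chart) (rule pfun.coord)
  fix p z assume p: "\<And>w. meval p (cone_chart False w) = 0" and z: "z \<in> cone_points"
  have 1: "meval (mvar 1) v * meval p v = 0" if v: "v \<in> cone_points" for v
  proof (cases "v $ 1 = 0")
    case False
    then obtain w where "v = cone_chart False w" using cone_chart_surj(1)[OF v] by blast
    then show ?thesis using p by simp
  qed simp
  have 2: "meval (mvar 1) (cone_chart False (\<lambda>_. 1)) \<noteq> 0" by (simp add: cone_chart_def)
  from irreducible_closed_mult_zero[OF irreducible_cone 1 cone_chart_cone 2 z] show "meval p z = 0" .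
qed

lemma cone_chain:
  assumes v: "v \<in> cone_points" "v \<noteq> 0"
  shows "\<exists>C. irreducible_chain cone_points 3 C \<and> v \<in> C 0"
proof -
  obtain i where "v $ i \<noteq> 0" using v(2) by (auto simp: vec_eq_iff)
  then have "\<exists>sw w. v = cone_chart sw w"
    using exhaust_4[of i] cone_chart_surj[OF v(1)] by blast
  then obtain sw w0 where v': "v = cone_chart sw w0" by blast
  define \<tau> where "\<tau> n w = (\<lambda>i. if i < n then w i else w0 i)" for n and w :: "nat \<Rightarrow> complex"
  define G where "G n w = cone_chart sw (\<tau> n w)" for n w
  define a c d :: 4 where "a = (if sw then 2 else 1)" and "c = (if sw then 4 else 3)" and "d = (if sw then 3 else 4)"
  have nth: "cone_chart sw w $ a = w 0" "cone_chart sw w $ c = w 1" "cone_chart sw w $ d = w 0 * w 2" for w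
    by (simp_all add: cone_chart_def a_def c_def d_def)
  have sep: "\<exists>p. (\<forall>w. meval p (G n w) = 0) \<and> (\<exists>w. meval p (G (Suc n) w) \<noteq> 0)" if n: "n < 3" for n
  proof -
    consider "n = 0" | "n = 1" | "n = 2" using n by linarith
    then show ?thesis
    proof cases
      case 1
      then show ?thesis
        by (intro exI[of _ "mvar a - mconst (w0 0)"] conjI exI[of _ "\<lambda>_. w0 0 + 1"]) (auto simp: G_def nth \<tau>_def)
    next
      case 2
      then show ?thesis
        by (intro exI[of _ "mvar c - mconst (w0 1)"] conjI exI[of _ "\<lambda>_. w0 1 + 1"]) (auto simp: G_def nth \<tau>_def)
    next
      \<comment> \<open>The third parameter is visible only as the ratio of coordinate
        \<open>d\<close> to coordinate \<open>a\<close>, so the separating polynomial is linear in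
        the two, and the witness has \<open>w 0 = 1\<close> to keep \<open>a\<close>
        nonzero.\<close>
      case 3
      then show ?thesis
        by (intro exI[of _ "mvar d - mconst (w0 2) * mvar a"] conjI exI[of _ "\<lambda>i. if i = 0 then 1 else w0 2 + 1"])
          (auto simp: G_def nth \<tau>_def)
    qed
  qed
  have "irreducible_chain cone_points 3 (\<lambda>n. Zariski_closure (range (G n)))"
  proof (rule irreducible_chainI[where m=3])
    have "pfun 3 (\<lambda>w. \<tau> n w i)" if "i < 3" for n i
      using that by (cases "i < n") (simp_all add: \<tau>_def pfun.intros)
    then show "pmap 3 (G n)" for n unfolding G_def by (rule pmap_cone_chart)
    show "zariski_closed cone_points" by (rule irreducible_closed_closed[OF irreducible_cone])
    show "G 3 w \<in> cone_points" for w unfolding G_def by (rule cone_chart_cone)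
    show "range (G n) \<subseteq> range (G (Suc n))" for n
    proof
      fix x assume "x \<in> range (G n)"
      then obtain w where "x = G n w" by blast
      also have "G n w = G (Suc n) (\<tau> n w)" unfolding G_def by (rule arg_cong[of _ _ "cone_chart sw"]) (auto simp: \<tau>_def)
      finally show "x \<in> range (G (Suc n))" by blast
    qed
  qed (rule sep)
  moreover have "v \<in> Zariski_closure (range (G 0))"
    by (rule subsetD[OF Zariski_closure_superset]) (auto simp: v' G_def \<tau>_def)
  ultimately show ?thesis by (intro exI[of _ "\<lambda>n. Zariski_closure (range (G n))"] conjI)
qed

text \<open>Off the vertex both the tangent space and the cone have dimension 3. At the vertex the
  differential of the equation is zero, so the tangent space is all of four-space while no chain is
  longer than 3.\<close>

theorem cone_singular_locus: "{v \<in> zeros cone_ideal. \<not> smooth_at cone_ideal v} = {0}"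
proof -
  have "smooth_at cone_ideal v" if v: "v \<in> cone_points" "v \<noteq> 0" for v
  proof -
    have "local_dim cone_points v = enat 3"
      unfolding local_dim_def using cone_chain_le cone_chain[OF v] by (intro Sup_enat_eqI) blast+
    then show ?thesis by (simp add: smooth_at_def zeros_cone_ideal dim_tangent_cone[OF v])
  qed
  moreover have "(0 :: complex ^ 4) \<in> cone_points" by (simp add: cone_points_def)
  moreover have "\<not> smooth_at cone_ideal 0"
  proof -
    have "tangent_space cone_ideal 0 = UNIV"
      using tangent_cone[OF \<open>0 \<in> cone_points\<close>] by (simp add: cone_form_def)
    then have "vec.dim (tangent_space cone_ideal (0 :: complex ^ 4)) = 4"
      by (simp add: vec.dim_UNIV card_cart_basis)
    moreover have "enat 4 \<noteq> local_dim cone_points 0"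
    proof
      assume "enat 4 = local_dim cone_points 0"
      also have "\<dots> \<le> enat 3"
        unfolding local_dim_def using cone_chain_le by (intro Sup_least) auto
      finally show False by simp
    qed
    ultimately show ?thesis by (simp add: smooth_at_def zeros_cone_ideal)
  qed
  ultimately show ?thesis unfolding zeros_cone_ideal by blast
qed

theorem proposition5p7:
  shows "smooth_scheme conifold_rep2 \<and>
    (\<exists>p q. irreducible_components (zeros conifold_rep2) = {{p}, {q}, zeros conifold_trep2}) \<and>
    card (irreducible_components (zeros conifold_rep2)) = 3 \<and>
    pairwise disjnt (irreducible_components (zeros conifold_rep2)) \<and>
    variety_dim (zeros conifold_trep2) = 6 \<and>
    smooth_order TYPE(2) conifold_relations \<and>
    (\<lambda>P. P \<inter> centre conifold_algebra)
      \<in> prime_spectrum conifold_algebra \<rightarrow> {p. primeideal p (centre_ring conifold_algebra)} \<and>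
    (\<exists>\<theta> s. \<theta> \<in> ring_iso cone_ring (centre_ring conifold_algebra) \<and>
       (\<forall>c. \<theta> (cone_ideal +>\<^bsub>ring_of_type_algebra\<^esub> mconst c) =
              residue_class conifold_relations (fconst c)) \<and>
       {v \<in> zeros cone_ideal. \<not> smooth_at cone_ideal v} = {s} \<and>
       bij_betw (\<lambda>P. P \<inter> centre conifold_algebra)
         {P \<in> prime_spectrum conifold_algebra.
            P \<inter> centre conifold_algebra \<noteq> \<theta> ` point_ideal cone_ideal s}
         ({p. primeideal p (centre_ring conifold_algebra)} - {\<theta> ` point_ideal cone_ideal s}))"
proof (intro conjI)
  show "smooth_scheme conifold_rep2" by (rule smooth_rep2)
  have comp: "irreducible_components (zeros conifold_rep2) = {{rep_p}, {rep_q}, Trep}"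
    unfolding irreducible_components_rep2 by blast
  then show "\<exists>p q. irreducible_components (zeros conifold_rep2) = {{p}, {q}, zeros conifold_trep2}"
    unfolding zeros_conifold_trep2 by blast
  have ne: "{rep_p} \<noteq> {rep_q}" "{rep_p} \<noteq> Trep" "{rep_q} \<noteq> Trep" using rep_pq_notin by blast+
  then show "card (irreducible_components (zeros conifold_rep2)) = 3" by (simp add: comp)
  show "pairwise disjnt (irreducible_components (zeros conifold_rep2))"
    unfolding comp using rep_pq_notin by (auto simp: pairwise_insert disjnt_def)
  show "variety_dim (zeros conifold_trep2) = 6" by (simp add: zeros_conifold_trep2 variety_dim_Trep)
  show "smooth_order TYPE(2) conifold_relations" by (rule smooth_order_conifold)
  show "(\<lambda>P. P \<inter> centre conifold_algebra)
      \<in> prime_spectrum conifold_algebra \<rightarrow> {p. primeideal p (centre_ring conifold_algebra)}"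
    by (rule prime_spectrum_centre)
  show "\<exists>\<theta> s. \<theta> \<in> ring_iso cone_ring (centre_ring conifold_algebra) \<and>
       (\<forall>c. \<theta> (cone_ideal +>\<^bsub>ring_of_type_algebra\<^esub> mconst c) =
              residue_class conifold_relations (fconst c)) \<and>
       {v \<in> zeros cone_ideal. \<not> smooth_at cone_ideal v} = {s} \<and>
       bij_betw (\<lambda>P. P \<inter> centre conifold_algebra)
         {P \<in> prime_spectrum conifold_algebra.
            P \<inter> centre conifold_algebra \<noteq> \<theta> ` point_ideal cone_ideal s}
         ({p. primeideal p (centre_ring conifold_algebra)} - {\<theta> ` point_ideal cone_ideal s})"
    by (intro exI[of _ cone_iso] exI[of _ "0 :: complex ^ 4"] conjI allI cone_iso_ring_iso cone_iso_mconst
        cone_singular_locus prime_spectrum_bij)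
qed

end
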